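(* Let $f:\mathbb{R}^d\to\mathbb{R}$ and $\mathbf{c}:\mathbb{R}^d\to\mathbb{R}^c$ be twice continuously differentiable, let $(\varepsilon_c,\varepsilon_p)\in(0,1)^2$, and run the Indirect Primal-Dual Newton-MR Algorithm (described in the context). Let $\mathcal{X}$ denote the set containing all iterates and trial points generated by the algorithm, and suppose: (i) there are constants $0<\sigma_J\le\kappa_J<\infty$ such that $\sigma_J\le\sigma_c(x)\le\sigma_1(x)\le\kappa_J$ for all $x\in\mathcal{X}$, where $\sigma_1(x)$ and $\sigma_c(x)$ are the largest and the $c$-th largest singular values of the Jacobian $J(x)$; (ii) on $\mathcal{X}$, $\nabla f$ is $L_f$-Lipschitz continuous, $J$ is $L_c$-Lipschitz continuous, and $f$ is bounded below by $f_{\mathrm{low}}$; (iii) $\|\nabla f(x)\|\le\kappa_g$ for all $x\in\mathcal{X}$; (iv) $\|\mathbf{c}(x)\|\le\kappa_c$ for all $x\in\mathcal{X}$. Then the algorithm reaches a point $x_k$ satisfying $$\|\mathbf{c}(x_k)\|\le\varepsilon_c\quad\text{and}\quad\|P_{\mathcal{N}(J(x_k))}\nabla f(x_k)\|\le\varepsilon_p$$ in at most $$K=\left\lceil\frac{(f(x_0)-f_{\mathrm{low}})/\pi_{-1}+\|\mathbf{c}(x_0)\|}{\min\{\Gamma_c',\Gamma_p'\}\,\min\{\varepsilon_c,\varepsilon_p^2\}}\right\rceil+1$$ iterations, where $\Gamma_c',\Gamma_p'>0$ are the constants $$\Gamma_c'=\tilde\alpha\,\eta\,\rho\,\gamma_{\mathrm{norm}},\qquad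 \Gamma_p'=\frac{\tilde\alpha\,\eta\,(1-\tau_{\mathrm{null}})\,\gamma_{\tan}\,\omega_{\tan}^2}{\tilde\pi},$$ $$\gamma_{\mathrm{norm}}=1-\tau_{\mathrm{norm}},\quad \nu_u=\frac1{\sigma_J},\quad \gamma_{\tan}=\min\{1,\sigma\},\quad \omega_{\tan}=\min\left\{\frac{\sigma}{\kappa_{\mathcal L}^2},\frac{\tau_{\tan}}{\sqrt{\tau_{\tan}^2+\kappa_{\mathcal L}^2}}\right\},$$ $$\tilde\pi=\max\left\{\frac{\kappa_g\nu_u}{(1-\rho)\gamma_{\mathrm{norm}}},\pi_{-1}\right\},\qquad \tilde\alpha=\min\left\{1,\ \frac{\theta(1-\eta)\min\{(1-\tau_{\mathrm{null}})\gamma_{\tan},\ \pi_{-1}\gamma_{\mathrm{norm}}\rho\}}{(\tilde\pi L_c+L_f)\max\{1,\kappa_c\nu_u^2\}}\right\},$$ and $\kappa_{\mathcal L}$ is a uniform bound on the Lagrangian Hessian, $\|\nabla^2_{xx}\mathcal{L}(x_k,\lambda_{k+1})\|\le\kappa_{\mathcal L}$ over all $k$ for which $\lambda_{k+1}$ is computed (the existence of which is a consequence of (i)-(iii)).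
   Context: Notation. $J(x)\in\mathbb{R}^{c\times d}$ is the Jacobian of $\mathbf{c}$; $\mathcal{L}(x,\lambda)=f(x)+\langle\lambda,\mathbf{c}(x)\rangle$; $\|\cdot\|$ is the Euclidean norm for vectors and the operator norm for matrices; $P_{\mathcal{N}(J)}$ is the orthogonal projector onto the null space of $J$; $\mathcal{R}(\cdot)$ is the range; $\mathcal{K}_t(A,b)=\mathrm{span}\{b,Ab,\dots,A^{t-1}b\}$. Subscript $k$ means evaluation at $x_k$. Merit function: $\phi(x;\pi)=f(x)+\pi\|\mathbf{c}(x)\|$. Also $$\bar D(x,p;\pi)=\langle\nabla f(x),p\rangle+\pi\big(\|\mathbf{c}(x)+J(x)p\|-\|\mathbf{c}(x)\|\big).$$ Inexact normal component (LSMR). Given $J,\mathbf{c}$ and $\tau_{\mathrm{norm}}\in(0,1)$, let $v^{(t)}=\arg\min\{\|J^\top Jv+J^\top\mathbf{c}\|: v\in\mathcal{K}_t(J^\top J,J^\top\mathbf{c})\}$, $t=1,2,\dots$; return the first $v^{(t)}$ with $\|Jv^{(t)}+\mathbf{c}\|\le\tau_{\mathrm{norm}}\|\mathbf{c}\|$. Projected CR (indirect termination). Inputs: symmetric $H\in\mathbb{R}^{d\times d}$, $g\in\mathbb{R}^d$, an orthogonal projection $P=ZZ^\top$ ($Z$ with orthonormal columns), the Jacobian $J$, $\pi>0$, $\sigma>0$, $\tau_{\tan}>0$, $\tau_{\mathrm{null}}\in(0,1)$. Put $\bar H=Z^\top HZ$, $\bar g=Z^\top g$, $\bar d^{(0)}=0$,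 $\bar r^{(0)}=y^{(0)}=-\bar g$, and write $d^{(t)}=Z\bar d^{(t)}$, $r^{(t)}=Z\bar r^{(t)}$. If $\langle\bar r^{(0)},\bar H\bar r^{(0)}\rangle\le(d+1)\sigma\|\bar r^{(0)}\|^2$, return $r^{(0)}$ (flag LPC). Otherwise, for $t=1,2,\dots$: $\zeta_{t-1}=\langle\bar r^{(t-1)},\bar H\bar r^{(t-1)}\rangle/\|\bar Hy^{(t-1)}\|^2$, $\bar d^{(t)}=\bar d^{(t-1)}+\zeta_{t-1}y^{(t-1)}$, $\bar r^{(t)}=\bar r^{(t-1)}-\zeta_{t-1}\bar Hy^{(t-1)}$, $\beta_{t-1}=\langle\bar r^{(t)},\bar H\bar r^{(t)}\rangle/\langle\bar r^{(t-1)},\bar H\bar r^{(t-1)}\rangle$, $y^{(t)}=\bar r^{(t)}+\beta_{t-1}y^{(t-1)}$; then: (a) if $\|Jd^{(t)}\|>-\frac{\tau_{\mathrm{null}}}{\pi}\langle g,d^{(t)}\rangle$, return $d^{(t-1)}$ (flag SOL); (b) else if $\|\bar H\bar r^{(t)}\|\le\tau_{\tan}\|\bar H\bar d^{(t)}\|$, return $d^{(t)}$ (flag SOL); (c) else if $\langle\bar r^{(t)},\bar H\bar r^{(t)}\rangle\le(d+1)\sigma\|\bar r^{(t)}\|^2$: return $d^{(t)}$ (flag SOL) if $\|Jr^{(t)}\|>-\frac{\tau_{\mathrm{null}}}{\pi}\langle g,r^{(t)}\rangle$, and return $r^{(t)}$ (flag LPC) otherwise; (d) else continue. Indirect Primal-Dual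 Newton-MR Algorithm. Parameters: $(\varepsilon_c,\varepsilon_p)\in(0,1)^2$, $\tau_{\mathrm{norm}},\tau_{\mathrm{null}}\in(0,1)$, $\tau_{\tan}>0$, $\sigma>0$, initial point $(x_0,\lambda_0)$, $\pi_{-1}>0$, $\rho,\eta,\theta\in(0,1)$; $\gamma_{\mathrm{norm}}=1-\tau_{\mathrm{norm}}$. For $k=0,1,2,\dots$: 1. Let $v_k$ be the inexact normal component for $J_k,\mathbf{c}_k,\tau_{\mathrm{norm}}$. 2. Set $\pi_k^{\mathrm{trial}}=\langle\nabla f_k,v_k\rangle/((1-\rho)\gamma_{\mathrm{norm}}\|\mathbf{c}_k\|)$ if $\mathbf{c}_k\neq0$ and $\pi_k^{\mathrm{trial}}=0$ otherwise; $\pi_k=\max\{\pi_k^{\mathrm{trial}},\pi_{k-1}\}$. 3. Apply any range-finding procedure producing a matrix $\hat\Omega_k$ with orthonormal columns and $\mathcal{R}(\hat\Omega_k)\subseteq\mathcal{R}(J_k^\top)$ such that $\hat P_k=I-\hat\Omega_k\hat\Omega_k^\top$ satisfies $\|J_k\hat P_k\nabla f_k\|\le\frac{\tau_{\mathrm{null}}}{\pi_k}\langle\nabla f_k,\hat P_k\nabla f_k\rangle$ or $\|\hat P_k\nabla f_k\|\le\varepsilon_p$. 4. If $\|\mathbf{c}_k\|\le\varepsilon_c$ and $\|\hat P_k\nabla f_k\|\le\varepsilon_p$, stop and return $x_k$. 5. If $\|\hat P_k\nabla f_k\|\le\varepsilon_p$, set $w_k=0$. Otherwise choose $\lambda_{k+1}$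 to be either $0$ or an LSMR iterate $\arg\min\{\|J_kJ_k^\top\lambda+J_k\nabla f_k\|:\lambda\in\mathcal{K}_t(J_kJ_k^\top,J_k\nabla f_k)\}$ for some $t\ge1$, and let $w_k$ be the vector returned by projected CR (indirect termination) with $H=\nabla^2_{xx}\mathcal{L}(x_k,\lambda_{k+1})$, $g=\nabla f_k$, $P=\hat P_k$, $J=J_k$, $\pi=\pi_k$, $\sigma,\tau_{\tan},\tau_{\mathrm{null}}$. 6. Set $p_k=v_k+w_k$ and, by backtracking over $\alpha\in\{1,\theta,\theta^2,\dots\}$, take $\alpha_k$ to be the first $\alpha$ with $\phi(x_k+\alpha p_k;\pi_k)\le\phi(x_k;\pi_k)+\alpha\eta\,\bar D(x_k,p_k;\pi_k)$. 7. Set $x_{k+1}=x_k+\alpha_kp_k$.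
   Formalization: The set X is required to contain every whole segment from x_k to x_k+p_k, not only the tested trial points, and the parenthetical existence of κ_L is proved for open X; with only the discrete iterates and trial points both claims fail. *)

theory Defs
  imports "HOL-Analysis.Analysis" "HOL-Library.Multiset"
begin

section \<open>Calculus and linear algebra\<close>

definition C1 :: "('a::euclidean_space \<Rightarrow> 'b::euclidean_space) \<Rightarrow> bool" where
  "C1 h \<longleftrightarrow> (\<forall>x. h differentiable at x) \<and>
     (\<forall>u. continuous_on UNIV (\<lambda>x. frechet_derivative h (at x) u))"

definition C2 :: "('a::euclidean_space \<Rightarrow> 'b::euclidean_space) \<Rightarrow> bool" where
  "C2 h \<longleftrightarrow> C1 h \<and> (\<forall>u. C1 (\<lambda>x. frechet_derivative h (at x) u))"

definition grad :: "('a::real_inner \<Rightarrow> real) \<Rightarrow> 'a \<Rightarrow> 'a" where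
  "grad h x = (THE D. GDERIV h x :> D)"

abbreviation Jac :: "(real^'d \<Rightarrow> real^'c) \<Rightarrow> real^'d \<Rightarrow> real^'d^'c" where
  "Jac h x \<equiv> jacobian h (at x)"

definition hessian :: "(real^'d \<Rightarrow> real) \<Rightarrow> real^'d \<Rightarrow> real^'d^'d" where
  "hessian h x = Jac (grad h) x"

definition lagrangian ::
  "(real^'d \<Rightarrow> real) \<Rightarrow> (real^'d \<Rightarrow> real^'c) \<Rightarrow> real^'d \<Rightarrow> real^'c \<Rightarrow> real" where
  "lagrangian f c x l = f x + l \<bullet> c x"

text \<open>The norm of the type \<^typ>\<open>real^'n^'m\<close> is the Frobenius norm; matrices are measured here
  by their operator norm.\<close>

abbreviation opnorm :: "real^'n^'m \<Rightarrow> real" where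
  "opnorm A \<equiv> onorm (\<lambda>v. A *v v)"

definition orth_proj :: "'a::real_inner set \<Rightarrow> 'a \<Rightarrow> 'a" where
  "orth_proj S x = (THE y. y \<in> S \<and> (\<forall>z\<in>S. orthogonal (x - y) z))"

definition null_space :: "real^'n^'m \<Rightarrow> (real^'n) set" where
  "null_space A = {v. A *v v = 0}"

text \<open>Eigenvalues with geometric multiplicity. They are used only for the symmetric matrix
  \<open>A A\<^sup>T\<close>, where geometric and algebraic multiplicities agree.\<close>

definition eigenvalues_mset :: "real^'n^'n \<Rightarrow> real multiset" where
  "eigenvalues_mset M =
     (\<Sum>\<mu>\<in>{\<mu>. \<exists>v. v \<noteq> 0 \<and> M *v v = \<mu> *\<^sub>R v}.
        replicate_mset (dim {v. M *v v = \<mu> *\<^sub>R v}) \<mu>)"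

text \<open>The \<open>i\<close>-th largest singular value (\<open>i = 1, \<dots>, CARD('m)\<close>). If \<open>CARD('m) > CARD('n)\<close>, the
  singular values with index above \<open>CARD('n)\<close> are \<open>0\<close>.\<close>

definition singular_value :: "nat \<Rightarrow> real^'n^'m \<Rightarrow> real" where
  "singular_value i A =
     sqrt (rev (sorted_list_of_multiset (eigenvalues_mset (A ** transpose A))) ! (i - 1))"

definition krylov :: "nat \<Rightarrow> real^'n^'n \<Rightarrow> real^'n \<Rightarrow> (real^'n) set" where
  "krylov t A b = span {((\<lambda>v. A *v v) ^^ i) b | i. i < t}"

text \<open>Matrices with orthonormal columns occur with a number of columns that varies from iteration
  to iteration. They are padded with zero columns to a fixed width: the nonzero columns are the
  actual columns. For such \<open>Z\<close>, the vectors \<open>Z\<^sup>T u\<close> and the matrices \<open>Z\<^sup>T H Z\<close> are the unpadded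
  ones extended by zeros; \<open>Z Z\<^sup>T\<close> and the range of \<open>Z\<close> are unaffected.\<close>

definition orthonormal_columns :: "real^'m^'n \<Rightarrow> bool" where
  "orthonormal_columns Z \<longleftrightarrow>
     (\<forall>i j. i \<noteq> j \<longrightarrow> orthogonal (column i Z) (column j Z)) \<and>
     (\<forall>j. column j Z = 0 \<or> norm (column j Z) = 1)"

section \<open>Subroutines\<close>

text \<open>The loops below are total functions, with \<^term>\<open>Least\<close> selecting the first index at which
  a loop exits. That this index exists, and that the minimizers exist and are unique, is not built
  into the definitions.\<close>

definition lsmr_iterate :: "real^'n^'m \<Rightarrow> real^'m \<Rightarrow> nat \<Rightarrow> real^'n" where
  "lsmr_iterate A b t =
     arg_min_on (\<lambda>v. norm ((transpose A ** A) *v v + transpose A *v b))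
       (krylov t (transpose A ** A) (transpose A *v b))"

definition inexact_normal :: "real^'n^'m \<Rightarrow> real^'m \<Rightarrow> real \<Rightarrow> real^'n" where
  "inexact_normal J b \<tau> =
     lsmr_iterate J b (LEAST t. 1 \<le> t \<and> norm (J *v lsmr_iterate J b t + b) \<le> \<tau> * norm b)"

text \<open>The triple \<open>(d, r, y)\<close> of the conjugate residual iterates with index \<open>t\<close>, in reduced
  coordinates.\<close>

primrec cr_iterate :: "real^'m^'m \<Rightarrow> real^'m \<Rightarrow> nat \<Rightarrow> (real^'m) \<times> (real^'m) \<times> (real^'m)" where
  "cr_iterate H g 0 = (0, - g, - g)"
| "cr_iterate H g (Suc t) =
     (case cr_iterate H g t of (d, r, y) \<Rightarrow>
       let \<zeta> = (r \<bullet> (H *v r)) / (norm (H *v y))\<^sup>2;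
           d' = d + \<zeta> *\<^sub>R y;
           r' = r - \<zeta> *\<^sub>R (H *v y);
           \<beta> = (r' \<bullet> (H *v r')) / (r \<bullet> (H *v r))
       in (d', r', r' + \<beta> *\<^sub>R y))"

definition projected_cr ::
  "real^'d^'d \<Rightarrow> real^'d \<Rightarrow> real^'m^'d \<Rightarrow> real^'d^'c \<Rightarrow> real \<Rightarrow> real \<Rightarrow> real \<Rightarrow> real \<Rightarrow> real^'d" where
  "projected_cr H g Z J \<pi> \<sigma> \<tau>tan \<tau>null =
     (let Hbar = transpose Z ** H ** Z;
          gbar = transpose Z *v g;
          dbar = (\<lambda>t. fst (cr_iterate Hbar gbar t));
          rbar = (\<lambda>t. fst (snd (cr_iterate Hbar gbar t)));
          d = (\<lambda>t. Z *v dbar t);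
          r = (\<lambda>t. Z *v rbar t);
          infeasible = (\<lambda>u. norm (J *v u) > - (\<tau>null / \<pi>) * (g \<bullet> u));
          converged = (\<lambda>t. norm (Hbar *v rbar t) \<le> \<tau>tan * norm (Hbar *v dbar t));
          low_curvature = (\<lambda>t. rbar t \<bullet> (Hbar *v rbar t)
                                 \<le> (real CARD('d) + 1) * \<sigma> * (norm (rbar t))\<^sup>2);
          T = (LEAST t. 1 \<le> t \<and> (infeasible (d t) \<or> converged t \<or> low_curvature t))
      in if low_curvature 0 then r 0
         else if infeasible (d T) then d (T - 1)
         else if converged T then d T
         else if infeasible (r T) then d T
         else r T)"

section \<open>The algorithm\<close>

record pdnmr_params =
  eps_c :: real
  eps_p :: real
  tau_norm :: real
  tau_null :: real
  tau_tan :: real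
  sigma :: real
  rho :: real
  eta :: real
  theta :: real
  pen_init :: real  \<comment> \<open>the penalty parameter with index \<open>-1\<close>\<close>

definition valid_params :: "pdnmr_params \<Rightarrow> bool" where
  "valid_params P \<longleftrightarrow>
     eps_c P \<in> {0<..<1} \<and> eps_p P \<in> {0<..<1} \<and>
     tau_norm P \<in> {0<..<1} \<and> tau_null P \<in> {0<..<1} \<and>
     0 < tau_tan P \<and> 0 < sigma P \<and> 0 < pen_init P \<and>
     rho P \<in> {0<..<1} \<and> eta P \<in> {0<..<1} \<and> theta P \<in> {0<..<1}"

text \<open>The quantities of a run, indexed by the iteration. The range finder's matrix has at most
  \<open>CARD('c)\<close> columns, since its range lies in that of \<open>J\<^sup>T\<close>. Entries for iterations that are
  not reached are unconstrained.\<close>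

record ('d, 'c) pdnmr_trace =
  iter :: "nat \<Rightarrow> real^'d"
  mult :: "nat \<Rightarrow> real^'c"
  normal_step :: "nat \<Rightarrow> real^'d"
  pen :: "nat \<Rightarrow> real"
  Omega :: "nat \<Rightarrow> real^'c^'d"
  Zmat :: "nat \<Rightarrow> real^'d^'d"
  tan_step :: "nat \<Rightarrow> real^'d"
  step :: "nat \<Rightarrow> real^'d"
  step_size :: "nat \<Rightarrow> real"

definition pen_prev ::
  "pdnmr_params \<Rightarrow> ('d::finite, 'c::finite) pdnmr_trace \<Rightarrow> nat \<Rightarrow> real" where
  "pen_prev P T k = (case k of 0 \<Rightarrow> pen_init P | Suc j \<Rightarrow> pen T j)"

definition Phat :: "('d::finite, 'c::finite) pdnmr_trace \<Rightarrow> nat \<Rightarrow> real^'d^'d" where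
  "Phat T k = mat 1 - Omega T k ** transpose (Omega T k)"

definition merit ::
  "(real^'d \<Rightarrow> real) \<Rightarrow> (real^'d \<Rightarrow> real^'c) \<Rightarrow> real \<Rightarrow> real^'d \<Rightarrow> real" where
  "merit f c \<pi> x = f x + \<pi> * norm (c x)"

definition Dbar ::
  "(real^'d \<Rightarrow> real) \<Rightarrow> (real^'d \<Rightarrow> real^'c) \<Rightarrow> real \<Rightarrow> real^'d \<Rightarrow> real^'d \<Rightarrow> real" where
  "Dbar f c \<pi> x p = grad f x \<bullet> p + \<pi> * (norm (c x + Jac c x *v p) - norm (c x))"

definition backtrack ::
  "(real^'d \<Rightarrow> real) \<Rightarrow> (real^'d \<Rightarrow> real^'c) \<Rightarrow> real \<Rightarrow> real \<Rightarrow> real \<Rightarrow> real^'d \<Rightarrow> real^'d \<Rightarrow> real" where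
  "backtrack f c \<theta> \<eta> \<pi> x p =
     \<theta> ^ (LEAST j. merit f c \<pi> (x + \<theta> ^ j *\<^sub>R p)
                    \<le> merit f c \<pi> x + \<theta> ^ j * \<eta> * Dbar f c \<pi> x p)"

definition small_proj_grad ::
  "(real^'d \<Rightarrow> real) \<Rightarrow> pdnmr_params \<Rightarrow> ('d::finite, 'c::finite) pdnmr_trace \<Rightarrow> nat \<Rightarrow> bool" where
  "small_proj_grad f P T k \<longleftrightarrow> norm (Phat T k *v grad f (iter T k)) \<le> eps_p P"

definition stops ::
  "(real^'d \<Rightarrow> real) \<Rightarrow> (real^'d \<Rightarrow> real^'c) \<Rightarrow> pdnmr_params \<Rightarrow>
     ('d::finite, 'c::finite) pdnmr_trace \<Rightarrow> nat \<Rightarrow> bool" where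
  "stops f c P T k \<longleftrightarrow> norm (c (iter T k)) \<le> eps_c P \<and> small_proj_grad f P T k"

definition reached ::
  "(real^'d \<Rightarrow> real) \<Rightarrow> (real^'d \<Rightarrow> real^'c) \<Rightarrow> pdnmr_params \<Rightarrow>
     ('d::finite, 'c::finite) pdnmr_trace \<Rightarrow> nat \<Rightarrow> bool" where
  "reached f c P T k \<longleftrightarrow> (\<forall>j<k. \<not> stops f c P T j)"

definition pen_trial ::
  "(real^'d \<Rightarrow> real) \<Rightarrow> (real^'d \<Rightarrow> real^'c) \<Rightarrow> pdnmr_params \<Rightarrow> real^'d \<Rightarrow> real^'d \<Rightarrow> real" where
  "pen_trial f c P x v =
     (if c x \<noteq> 0 then (grad f x \<bullet> v) / ((1 - rho P) * (1 - tau_norm P) * norm (c x)) else 0)"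

definition normal_phase ::
  "(real^'d \<Rightarrow> real) \<Rightarrow> (real^'d \<Rightarrow> real^'c) \<Rightarrow> pdnmr_params \<Rightarrow>
     ('d::finite, 'c::finite) pdnmr_trace \<Rightarrow> nat \<Rightarrow> bool" where
  "normal_phase f c P T k \<longleftrightarrow>
     (let x = iter T k; J = Jac c x; g = grad f x; v = normal_step T k in
        v = inexact_normal J (c x) (tau_norm P) \<and>
        pen T k = max (pen_trial f c P x v) (pen_prev P T k) \<and>
        orthonormal_columns (Omega T k) \<and>
        range (\<lambda>u. Omega T k *v u) \<subseteq> range (\<lambda>u. transpose J *v u) \<and>
        (norm (J *v (Phat T k *v g)) \<le> tau_null P / pen T k * (g \<bullet> (Phat T k *v g)) \<or>
         norm (Phat T k *v g) \<le> eps_p P))"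

definition tangential_phase ::
  "(real^'d \<Rightarrow> real) \<Rightarrow> (real^'d \<Rightarrow> real^'c) \<Rightarrow> pdnmr_params \<Rightarrow>
     ('d::finite, 'c::finite) pdnmr_trace \<Rightarrow> nat \<Rightarrow> bool" where
  "tangential_phase f c P T k \<longleftrightarrow>
     (let x = iter T k; J = Jac c x; g = grad f x; l = mult T (Suc k); Z = Zmat T k in
        if small_proj_grad f P T k then tan_step T k = 0
        else
          (l = 0 \<or> (\<exists>t\<ge>1. l = lsmr_iterate (transpose J) g t)) \<and>
          orthonormal_columns Z \<and> Phat T k = Z ** transpose Z \<and>
          tan_step T k =
            projected_cr (hessian (\<lambda>z. lagrangian f c z l) x) g Z J (pen T k)
              (sigma P) (tau_tan P) (tau_null P))"

definition update_phase ::
  "(real^'d \<Rightarrow> real) \<Rightarrow> (real^'d \<Rightarrow> real^'c) \<Rightarrow> pdnmr_params \<Rightarrow>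
     ('d::finite, 'c::finite) pdnmr_trace \<Rightarrow> nat \<Rightarrow> bool" where
  "update_phase f c P T k \<longleftrightarrow>
     step T k = normal_step T k + tan_step T k \<and>
     step_size T k = backtrack f c (theta P) (eta P) (pen T k) (iter T k) (step T k) \<and>
     iter T (Suc k) = iter T k + step_size T k *\<^sub>R step T k"

definition pdnmr_run ::
  "(real^'d \<Rightarrow> real) \<Rightarrow> (real^'d \<Rightarrow> real^'c) \<Rightarrow> pdnmr_params \<Rightarrow> real^'d \<Rightarrow> real^'c \<Rightarrow>
     ('d::finite, 'c::finite) pdnmr_trace \<Rightarrow> bool" where
  "pdnmr_run f c P x0 l0 T \<longleftrightarrow>
     iter T 0 = x0 \<and> mult T 0 = l0 \<and>
     (\<forall>k. reached f c P T k \<longrightarrow> normal_phase f c P T k) \<and>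
     (\<forall>k. reached f c P T k \<and> \<not> stops f c P T k \<longrightarrow>
        tangential_phase f c P T k \<and> update_phase f c P T k)"

text \<open>The iterates together with the trial points \<open>x\<^sub>k + \<alpha> p\<^sub>k\<close>, where \<open>\<alpha>\<close> ranges over all of
  \<open>[0, 1]\<close> and not only over the powers of the backtracking factor: with the discrete set alone,
  Lipschitz continuity of the gradient gives no control of the function along the step.\<close>

definition visited ::
  "(real^'d \<Rightarrow> real) \<Rightarrow> (real^'d \<Rightarrow> real^'c) \<Rightarrow> pdnmr_params \<Rightarrow>
     ('d::finite, 'c::finite) pdnmr_trace \<Rightarrow> (real^'d) set" where
  "visited f c P T =
     {iter T k | k. reached f c P T k} \<union>
     (\<Union>k\<in>{k. reached f c P T k \<and> \<not> stops f c P T k}.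
        {iter T k + \<alpha> *\<^sub>R step T k | \<alpha>. 0 \<le> \<alpha> \<and> \<alpha> \<le> 1})"

text \<open>The multiplier with index \<open>k + 1\<close> is computed exactly in the iterations \<open>k\<close> below.\<close>

definition lagrangian_hessian_bound ::
  "(real^'d \<Rightarrow> real) \<Rightarrow> (real^'d \<Rightarrow> real^'c) \<Rightarrow> pdnmr_params \<Rightarrow>
     ('d::finite, 'c::finite) pdnmr_trace \<Rightarrow> real \<Rightarrow> bool" where
  "lagrangian_hessian_bound f c P T \<kappa> \<longleftrightarrow>
     0 \<le> \<kappa> \<and>
     (\<forall>k. reached f c P T k \<and> \<not> stops f c P T k \<and> \<not> small_proj_grad f P T k \<longrightarrow>
        opnorm (hessian (\<lambda>z. lagrangian f c z (mult T (Suc k))) (iter T k)) \<le> \<kappa>)"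

section \<open>Constants of the complexity bound\<close>

text \<open>A quotient of a positive number by zero is read as infinity in both minima (in HOL it would
  be \<open>0\<close>); the case distinctions implement this.\<close>

definition omega_tan :: "pdnmr_params \<Rightarrow> real \<Rightarrow> real" where
  "omega_tan P \<kappa>L =
     (if \<kappa>L = 0 then tau_tan P / sqrt ((tau_tan P)\<^sup>2 + \<kappa>L\<^sup>2)
      else min (sigma P / \<kappa>L\<^sup>2) (tau_tan P / sqrt ((tau_tan P)\<^sup>2 + \<kappa>L\<^sup>2)))"

definition alpha_tilde ::
  "pdnmr_params \<Rightarrow> real \<Rightarrow> real \<Rightarrow> real \<Rightarrow> real \<Rightarrow> real \<Rightarrow> real \<Rightarrow> real \<Rightarrow> real" where
  "alpha_tilde P \<gamma>norm \<gamma>tan \<nu>u \<pi>tilde Lf Lc \<kappa>c =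
     (if \<pi>tilde * Lc + Lf = 0 then 1
      else min 1
        ((theta P * (1 - eta P) *
            min ((1 - tau_null P) * \<gamma>tan) (pen_init P * \<gamma>norm * rho P)) /
         ((\<pi>tilde * Lc + Lf) * max 1 (\<kappa>c * \<nu>u\<^sup>2))))"

end

(* The scaled merit function (f - flow) / pi + ||c|| does not increase when the penalty parameter pi
   grows, because f >= flow, so it serves as one potential for the whole run. An Armijo step lowers it
   by a multiple of -Dbar / pi, which dominates ||c|| through the normal step and ||w||^2 through the
   tangential step. While the run has not stopped, ||c|| > eps_c or ||Phat grad f|| > eps_p, and
   ||w|| >= omega_tan ||Phat grad f||, so every iteration removes a fixed amount.

   Both subroutines are treated as conjugate residual iterations. The residuals r_i are H-conjugate
   with <r_i, r_j> = ||r_max(i,j)||^2, hence the search directions have nonnegative inner products and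
   the iterates grow in norm. For J^T J this bounds the LSMR iterates by the exact solution; for the
   projected Hessian, the curvature of the iterates follows from that of the residuals by
   Cauchy-Schwarz over at most d conjugate terms. *)

theory Submission
  imports Defs
begin

section \<open>Symmetric matrices and singular values\<close>

text \<open>The range of \<open>Phat\<close> contains the null space of the Jacobian but may be
  larger. A small \<open>Phat\<close> gradient therefore certifies a small exact projected gradient,
  but a tangential step can change the linearized constraints. The feasibility test caps this
  penalty term by the fraction \<open>tau_null\<close> of the decrease predicted by the gradient,
  which is the origin of the factor \<open>1 - tau_null\<close>.

  The two terms of \<open>omega_tan\<close> belong to two kinds of returned vector. Iterates are
  compared with the first one, which gives \<open>sigma P / \<kappa>L\<^sup>2\<close>; for the
  residual of an unconverged iterate an orthogonal splitting of the projected gradient gives the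
  square root term.

  After division by the penalty, the normal part of the decrease no longer contains it, while the
  tangential part keeps its reciprocal; hence the upper bound \<open>\<pi>max\<close> occurs in
  \<open>\<Gamma>2\<close> alone.

  Loops are given by \<open>LEAST\<close> and minimizers by choice, so existence is a proof
  obligation throughout. Termination of both subroutines rests on the orthogonality of the vectors
  \<open>H *v dir i\<close>, of which at most as many as the dimension can be nonzero.\<close>

lemma inner_transpose_mult: "(transpose A *v x) \<bullet> y = x \<bullet> ((A::real^'n^'m) *v y)"
  by (simp add: dot_lmul_matrix)

text \<open>For small \<open>t\<close> the linear term dominates, so a step against its sign would
  make the expression negative. This is the first-order condition for the Rayleigh quotient
  below.\<close>

lemma quadratic_nonneg_imp_linear_zero:
  fixes a b :: real
  assumes "\<And>t. 0 \<le> 2 * t * a + t\<^sup>2 * b"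
  shows "a = 0"
proof (rule ccontr)
  assume a: "a \<noteq> 0"
  \<comment> \<open>The step \<open>- a / m\<close> gives the value
    \<open>a\<^sup>2 * (b - 2 * m) / m\<^sup>2\<close>, which is negative because \<open>m\<close>
    exceeds the absolute value of \<open>b\<close>.\<close>
  define m where "m = \<bar>b\<bar> + 1"
  define t where "t = - a / m"
  have m: "m > 0" "b < 2 * m" by (auto simp: m_def)
  have "t * m = - a" using m by (simp add: t_def)
  then have "m\<^sup>2 * (2 * t * a + t\<^sup>2 * b) = a\<^sup>2 * (b - 2 * m)" by algebra
  moreover have "a\<^sup>2 * (b - 2 * m) < 0" using a m by (simp add: mult_pos_neg)
  moreover have "0 \<le> m\<^sup>2 * (2 * t * a + t\<^sup>2 * b)" using assms[of t] by simp
  ultimately show False by simp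
qed

text \<open>The eigenvector minimizes the Rayleigh quotient on the unit sphere of \<open>S\<close>.
  The form with an invariant subspace serves twice: on an orthogonal complement for the spectral
  decomposition, and on \<open>UNIV\<close> for the extreme singular values.\<close>

lemma symmetric_matrix_min_eigenvector:
  fixes M :: "real^'n^'n"
  assumes sym: "transpose M = M" and S: "subspace S" and ne: "S \<noteq> {0}"
    and inv: "\<And>u. u \<in> S \<Longrightarrow> M *v u \<in> S"
  obtains v \<mu> where "v \<in> S" "v \<noteq> 0" "M *v v = \<mu> *\<^sub>R v"
    "\<And>u. u \<in> S \<Longrightarrow> \<mu> * (norm u)\<^sup>2 \<le> u \<bullet> (M *v u)"
proof -
  obtain z where z: "z \<in> S" "z \<noteq> 0" using ne subspace_0[OF S] by auto
  have "(1 / norm z) *\<^sub>R z \<in> S \<inter> sphere 0 1" using z S by (auto simp: subspace_scale)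
  then have ne': "S \<inter> sphere 0 1 \<noteq> {}" by blast
  have "compact (S \<inter> sphere 0 1)" using closed_subspace[OF S] by (intro closed_Int_compact) auto
  moreover have "continuous_on (S \<inter> sphere 0 1) (\<lambda>u. u \<bullet> (M *v u))"
    by (intro continuous_intros linear_continuous_on matrix_vector_mul_bounded_linear)
  ultimately obtain v where v: "v \<in> S \<inter> sphere 0 1"
      "\<forall>u\<in>S \<inter> sphere 0 1. v \<bullet> (M *v v) \<le> u \<bullet> (M *v u)"
    using continuous_attains_inf[OF _ ne'] by blast
  define \<mu> where "\<mu> = v \<bullet> (M *v v)"
  have ray: "\<mu> * (norm u)\<^sup>2 \<le> u \<bullet> (M *v u)" if u: "u \<in> S" for u
  proof (cases "u = 0")
    case False
    have "(1 / norm u) *\<^sub>R u \<in> S \<inter> sphere 0 1" using u False S by (auto simp: subspace_scale)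
    then have "\<mu> \<le> ((1 / norm u) *\<^sub>R u) \<bullet> (M *v ((1 / norm u) *\<^sub>R u))"
      unfolding \<mu>_def by (rule bspec[OF v(2)])
    also have "\<dots> = (u \<bullet> (M *v u)) / (norm u)\<^sup>2"
      by (simp add: matrix_vector_mult_scaleR power2_eq_square)
    finally show ?thesis using False by (simp add: field_simps)
  qed simp
  \<comment> \<open>The variation goes along the eigenvalue residual, which stays in
    \<open>S\<close> by invariance. Its linear coefficient is \<open>w \<bullet> w\<close>, so
    stationarity gives \<open>w = 0\<close>.\<close>
  define w where "w = M *v v - \<mu> *\<^sub>R v"
  have wS: "w \<in> S" unfolding w_def using v S inv by (auto intro: subspace_diff subspace_scale)
  have nv: "norm v = 1" using v by auto
  have "0 \<le> 2 * t * (w \<bullet> w) + t\<^sup>2 * (w \<bullet> (M *v w) - \<mu> * (norm w)\<^sup>2)" for t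
  proof -
    have "v + t *\<^sub>R w \<in> S" using v wS S by (auto intro: subspace_add subspace_scale)
    from ray[OF this]
    have 1: "\<mu> * ((v + t *\<^sub>R w) \<bullet> (v + t *\<^sub>R w)) \<le> (v + t *\<^sub>R w) \<bullet> (M *v (v + t *\<^sub>R w))"
      by (simp add: power2_norm_eq_inner)
    have vv: "v \<bullet> v = 1" using nv by (simp add: norm_eq_sqrt_inner)
    have 2: "(v + t *\<^sub>R w) \<bullet> (v + t *\<^sub>R w) = 1 + 2 * t * (w \<bullet> v) + t\<^sup>2 * (w \<bullet> w)"
      by (simp add: inner_add_left inner_add_right inner_commute[of v w] vv power2_eq_square algebra_simps)
    have "v \<bullet> (M *v w) = w \<bullet> (M *v v)"
      using inner_transpose_mult[of M v w] sym by (simp add: inner_commute)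
    then have 3: "(v + t *\<^sub>R w) \<bullet> (M *v (v + t *\<^sub>R w))
        = \<mu> + 2 * t * (w \<bullet> (M *v v)) + t\<^sup>2 * (w \<bullet> (M *v w))"
      by (simp add: \<mu>_def matrix_vector_right_distrib matrix_vector_mult_scaleR inner_add_left
          inner_add_right power2_eq_square algebra_simps)
    have "w \<bullet> w = w \<bullet> (M *v v) - \<mu> * (w \<bullet> v)"
      by (subst (2) w_def) (simp add: inner_diff_right)
    then have 4: "2 * t * (w \<bullet> w) = 2 * t * (w \<bullet> (M *v v)) - 2 * t * \<mu> * (w \<bullet> v)"
      by (simp only: right_diff_distrib mult.assoc)
    show ?thesis
      using 1 unfolding 2 3 4 by (simp add: power2_norm_eq_inner algebra_simps)
  qed
  then have "w \<bullet> w = 0" by (rule quadratic_nonneg_imp_linear_zero)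
  then have "w = 0" by simp
  then have "M *v v = \<mu> *\<^sub>R v" unfolding w_def by (rule right_minus_eq[THEN iffD1])
  moreover have "v \<noteq> 0" using nv by auto
  moreover have "v \<in> S" using v(1) by blast
  ultimately show ?thesis using ray by (intro that)
qed

section \<open>Spectral decomposition and multiplicities of eigenvalues\<close>

definition eigenspace :: "real^'n^'n \<Rightarrow> real \<Rightarrow> (real^'n) set" where
  "eigenspace M \<mu> = {v. M *v v = \<mu> *\<^sub>R v}"

definition eigenvalues :: "real^'n^'n \<Rightarrow> real set" where
  "eigenvalues M = {\<mu>. \<exists>v. v \<noteq> 0 \<and> M *v v = \<mu> *\<^sub>R v}"

lemma eigenspace_orthogonal:
  assumes "transpose M = M" "u \<in> eigenspace M a" "v \<in> eigenspace M b" "a \<noteq> b"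
  shows "u \<bullet> v = 0"
proof -
  have "(M *v u) \<bullet> v = u \<bullet> (M *v v)" using inner_transpose_mult[of M u v] assms(1) by simp
  then have "a * (u \<bullet> v) = b * (u \<bullet> v)" using assms(2,3) by (simp add: eigenspace_def)
  then show ?thesis using assms(4) by simp
qed

lemma subspace_eigenspace: "subspace (eigenspace M a)"
  by (auto simp: subspace_def eigenspace_def matrix_vector_right_distrib matrix_vector_mult_scaleR
      scaleR_add_right)

text \<open>By symmetry the orthogonal complement of all eigenvectors is invariant. If it were
  nonzero, it would contain an eigenvector, orthogonal to itself.\<close>

lemma eigenvectors_span:
  fixes M :: "real^'n^'n"
  assumes sym: "transpose M = M"
  shows "span (\<Union>a\<in>eigenvalues M. eigenspace M a) = UNIV"
proof (rule ccontr)
  let ?E = "\<Union>a\<in>eigenvalues M. eigenspace M a"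
  assume *: "span ?E \<noteq> UNIV"
  define S where "S = {y. \<forall>x\<in>?E. orthogonal x y}"
  have S: "subspace S" unfolding S_def by (rule subspace_orthogonal_to_vectors)
  have "span ?E \<subset> span UNIV" using * by auto
  then obtain y where y: "y \<noteq> 0" "\<And>x. x \<in> span ?E \<Longrightarrow> orthogonal y x"
    using orthogonal_to_subspace_exists_gen by metis
  then have "y \<in> S" unfolding S_def by (auto simp: orthogonal_commute intro: span_base)
  then have ne: "S \<noteq> {0}" using y(1) by blast
  have inv: "M *v u \<in> S" if u: "u \<in> S" for u
  proof -
    have "orthogonal x (M *v u)" if x: "x \<in> ?E" for x
    proof -
      obtain a where a: "M *v x = a *\<^sub>R x" using x unfolding eigenspace_def by blast
      have "x \<bullet> (M *v u) = (M *v x) \<bullet> u" using inner_transpose_mult[of M x u] sym by simp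
      moreover have "x \<bullet> u = 0" using u x unfolding S_def orthogonal_def by blast
      ultimately show ?thesis using a by (simp add: orthogonal_def)
    qed
    then show ?thesis unfolding S_def by blast
  qed
  obtain v \<mu> where v: "v \<in> S" "v \<noteq> 0" "M *v v = \<mu> *\<^sub>R v"
    by (rule symmetric_matrix_min_eigenvector[OF sym S ne inv])
  then have "v \<in> ?E" unfolding eigenvalues_def eigenspace_def by blast
  then have "orthogonal v v" using v(1) unfolding S_def by blast
  then show False using v(2) by (simp add: orthogonal_def)
qed

text \<open>Orthonormal bases of the eigenspaces join to a basis of the whole space. Finiteness
  matters because \<open>eigenvalues_mset\<close> is a sum over the set of eigenvalues, and a sum
  over an infinite set is zero by convention.\<close>

lemma sum_dim_eigenspaces:
  fixes M :: "real^'n^'n"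
  assumes sym: "transpose M = M"
  shows "finite (eigenvalues M)" "(\<Sum>a\<in>eigenvalues M. dim (eigenspace M a)) = CARD('n)"
proof -
  have "\<exists>B. B \<subseteq> eigenspace M a \<and> pairwise orthogonal B \<and> (\<forall>x\<in>B. norm x = 1) \<and> independent B \<and>
      finite B \<and> card B = dim (eigenspace M a) \<and> span B = eigenspace M a" for a
    using orthonormal_basis_subspace[OF subspace_eigenspace[of M a]]
    by (metis independent_imp_finite)
  then obtain B where B: "\<And>a. B a \<subseteq> eigenspace M a" "\<And>a. pairwise orthogonal (B a)"
    "\<And>a x. x \<in> B a \<Longrightarrow> norm x = 1" "\<And>a. finite (B a)"
    "\<And>a. card (B a) = dim (eigenspace M a)" "\<And>a. span (B a) = eigenspace M a"
    by metis
  let ?U = "\<Union>a\<in>eigenvalues M. B a"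
  have orth: "x \<bullet> y = 0" if "x \<in> B a" "y \<in> B b" "a \<noteq> b" for x y a b
    using eigenspace_orthogonal[OF sym] that B(1) by blast
  have "pairwise orthogonal ?U"
    unfolding pairwise_def orthogonal_def
    using orth B(2) by (metis UN_E orthogonal_def pairwise_def)
  moreover have "0 \<notin> ?U" using B(3) by fastforce
  ultimately have ind: "independent ?U" by (rule pairwise_orthogonal_independent)
  have disj: "B a \<inter> B b = {}" if "a \<noteq> b" for a b
    using orth[OF _ _ that] B(3) by (metis disjoint_iff inner_eq_zero_iff norm_zero zero_neq_one)
  have neB: "B a \<noteq> {}" if "a \<in> eigenvalues M" for a
  proof
    assume "B a = {}"
    then have "eigenspace M a = {0}" using B(6)[of a] by simp
    then show False using that by (auto simp: eigenvalues_def eigenspace_def)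
  qed
  have "finite ?U" using ind by (rule independent_imp_finite)
  \<comment> \<open>One basis vector per eigenvalue: these are distinct because the bases are
    disjoint, so an independent, hence finite, union admits only finitely many eigenvalues.\<close>
  moreover have "inj_on (\<lambda>a. SOME x. x \<in> B a) (eigenvalues M)"
    using disj neB by (intro inj_onI) (metis disjoint_iff some_in_eq)
  moreover have "(\<lambda>a. SOME x. x \<in> B a) ` eigenvalues M \<subseteq> ?U" using neB some_in_eq by fastforce
  ultimately show fin: "finite (eigenvalues M)" by (metis finite_imageD finite_subset)
  have "eigenspace M a \<subseteq> span ?U" if "a \<in> eigenvalues M" for a
    using B(6)[of a] that by (metis UN_upper span_mono)
  then have "span (\<Union>a\<in>eigenvalues M. eigenspace M a) \<subseteq> span ?U"
    by (intro span_minimal) (auto simp: subspace_span)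
  then have "span ?U = UNIV" using eigenvectors_span[OF sym] by auto
  then have "card ?U = CARD('n)" using ind
    by (metis DIM_cart DIM_real dim_UNIV dim_eq_card mult.right_neutral dim_span)
  moreover have "card ?U = (\<Sum>a\<in>eigenvalues M. card (B a))"
    using fin B(4) disj by (intro card_UN_disjoint) auto
  ultimately show "(\<Sum>a\<in>eigenvalues M. dim (eigenspace M a)) = CARD('n)" using B(5) by simp
qed

text \<open>The size is the length of the sorted list in \<open>singular_value\<close>; it ensures
  that the first and the last index are in range.\<close>

lemma eigenvalues_mset_symmetric:
  fixes M :: "real^'n^'n"
  assumes sym: "transpose M = M"
  shows "size (eigenvalues_mset M) = CARD('n)" "set_mset (eigenvalues_mset M) = eigenvalues M"
proof -
  have e: "eigenvalues_mset M = (\<Sum>a\<in>eigenvalues M. replicate_mset (dim (eigenspace M a)) a)"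
    by (simp add: eigenvalues_mset_def eigenvalues_def eigenspace_def)
  show "size (eigenvalues_mset M) = CARD('n)"
    using sum_dim_eigenspaces[OF sym] by (simp add: e size_multiset_sum)
  have "dim (eigenspace M a) \<noteq> 0" if "a \<in> eigenvalues M" for a
    using that by (auto simp: eigenvalues_def eigenspace_def)
  then show "set_mset (eigenvalues_mset M) = eigenvalues M"
    using sum_dim_eigenspaces(1)[OF sym] by (auto simp: e set_mset_sum)
qed

lemma singular_value_bounds_eigenvalue:
  fixes A :: "real^'n^'m"
  assumes "\<mu> \<in> eigenvalues (A ** transpose A)"
  shows "singular_value CARD('m) A \<le> sqrt \<mu>" "sqrt \<mu> \<le> singular_value 1 A"
proof -
  let ?M = "A ** transpose A"
  let ?L = "sorted_list_of_multiset (eigenvalues_mset ?M)"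
  have sym: "transpose ?M = ?M" by (simp add: matrix_transpose_mul)
  have len: "length ?L = CARD('m)"
    using eigenvalues_mset_symmetric(1)[OF sym] by (metis size_mset mset_sorted_list_of_multiset)
  have "\<mu> \<in> set ?L"
    using eigenvalues_mset_symmetric(2)[OF sym] assms by simp
  then obtain i where i: "i < length ?L" "?L ! i = \<mu>" by (metis in_set_conv_nth)
  have s: "sorted ?L" by simp
  have p: "0 < CARD('m)" by simp
  \<comment> \<open>The list ascends, so after reversal the index \<open>CARD('m)\<close> reads its
    smallest entry and the index 1 its largest.\<close>
  have "rev ?L ! (CARD('m) - 1) = ?L ! 0" using len p by (simp add: rev_nth)
  moreover have "?L ! 0 \<le> ?L ! i" using s i by (intro sorted_nth_mono) auto
  ultimately show "singular_value CARD('m) A \<le> sqrt \<mu>" using i by (simp add: singular_value_def)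
  have "rev ?L ! 0 = ?L ! (CARD('m) - 1)" using len p by (simp add: rev_nth)
  moreover have "?L ! i \<le> ?L ! (CARD('m) - 1)" using s i len by (intro sorted_nth_mono) auto
  ultimately show "sqrt \<mu> \<le> singular_value 1 A" using i by (simp add: singular_value_def)
qed

lemma inner_mult_transpose:
  fixes A :: "real^'n^'m"
  shows "u \<bullet> ((A ** transpose A) *v u) = (norm (transpose A *v u))\<^sup>2"
  using inner_transpose_mult[of A u "transpose A *v u"]
  by (simp only: power2_norm_eq_inner matrix_vector_mul_assoc)

text \<open>The quadratic form of \<open>A ** transpose A\<close> is the squared norm of
  \<open>transpose A *v u\<close>, and its least eigenvalue bounds it from below. Full row rank thus
  becomes injectivity of the transpose, in quantitative form.\<close>

lemma norm_transpose_mult_ge_singular_value: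
  fixes A :: "real^'n^'m"
  assumes "0 \<le> s" "s \<le> singular_value CARD('m) A"
  shows "s * norm u \<le> norm (transpose A *v u)"
proof -
  let ?M = "A ** transpose A"
  have sym: "transpose ?M = ?M" by (simp add: matrix_transpose_mul)
  have "(UNIV :: (real^'m) set) \<noteq> {0}"
    using UNIV_not_singleton by blast
  then obtain v \<mu> where v: "v \<noteq> 0" "?M *v v = \<mu> *\<^sub>R v"
    and mu: "\<And>u. \<mu> * (norm u)\<^sup>2 \<le> u \<bullet> (?M *v u)"
    using symmetric_matrix_min_eigenvector[OF sym subspace_UNIV] by (metis UNIV_I)
  have "\<mu> \<in> eigenvalues ?M" using v by (auto simp: eigenvalues_def)
  then have "s \<le> sqrt \<mu>" using singular_value_bounds_eigenvalue(1)[of \<mu> A] assms by linarith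
  then have "s\<^sup>2 \<le> \<mu>" using assms(1) real_le_rsqrt real_sqrt_le_iff
    by (metis abs_of_nonneg real_sqrt_abs)
  then have "(s * norm u)\<^sup>2 \<le> (norm (transpose A *v u))\<^sup>2"
    using mu[of u] mult_right_mono[of "s\<^sup>2" \<mu> "(norm u)\<^sup>2"]
    by (simp add: inner_mult_transpose power_mult_distrib)
  then show ?thesis by (rule power2_le_imp_le) simp
qed

text \<open>The largest eigenvalue comes from the same minimization, applied to the negated
  matrix.\<close>

lemma norm_transpose_mult_le_singular_value:
  fixes A :: "real^'n^'m"
  assumes "0 \<le> s" "singular_value 1 A \<le> s"
  shows "norm (transpose A *v u) \<le> s * norm u"
proof -
  let ?M = "A ** transpose A"
  have sym: "transpose (- ?M) = - ?M"
  proof -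
    have "transpose (- X) = - transpose X" for X :: "real^'m^'m"
      unfolding vec_eq_iff transpose_def by simp
    from this[of ?M] show ?thesis unfolding matrix_transpose_mul transpose_transpose .
  qed
  have "(UNIV :: (real^'m) set) \<noteq> {0}"
    using UNIV_not_singleton by blast
  then obtain v \<mu> where v: "v \<noteq> 0" "(- ?M) *v v = \<mu> *\<^sub>R v"
    and mu: "\<And>u. \<mu> * (norm u)\<^sup>2 \<le> u \<bullet> ((- ?M) *v u)"
    using symmetric_matrix_min_eigenvector[OF sym subspace_UNIV] by (metis UNIV_I)
  have neg: "(- ?M) *v x = - (?M *v x)" for x
    by (simp add: vec_eq_iff matrix_vector_mult_def sum_negf)
  have "?M *v v = (- \<mu>) *\<^sub>R v" using v(2) by (simp add: neg) (metis minus_minus)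
  then have "- \<mu> \<in> eigenvalues ?M" using v(1) unfolding eigenvalues_def by blast
  then have "sqrt (- \<mu>) \<le> s" using singular_value_bounds_eigenvalue(2)[of "- \<mu>" A] assms by linarith
  then have "- \<mu> \<le> s\<^sup>2" using assms(1) by (simp add: real_sqrt_le_iff sqrt_le_D)
  moreover have "(norm (transpose A *v u))\<^sup>2 \<le> - \<mu> * (norm u)\<^sup>2"
    using mu[of u] by (simp add: neg inner_mult_transpose)
  ultimately have "(norm (transpose A *v u))\<^sup>2 \<le> (s * norm u)\<^sup>2"
    using mult_right_mono[of "- \<mu>" "s\<^sup>2" "(norm u)\<^sup>2"]
    by (simp add: power_mult_distrib)
  then show ?thesis by (rule power2_le_imp_le) (use assms in simp)
qed

section \<open>Conjugate residual iterates\<close>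

text \<open>The matrix is an arbitrary symmetric one, so that \<open>transpose J ** J\<close> and
  the projected Hessian share all results. Division by zero yields zero, which keeps the sequences
  total; how long the curvature stays positive is a separate hypothesis.\<close>

locale conjugate_residual =
  fixes H :: "real^'m^'m" and g :: "real^'m"
  assumes sym: "transpose H = H"
begin

definition sol :: "nat \<Rightarrow> real^'m" where "sol t = fst (cr_iterate H g t)"
definition res :: "nat \<Rightarrow> real^'m" where "res t = fst (snd (cr_iterate H g t))"
definition dir :: "nat \<Rightarrow> real^'m" where "dir t = snd (snd (cr_iterate H g t))"
definition curv :: "nat \<Rightarrow> real" where "curv t = res t \<bullet> (H *v res t)"
definition zeta :: "nat \<Rightarrow> real" where "zeta t = curv t / (norm (H *v dir t))\<^sup>2"
definition beta :: "nat \<Rightarrow> real" where "beta t = curv (Suc t) / curv t"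

lemma iter_0: "sol 0 = 0" "res 0 = - g" "dir 0 = - g"
  by (simp_all add: sol_def res_def dir_def)

lemma sol_Suc: "sol (Suc t) = sol t + zeta t *\<^sub>R dir t"
  and res_Suc: "res (Suc t) = res t - zeta t *\<^sub>R (H *v dir t)"
  by (simp_all add: sol_def res_def dir_def curv_def zeta_def Let_def split: prod.splits)

lemma dir_Suc: "dir (Suc t) = res (Suc t) + beta t *\<^sub>R dir t"
  by (simp add: sol_def res_def dir_def curv_def zeta_def beta_def Let_def split: prod.splits)

lemma inner_H: "(H *v u) \<bullet> w = u \<bullet> (H *v w)"
  using inner_transpose_mult[of H u w] sym by simp

lemma inner_H_commute: "u \<bullet> (H *v w) = w \<bullet> (H *v u)"
  by (subst inner_H[symmetric]) (rule inner_commute)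

lemma res_eq: "res t = - g - H *v sol t"
  by (induction t) (simp_all add: iter_0 sol_Suc res_Suc matrix_vector_right_distrib
      matrix_vector_mult_scaleR)

lemma H_dir_Suc: "H *v dir (Suc t) = H *v res (Suc t) + beta t *\<^sub>R (H *v dir t)"
  by (simp add: dir_Suc matrix_vector_right_distrib matrix_vector_mult_scaleR)

text \<open>The four families of relations support each other in one induction. The hypothesis stops
  before \<open>t\<close> on purpose: the residual with index \<open>t\<close> may have nonpositive
  curvature and still satisfies the relations, and such an index can be the one at which the loop
  exits.\<close>

lemma conjugacy:
  assumes "\<And>i. i < t \<Longrightarrow> 0 < curv i"
  shows "(\<forall>i\<le>t. \<forall>j<i. res i \<bullet> (H *v dir j) = 0) \<and>
    (\<forall>i\<le>t. \<forall>j<i. res i \<bullet> (H *v res j) = 0) \<and>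
    (\<forall>i\<le>t. \<forall>j<i. (H *v dir i) \<bullet> (H *v dir j) = 0) \<and>
    (\<forall>i\<le>t. res i \<bullet> (H *v dir i) = curv i)"
  using assms
proof (induction t)
  case 0
  then show ?case by (simp add: curv_def iter_0)
next
  case (Suc t)
  then have IH: "\<And>i j. i \<le> t \<Longrightarrow> j < i \<Longrightarrow> res i \<bullet> (H *v dir j) = 0"
    "\<And>i j. i \<le> t \<Longrightarrow> j < i \<Longrightarrow> res i \<bullet> (H *v res j) = 0"
    "\<And>i j. i \<le> t \<Longrightarrow> j < i \<Longrightarrow> (H *v dir i) \<bullet> (H *v dir j) = 0"
    "\<And>i. i \<le> t \<Longrightarrow> res i \<bullet> (H *v dir i) = curv i"
    by auto
  have pos: "0 < curv i" if "i \<le> t" for i using Suc.prems that by simp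
  have nz: "norm (H *v dir i) > 0" if "i \<le> t" for i
    using IH(4)[OF that] pos[OF that] by auto
  have zpos: "0 < zeta i" if "i \<le> t" for i
    using pos[OF that] nz[OF that] by (simp add: zeta_def)
  have sq: "zeta i * (norm (H *v dir i))\<^sup>2 = curv i" if "i \<le> t" for i
    using nz[OF that] by (simp add: zeta_def)
  have a: "res (Suc t) \<bullet> (H *v dir j) = 0" if j: "j \<le> t" for j
  proof (cases "j = t")
    case True
    then show ?thesis using IH(4)[of t] sq[of t]
      by (simp add: res_Suc inner_diff_left power2_norm_eq_inner)
  next
    case False
    then show ?thesis using IH(1)[of t j] IH(3)[of t j] j
      by (simp add: res_Suc inner_diff_left)
  qed
  have b: "res (Suc t) \<bullet> (H *v res j) = 0" if j: "j \<le> t" for j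
  proof (cases j)
    case 0
    then show ?thesis using a[of 0] by (simp add: iter_0)
  next
    case (Suc k)
    have "H *v res j = H *v dir j - beta k *\<^sub>R (H *v dir k)"
      unfolding Suc H_dir_Suc by simp
    then show ?thesis using a[of j] a[of k] Suc j by (simp add: inner_diff_right)
  qed
  have e: "res (Suc t) \<bullet> (H *v dir (Suc t)) = curv (Suc t)"
    unfolding H_dir_Suc using a[of t] by (simp add: curv_def inner_add_right)
  have c: "(H *v dir (Suc t)) \<bullet> (H *v dir j) = 0" if j: "j \<le> t" for j
  proof -
    \<comment> \<open>Solving the residual recurrence for \<open>H *v dir j\<close> reduces the
      remaining products to products of residuals whose conjugacy is known.\<close>
    have hd: "H *v dir j = (1 / zeta j) *\<^sub>R (res j - res (Suc j))"
      using zpos[OF j] by (simp add: res_Suc)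
    have 1: "(H *v res (Suc t)) \<bullet> (H *v dir j) = (1 / zeta j) * (res j \<bullet> (H *v res (Suc t)) - res (Suc j) \<bullet> (H *v res (Suc t)))"
      unfolding hd by (simp add: inner_diff_right inner_commute)
    have 2: "res j \<bullet> (H *v res (Suc t)) = 0"
      by (subst inner_H_commute) (rule b[OF j])
    show ?thesis
    proof (cases "j = t")
      case True
      \<comment> \<open>\<open>beta t\<close> is the coefficient for which both terms have absolute
        value \<open>curv (Suc t) / zeta t\<close> and cancel.\<close>
      have "(H *v dir (Suc t)) \<bullet> (H *v dir j)
          = - curv (Suc t) / zeta t + beta t * (norm (H *v dir t))\<^sup>2"
        unfolding H_dir_Suc inner_add_left 1 2
        using True by (simp add: curv_def power2_norm_eq_inner)
      also have "\<dots> = 0"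
        using sq[of t] zpos[of t] pos[of t] by (simp add: beta_def field_simps)
      finally show ?thesis .
    next
      case False
      then have "res (Suc j) \<bullet> (H *v res (Suc t)) = 0"
        by (subst inner_H_commute) (use b[of "Suc j"] j in simp)
      then show ?thesis
        unfolding H_dir_Suc inner_add_left 1 2 using IH(3)[of t j] j False by simp
    qed
  qed
  show ?case using IH a b c e by (auto simp: le_Suc_eq)
qed

section \<open>Orthogonality and monotonicity while the curvature is positive\<close>

context
  fixes t :: nat
  assumes pos: "\<And>i. i < t \<Longrightarrow> 0 < curv i"
begin

lemma res_H_dir: "i \<le> t \<Longrightarrow> j < i \<Longrightarrow> res i \<bullet> (H *v dir j) = 0"
  and res_H_res: "i \<le> t \<Longrightarrow> j < i \<Longrightarrow> res i \<bullet> (H *v res j) = 0"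
  and H_dir_H_dir: "i \<le> t \<Longrightarrow> j < i \<Longrightarrow> (H *v dir i) \<bullet> (H *v dir j) = 0"
  and res_H_dir_self: "i \<le> t \<Longrightarrow> res i \<bullet> (H *v dir i) = curv i"
  using conjugacy[OF pos] by blast+

lemma H_dir_nonzero: "i < t \<Longrightarrow> H *v dir i \<noteq> 0"
  using res_H_dir_self[of i] pos[of i] by auto

lemma zeta_pos: "i < t \<Longrightarrow> 0 < zeta i"
  using pos[of i] H_dir_nonzero[of i] by (simp add: zeta_def)

lemma beta_nonneg: "Suc i < t \<Longrightarrow> 0 \<le> beta i"
  using pos[of i] pos[of "Suc i"] by (simp add: beta_def)

text \<open>Pairwise orthogonal nonzero vectors are independent. Every termination argument uses
  this: some curvature with index at most the dimension is not positive.\<close>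

lemma steps_le_dim: "t \<le> CARD('m)"
proof -
  let ?S = "(\<lambda>i. H *v dir i) ` {..<t}"
  have orth: "(H *v dir i) \<bullet> (H *v dir j) = 0" if "i < t" "j < t" "i \<noteq> j" for i j
    using H_dir_H_dir[of i j] H_dir_H_dir[of j i] that
    by (cases "i < j") (auto simp: inner_commute)
  have inj: "inj_on (\<lambda>i. H *v dir i) {..<t}"
  proof (rule inj_onI)
    fix i j assume *: "i \<in> {..<t}" "j \<in> {..<t}" "H *v dir i = H *v dir j"
    show "i = j"
    proof (rule ccontr)
      assume "i \<noteq> j"
      then have "(H *v dir i) \<bullet> (H *v dir i) = 0" using orth[of i j] * by simp
      then show False using H_dir_nonzero[of i] * by simp
    qed
  qed
  have "pairwise orthogonal ?S" using orth by (auto simp: pairwise_def orthogonal_def)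
  moreover have "0 \<notin> ?S" using H_dir_nonzero by force
  ultimately have "independent ?S" by (rule pairwise_orthogonal_independent)
  then have "card ?S \<le> DIM(real^'m)" using independent_bound by blast
  then show ?thesis using card_image[OF inj] by simp
qed

lemma res_H_sol: "i \<le> t \<Longrightarrow> j \<le> i \<Longrightarrow> res i \<bullet> (H *v sol j) = 0"
proof (induction j)
  case (Suc j)
  then show ?case using res_H_dir[of i j]
    by (simp add: sol_Suc matrix_vector_right_distrib matrix_vector_mult_scaleR inner_add_right)
qed (simp add: iter_0)

text \<open>Two residuals differ by \<open>H\<close> applied to a difference of iterates, and the
  later residual is orthogonal to the image of every iterate up to its own index.\<close>

lemma inner_res_res: "i \<le> t \<Longrightarrow> j \<le> i \<Longrightarrow> res i \<bullet> res j = (norm (res i))\<^sup>2"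
proof -
  assume a: "i \<le> t" "j \<le> i"
  have "res j = res i + H *v sol i - H *v sol j" by (simp add: res_eq)
  then have "res i \<bullet> res j = res i \<bullet> res i + res i \<bullet> (H *v sol i) - res i \<bullet> (H *v sol j)"
    by (simp add: inner_add_right inner_diff_right)
  then show ?thesis using res_H_sol[of i j] res_H_sol[of i i] a by (simp add: power2_norm_eq_inner)
qed

text \<open>Directions are combinations of residuals with nonnegative coefficients. The index
  \<open>j\<close> stays below \<open>t\<close> because \<open>beta\<close> has the later curvature
  in its numerator, whose sign at \<open>t\<close> is unknown.\<close>

lemma inner_res_dir_nonneg: "i \<le> t \<Longrightarrow> j < t \<Longrightarrow> 0 \<le> res i \<bullet> dir j"
proof (induction j)
  case 0
  then show ?case using inner_res_res[of i 0] by (simp add: iter_0)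
next
  case (Suc j)
  have "0 \<le> res i \<bullet> res (Suc j)"
  proof (cases "Suc j \<le> i")
    case True
    then show ?thesis using inner_res_res[of i "Suc j"] Suc by simp
  next
    case False
    then show ?thesis using inner_res_res[of "Suc j" i] Suc by (simp add: inner_commute)
  qed
  then show ?case using Suc beta_nonneg[of j] by (simp add: dir_Suc inner_add_right)
qed

lemma inner_dir_dir_nonneg: "i < t \<Longrightarrow> j < t \<Longrightarrow> 0 \<le> dir i \<bullet> dir j"
proof (induction i)
  case 0
  then show ?case using inner_res_dir_nonneg[of 0 j] by (simp add: iter_0)
next
  case (Suc i)
  then show ?case using inner_res_dir_nonneg[of "Suc i" j] beta_nonneg[of i]
    by (simp add: dir_Suc inner_add_left)
qed

lemma inner_sol_dir_nonneg: "i \<le> t \<Longrightarrow> j < t \<Longrightarrow> 0 \<le> sol i \<bullet> dir j"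
proof (induction i)
  case (Suc i)
  then show ?case using inner_dir_dir_nonneg[of i j] zeta_pos[of i]
    by (simp add: sol_Suc inner_add_left)
qed (simp add: iter_0)

lemma inner_res_sol_nonneg: "i \<le> t \<Longrightarrow> j \<le> t \<Longrightarrow> 0 \<le> res i \<bullet> sol j"
proof (induction j)
  case (Suc j)
  then show ?case using inner_res_dir_nonneg[of i j] zeta_pos[of j]
    by (simp add: sol_Suc inner_add_right)
qed (simp add: iter_0)

lemma norm_sol_mono: "i \<le> j \<Longrightarrow> j \<le> t \<Longrightarrow> norm (sol i) \<le> norm (sol j)"
proof (induction j rule: dec_induct)
  case (step j)
  have "(norm (sol j))\<^sup>2 \<le> (norm (sol (Suc j)))\<^sup>2"
    using inner_sol_dir_nonneg[of j j] zeta_pos[of j] step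
    by (simp add: sol_Suc power2_norm_eq_inner inner_add_left inner_add_right inner_commute)
  then have "norm (sol j) \<le> norm (sol (Suc j))" by (rule power2_le_imp_le) simp
  then show ?case using step by simp
qed simp

text \<open>Pythagoras: \<open>- g\<close> is the orthogonal sum of \<open>res i\<close> and
  \<open>H *v sol i\<close>.\<close>

lemma norm_H_sol: "i \<le> t \<Longrightarrow> (norm (H *v sol i))\<^sup>2 = (norm g)\<^sup>2 - (norm (res i))\<^sup>2"
proof -
  assume i: "i \<le> t"
  have "g = - res i - H *v sol i" by (simp add: res_eq)
  then have "g \<bullet> g = (- res i - H *v sol i) \<bullet> (- res i - H *v sol i)" by simp
  also have "\<dots> = res i \<bullet> res i + (H *v sol i) \<bullet> (H *v sol i)"
    using res_H_sol[OF i, of i] by (simp add: inner_diff_left inner_diff_right inner_commute)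
  finally show ?thesis by (simp add: power2_norm_eq_inner)
qed

lemma norm_res_Suc_le: "i < t \<Longrightarrow> norm (res (Suc i)) \<le> norm (res i)"
proof -
  assume i: "i < t"
  have "(norm (res (Suc i)))\<^sup>2 = res (Suc i) \<bullet> res i" using inner_res_res[of "Suc i" i] i by simp
  also have "\<dots> \<le> norm (res (Suc i)) * norm (res i)" by (rule norm_cauchy_schwarz)
  finally show ?thesis
    by (cases "res (Suc i) = 0") (auto simp: power2_eq_square)
qed

lemma norm_H_sol_mono: "i \<le> j \<Longrightarrow> j \<le> t \<Longrightarrow> norm (H *v sol i) \<le> norm (H *v sol j)"
proof (induction j rule: dec_induct)
  case (step j)
  have "(norm (res (Suc j)))\<^sup>2 \<le> (norm (res j))\<^sup>2"
    using norm_res_Suc_le[of j] step by (intro power_mono) auto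
  then have "(norm (H *v sol j))\<^sup>2 \<le> (norm (H *v sol (Suc j)))\<^sup>2"
    using norm_H_sol[of j] norm_H_sol[of "Suc j"] step by simp
  then have "norm (H *v sol j) \<le> norm (H *v sol (Suc j))" by (rule power2_le_imp_le) simp
  then show ?case using step by simp
qed simp

lemma inner_g_res: "i \<le> t \<Longrightarrow> g \<bullet> res i = - (norm (res i))\<^sup>2"
  using inner_res_res[of i 0] by (simp add: iter_0 inner_commute)

text \<open>The dropped term is \<open>res i \<bullet> sol i\<close>, which is nonnegative; so the
  curvature of an iterate bounds the descent along it.\<close>

lemma inner_g_sol_le: "i \<le> t \<Longrightarrow> g \<bullet> sol i \<le> - (sol i \<bullet> (H *v sol i))"
proof -
  assume i: "i \<le> t"
  have "g = - res i - H *v sol i" by (simp add: res_eq)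
  then have "g \<bullet> sol i = (- res i - H *v sol i) \<bullet> sol i" by (rule arg_cong)
  also have "\<dots> = - (res i \<bullet> sol i) - (H *v sol i) \<bullet> sol i"
    by (simp add: inner_diff_left)
  finally have "g \<bullet> sol i = - (res i \<bullet> sol i) - (H *v sol i) \<bullet> sol i" .
  then show ?thesis using inner_res_sol_nonneg[OF i i] by (simp add: inner_commute)
qed

section \<open>Expansion of the iterates in residuals\<close>

lemma dir_combination: "i < t \<Longrightarrow> \<exists>a. dir i = (\<Sum>l\<le>i. a l *\<^sub>R res l)"
proof (induction i)
  case 0
  have "dir 0 = (\<Sum>l\<le>0. 1 *\<^sub>R res l)" by (simp add: iter_0)
  then show ?case by (rule exI[of _ "\<lambda>_. 1"])
next
  case (Suc i)
  then obtain a where a: "dir i = (\<Sum>l\<le>i. a l *\<^sub>R res l)" by auto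
  have "dir (Suc i) = (\<Sum>l\<le>Suc i. (if l = Suc i then 1 else beta i * a l) *\<^sub>R res l)"
    by (simp add: dir_Suc a scaleR_sum_right)
  then show ?case by (rule exI[of _ "\<lambda>l. if l = Suc i then 1 else beta i * a l"])
qed

lemma sol_combination: "i \<le> t \<Longrightarrow> \<exists>a. sol i = (\<Sum>l<i. a l *\<^sub>R res l)"
proof (induction i)
  case 0
  then show ?case by (simp add: iter_0)
next
  case (Suc i)
  then obtain a where a: "sol i = (\<Sum>l<i. a l *\<^sub>R res l)" by auto
  obtain b where b: "dir i = (\<Sum>l\<le>i. b l *\<^sub>R res l)" using dir_combination[of i] Suc by auto
  have "sol (Suc i) = (\<Sum>l<Suc i. ((if l < i then a l else 0) + zeta i * b l) *\<^sub>R res l)"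
    by (simp add: sol_Suc a b lessThan_Suc_atMost[symmetric] scaleR_add_left sum.distrib
        scaleR_sum_right scaleR_add_right)
  then show ?case by (rule exI[of _ "\<lambda>l. (if l < i then a l else 0) + zeta i * b l"])
qed

text \<open>The residuals diagonalize the quadratic form of \<open>H\<close> but need not be
  orthogonal to one another, so the squared norm of the expansion is only bounded up to the number
  of its terms. The factor \<open>CARD('m)\<close> in \<open>low\<close> compensates for
  that.\<close>

lemma sol_curvature:
  assumes i: "i \<le> t" and s: "0 \<le> s"
    and low: "\<And>l. l < i \<Longrightarrow> real CARD('m) * s * (norm (res l))\<^sup>2 \<le> curv l"
  shows "s * (norm (sol i))\<^sup>2 \<le> sol i \<bullet> (H *v sol i)"
proof -
  obtain a where a: "sol i = (\<Sum>l<i. a l *\<^sub>R res l)" using sol_combination[OF i] by blast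
  have orth: "res l \<bullet> (H *v res k) = 0" if "l < i" "k < i" "l \<noteq> k" for l k
  proof (cases "k < l")
    case True
    then show ?thesis using res_H_res[of l k] that i by simp
  next
    case False
    then show ?thesis
      by (subst inner_H_commute) (use res_H_res[of k l] that i in simp)
  qed
  have lin: "H *v sol i = (\<Sum>k<i. a k *\<^sub>R (H *v res k))"
    by (simp add: a matrix_vector_mult_scaleR linear_sum[OF matrix_vector_mul_linear, unfolded o_def])
  have "sol i \<bullet> (H *v sol i) = (\<Sum>l<i. \<Sum>k<i. a l * (a k * (res k \<bullet> (H *v res l))))"
    unfolding lin by (subst a) (simp add: inner_sum_left inner_sum_right sum_distrib_left)
  also have "\<dots> = (\<Sum>l<i. \<Sum>k<i. if k = l then a l * (a l * curv l) else 0)"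
    using orth by (intro sum.cong refl) (auto simp: curv_def)
  also have "\<dots> = (\<Sum>l<i. (a l)\<^sup>2 * curv l)"
    by (simp add: power2_eq_square mult.assoc)
  finally have q: "sol i \<bullet> (H *v sol i) = (\<Sum>l<i. (a l)\<^sup>2 * curv l)" .
  have "(norm (sol i))\<^sup>2 \<le> (\<Sum>l<i. norm (a l *\<^sub>R res l))\<^sup>2"
    unfolding a by (intro power_mono norm_sum) simp
  also have "\<dots> \<le> real i * (\<Sum>l<i. (norm (a l *\<^sub>R res l))\<^sup>2)"
    using sum_squared_le_sum_of_squares[of "\<lambda>l. norm (a l *\<^sub>R res l)" "{..<i}"]
    by (simp add: mult.commute[of "real i"])
  also have "\<dots> \<le> real CARD('m) * (\<Sum>l<i. (norm (a l *\<^sub>R res l))\<^sup>2)"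
    using steps_le_dim i by (intro mult_right_mono sum_nonneg) auto
  finally have "s * (norm (sol i))\<^sup>2 \<le> s * (real CARD('m) * (\<Sum>l<i. (norm (a l *\<^sub>R res l))\<^sup>2))"
    using s by (intro mult_left_mono)
  also have "\<dots> = (\<Sum>l<i. (a l)\<^sup>2 * (real CARD('m) * s * (norm (res l))\<^sup>2))"
    by (simp add: sum_distrib_left power_mult_distrib mult_ac)
  also have "\<dots> \<le> (\<Sum>l<i. (a l)\<^sup>2 * curv l)"
    using low by (intro sum_mono mult_left_mono) auto
  finally show ?thesis using q by simp
qed

section \<open>Krylov spaces and minimality of the residual\<close>

lemma krylov_subset: "k \<le> t \<Longrightarrow> krylov k H g \<subseteq> span (dir ` {..<k})"
proof -
  assume k: "k \<le> t"
  \<comment> \<open>Multiplication by \<open>H\<close> raises the index by at most one: the image is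
    a multiple of a difference of consecutive residuals, each a combination of at most two
    directions.\<close>
  have Hdir: "H *v dir j \<in> span (dir ` {..Suc j})" if "j < t" for j
  proof -
    have "H *v dir j = (1 / zeta j) *\<^sub>R (res j - res (Suc j))"
      using zeta_pos[OF that] by (simp add: res_Suc)
    moreover have "res (Suc j) \<in> span (dir ` {..Suc j})"
    proof -
      have "res (Suc j) = dir (Suc j) - beta j *\<^sub>R dir j" by (simp add: dir_Suc)
      also have "\<dots> \<in> span (dir ` {..Suc j})"
        by (rule span_diff[OF span_base span_scale[OF span_base]]) auto
      finally show ?thesis .
    qed
    moreover have "res j \<in> span (dir ` {..Suc j})"
    proof (cases j)
      case 0
      then have "res j = dir j" by (simp add: iter_0)
      then show ?thesis by (auto intro: span_base)
    next
      case (Suc l)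
      then have "res j = dir j - beta l *\<^sub>R dir l" by (simp add: dir_Suc)
      also have "\<dots> \<in> span (dir ` {..Suc j})"
        by (rule span_diff[OF span_base span_scale[OF span_base]]) (auto simp: Suc)
      finally show ?thesis .
    qed
    ultimately show ?thesis by (auto intro!: span_scale span_diff)
  qed
  have "((\<lambda>v. H *v v) ^^ i) g \<in> span (dir ` {..i})" if "i < k" for i
    using that
  proof (induction i)
    case 0
    have "- dir 0 \<in> span (dir ` {..0})" by (rule span_neg[OF span_base]) auto
    moreover have "- dir 0 = g" by (simp add: iter_0)
    ultimately show ?case by (metis funpow_0)
  next
    case (Suc i)
    have "H *v u \<in> span (dir ` {..Suc i})" if u: "u \<in> span (dir ` {..i})" for u
      using u
    proof (induction u rule: span_induct_alt)
      case base
      then show ?case by (simp add: span_0)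
    next
      case (step c x y)
      then obtain j where j: "j \<le> i" "x = dir j" by auto
      have "H *v x \<in> span (dir ` {..Suc j})" using Hdir[of j] j Suc.prems k by simp
      moreover have "span (dir ` {..Suc j}) \<subseteq> span (dir ` {..Suc i})"
        using j by (intro span_mono image_mono) auto
      ultimately show ?case using step
        by (auto simp: matrix_vector_right_distrib matrix_vector_mult_scaleR
            intro!: span_add span_scale)
    qed
    then show ?case using Suc by simp
  qed
  then have "((\<lambda>v. H *v v) ^^ i) g \<in> span (dir ` {..<k})" if "i < k" for i
    using that span_mono[of "dir ` {..i}" "dir ` {..<k}"] by fastforce
  then show ?thesis unfolding krylov_def by (intro span_minimal subspace_span) auto
qed

text \<open>This Galerkin condition makes \<open>sol k\<close> a minimizer of
  \<open>norm (H *v z + g)\<close> over the Krylov space. It links the recurrence with LSMR, which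
  is defined by minimization.\<close>

lemma res_H_krylov: "k \<le> t \<Longrightarrow> z \<in> krylov k H g \<Longrightarrow> res k \<bullet> (H *v z) = 0"
proof -
  assume k: "k \<le> t" and z: "z \<in> krylov k H g"
  have "z \<in> span (dir ` {..<k})" using krylov_subset[OF k] z by blast
  then show ?thesis
  proof (induction z rule: span_induct_alt)
    case (step c x y)
    then show ?case using res_H_dir[of k] k
      by (auto simp: matrix_vector_right_distrib matrix_vector_mult_scaleR inner_add_right)
  qed simp
qed

end

lemma H_krylov: "z \<in> krylov k H g \<Longrightarrow> H *v z \<in> krylov (Suc k) H g"
  unfolding krylov_def
proof (induction z rule: span_induct_alt)
  case base
  then show ?case by (simp add: span_0)
next
  case (step c x y)
  then obtain i where i: "i < k" "x = ((\<lambda>v. H *v v) ^^ i) g" by auto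
  then have "H *v x = ((\<lambda>v. H *v v) ^^ (Suc i)) g" by simp
  then have "H *v x \<in> span {((\<lambda>v. H *v v) ^^ i) g |i. i < Suc k}"
    using i(1) by (intro span_base) blast
  then show ?case using step
    by (auto simp: matrix_vector_right_distrib matrix_vector_mult_scaleR
        intro!: span_add span_scale)
qed

lemma krylov_mono: "i \<le> j \<Longrightarrow> krylov i H g \<subseteq> krylov j H g"
  unfolding krylov_def by (intro span_mono) auto

lemma subspace_krylov: "subspace (krylov k A b)"
  unfolding krylov_def by (rule subspace_span)

lemma iterates_in_krylov:
  "sol i \<in> krylov i H g" "res i \<in> krylov (Suc i) H g" "dir i \<in> krylov (Suc i) H g"
proof (induction i)
  case 0
  have "g = ((\<lambda>v. H *v v) ^^ 0) g" by simp
  then have "g \<in> krylov (Suc 0) H g" unfolding krylov_def by (intro span_base) blast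
  then have "- g \<in> krylov (Suc 0) H g" using subspace_krylov by (intro subspace_neg)
  then show "sol 0 \<in> krylov 0 H g" "res 0 \<in> krylov (Suc 0) H g" "dir 0 \<in> krylov (Suc 0) H g"
    using subspace_0[OF subspace_krylov] by (auto simp: iter_0)
next
  case (Suc i)
  note m = subsetD[OF krylov_mono]
  show "sol (Suc i) \<in> krylov (Suc i) H g"
    unfolding sol_Suc using Suc m[of i "Suc i"]
    by (auto intro!: subspace_add[OF subspace_krylov] subspace_scale[OF subspace_krylov])
  show 1: "res (Suc i) \<in> krylov (Suc (Suc i)) H g"
    unfolding res_Suc using Suc(2,3) m[of "Suc i" "Suc (Suc i)"]
    by (auto intro!: subspace_diff[OF subspace_krylov] subspace_scale[OF subspace_krylov] H_krylov)
  show "dir (Suc i) \<in> krylov (Suc (Suc i)) H g"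
    unfolding dir_Suc using 1 Suc(3) m[of "Suc i" "Suc (Suc i)"]
    by (auto intro!: subspace_add[OF subspace_krylov] subspace_scale[OF subspace_krylov])
qed

end

section \<open>LSMR\<close>

lemma krylov_subset_invariant:
  assumes "subspace S" "b \<in> S" "\<And>v. v \<in> S \<Longrightarrow> A *v v \<in> S"
  shows "krylov t A b \<subseteq> S"
proof -
  have "((\<lambda>v. A *v v) ^^ i) b \<in> S" for i
    using assms(2,3) by (induction i) auto
  then show ?thesis unfolding krylov_def by (intro span_minimal assms(1)) auto
qed

lemma arg_min_on_least:
  fixes h :: "'a \<Rightarrow> real"
  assumes "x \<in> S" "\<And>y. y \<in> S \<Longrightarrow> h x \<le> h y"
  shows "arg_min_on h S \<in> S" "\<And>y. y \<in> S \<Longrightarrow> h (arg_min_on h S) \<le> h y"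
proof -
  have "is_arg_min h (\<lambda>x. x \<in> S) x" using assms by (force simp: is_arg_min_def)
  then have "is_arg_min h (\<lambda>x. x \<in> S) (arg_min_on h S)"
    unfolding arg_min_on_def arg_min_def by (rule someI)
  then show "arg_min_on h S \<in> S" "\<And>y. y \<in> S \<Longrightarrow> h (arg_min_on h S) \<le> h y"
    by (force simp: is_arg_min_def)+
qed

text \<open>The image of a subspace is a subspace, hence closed, and has a point nearest to
  \<open>- b\<close>.\<close>

lemma least_squares_exists:
  fixes M :: "real^'n^'m"
  assumes "subspace S"
  obtains x where "x \<in> S" "\<And>y. y \<in> S \<Longrightarrow> norm (M *v x + b) \<le> norm (M *v y + b)"
proof -
  let ?T = "(\<lambda>v. M *v v) ` S"
  have "subspace ?T" using assms by (intro linear_subspace_image) auto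
  then have "closed ?T" by (rule closed_subspace)
  moreover have "?T \<noteq> {}" using subspace_0[OF assms] by blast
  ultimately obtain z where z: "z \<in> ?T" "\<And>y. y \<in> ?T \<Longrightarrow> dist (- b) z \<le> dist (- b) y"
    using distance_attains_inf by metis
  have d: "dist (- b) w = norm (w + b)" for w
    by (simp add: dist_norm norm_minus_commute[of "- b"])
  obtain x where "x \<in> S" "z = M *v x" using z(1) by blast
  then show ?thesis using that[of x] z(2) unfolding d by blast
qed

lemma lsmr_iterate_least:
  shows "lsmr_iterate A b t \<in> krylov t (transpose A ** A) (transpose A *v b)"
    and "v \<in> krylov t (transpose A ** A) (transpose A *v b) \<Longrightarrow>
      norm ((transpose A ** A) *v lsmr_iterate A b t + transpose A *v b)
        \<le> norm ((transpose A ** A) *v v + transpose A *v b)"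
proof -
  have "subspace (krylov t (transpose A ** A) (transpose A *v b))"
    unfolding krylov_def by (rule subspace_span)
  from least_squares_exists[OF this, of "transpose A ** A" "transpose A *v b"]
  obtain x where "x \<in> krylov t (transpose A ** A) (transpose A *v b)"
    "\<And>y. y \<in> krylov t (transpose A ** A) (transpose A *v b) \<Longrightarrow>
      norm ((transpose A ** A) *v x + transpose A *v b) \<le> norm ((transpose A ** A) *v y + transpose A *v b)"
    by blast
  from arg_min_on_least[where h = "\<lambda>v. norm ((transpose A ** A) *v v + transpose A *v b)", OF this]
  show "lsmr_iterate A b t \<in> krylov t (transpose A ** A) (transpose A *v b)"
    and "v \<in> krylov t (transpose A ** A) (transpose A *v b) \<Longrightarrow>
      norm ((transpose A ** A) *v lsmr_iterate A b t + transpose A *v b)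
        \<le> norm ((transpose A ** A) *v v + transpose A *v b)"
    unfolding lsmr_iterate_def by blast+
qed

text \<open>A bound for multipliers, where any uniform constant suffices. Zero is an admissible
  competitor, so the image of the iterate under \<open>transpose A ** A\<close> has at most twice
  the norm of \<open>transpose A *v b\<close>; coercivity with constant \<open>s\<^sup>2\<close>
  does the rest.\<close>

lemma norm_lsmr_iterate_le:
  fixes A :: "real^'n^'m"
  assumes s: "0 < s" and lower: "\<And>u. s * norm u \<le> norm (A *v u)"
    and k: "0 \<le> k" and upper: "\<And>u. norm (A *v u) \<le> k * norm u"
  shows "norm (lsmr_iterate A b t) \<le> 2 * k * norm b / s\<^sup>2"
proof -
  define l where "l = lsmr_iterate A b t"
  have 0: "0 \<in> krylov t (transpose A ** A) (transpose A *v b)"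
    unfolding krylov_def by (rule span_0)
  have "norm ((transpose A ** A) *v l + transpose A *v b) \<le> norm (transpose A *v b)"
    using lsmr_iterate_least(2)[OF 0] by (simp add: l_def)
  then have 1: "norm ((transpose A ** A) *v l) \<le> 2 * norm (transpose A *v b)"
    using norm_triangle_ineq4[of "(transpose A ** A) *v l + transpose A *v b" "transpose A *v b"]
    by simp
  have 2: "norm (transpose A *v b) \<le> k * norm b"
  proof (cases "transpose A *v b = 0")
    case True
    then show ?thesis using k by (simp only: norm_zero) simp
  next
    case False
    have "(norm (transpose A *v b))\<^sup>2 = b \<bullet> (A *v (transpose A *v b))"
      by (simp only: power2_norm_eq_inner inner_transpose_mult)
    also have "\<dots> \<le> norm b * (k * norm (transpose A *v b))"
      by (intro order_trans[OF norm_cauchy_schwarz] mult_left_mono upper norm_ge_zero)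
    finally show ?thesis using False by (simp add: power2_eq_square mult_ac del: transpose_matrix_vector)
  qed
  have "(s * norm l)\<^sup>2 \<le> (norm (A *v l))\<^sup>2"
    using lower[of l] s by (intro power_mono) auto
  also have "\<dots> = l \<bullet> ((transpose A ** A) *v l)"
    using inner_transpose_mult[of "transpose A" l "A *v l"]
    by (simp only: power2_norm_eq_inner matrix_vector_mul_assoc transpose_transpose)
  also have "\<dots> \<le> norm l * (2 * (k * norm b))"
    using 1 2 by (intro order_trans[OF norm_cauchy_schwarz] mult_left_mono) auto
  finally have 3: "norm l * (s\<^sup>2 * norm l) \<le> norm l * (2 * k * norm b)"
    by (simp add: power2_eq_square mult_ac)
  have "s\<^sup>2 * norm l \<le> 2 * k * norm b"
  proof (cases "l = 0")
    case True
    then show ?thesis using k by simp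
  next
    case False
    then show ?thesis using 3 by simp
  qed
  then show ?thesis using s by (simp add: l_def field_simps)
qed

text \<open>\<open>transpose J ** J\<close> may be singular, but it is injective on the range of
  \<open>transpose J\<close>, which contains all Krylov spaces. There the LSMR minimizer is unique
  and can be identified with a conjugate residual iterate.\<close>

lemma inexact_normal_bounds:
  fixes J :: "real^'n^'m"
  assumes s: "0 < s" and lower: "\<And>u. s * norm u \<le> norm (transpose J *v u)" and tau: "0 \<le> \<tau>"
  shows "norm (J *v inexact_normal J b \<tau> + b) \<le> \<tau> * norm b"
    and "s * norm (inexact_normal J b \<tau>) \<le> norm b"
proof -
  define A where "A = transpose J ** J"
  define g where "g = transpose J *v b"
  have AJ: "A *v u = transpose J *v (J *v u)" for u
    by (simp only: A_def matrix_vector_mul_assoc)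
  interpret conjugate_residual A g
    by unfold_locales (simp add: A_def matrix_transpose_mul)
  have curv: "curv i = (norm (J *v res i))\<^sup>2" for i
    using inner_transpose_mult[of J "J *v res i" "res i"]
    by (simp only: curv_def AJ power2_norm_eq_inner inner_commute)
  have inj: "u = 0" if "transpose J *v u = 0" for u
    using lower[of u] s that by (simp add: mult_le_0_iff)
  have range: "subspace (range (\<lambda>u. transpose J *v u))"
    by (rule linear_subspace_image[OF matrix_vector_mul_linear subspace_UNIV])
  have kr: "krylov i A g \<subseteq> range (\<lambda>u. transpose J *v u)" for i
    by (rule krylov_subset_invariant[OF range]) (unfold AJ g_def, (rule rangeI)+)
  have ker: "x = 0" if x: "x \<in> range (\<lambda>u. transpose J *v u)" "J *v x = 0" for x
  proof -
    obtain u where u: "x = transpose J *v u" using x(1) by blast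
    have "x \<bullet> x = u \<bullet> (J *v x)" by (subst (1) u) (rule inner_transpose_mult)
    then show ?thesis using x(2) by simp
  qed
  have kerA: "x = 0" if "x \<in> range (\<lambda>u. transpose J *v u)" "A *v x = 0" for x
    using ker[OF that(1)] inj[of "J *v x"] that(2) unfolding AJ by blast
  have "\<exists>i. \<not> 0 < curv i"
    using steps_le_dim[of "Suc CARD('n)"] by fastforce
  \<comment> \<open>\<open>M\<close> is the first index without positive curvature. Here the
    curvature is the squared norm of \<open>J *v res M\<close>, so it vanishes only with the
    residual, and \<open>sol M\<close> is exact.\<close>
  then obtain M where M: "\<not> 0 < curv M" "\<And>i. i < M \<Longrightarrow> 0 < curv i"
    using exists_least_iff[of "\<lambda>i. \<not> 0 < curv i"] by blast
  have "J *v res M = 0" using M(1) by (simp add: curv)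
  then have resM: "res M = 0" using ker kr iterates_in_krylov(2) by blast
  have solM: "J *v sol M + b = 0"
  proof (rule inj)
    have "A *v sol M + g = - res M" by (simp add: res_eq)
    then have "A *v sol M + g = 0" unfolding resM by simp
    then show "transpose J *v (J *v sol M + b) = 0"
      unfolding AJ g_def matrix_vector_right_distrib .
  qed
  \<comment> \<open>The recurrence is controlled only up to \<open>M\<close>; for larger
    \<open>t\<close> the residual at \<open>M\<close> is already zero.\<close>
  have lsmr: "lsmr_iterate J b t = sol (min t M)" for t
  proof -
    let ?k = "min t M" and ?v = "lsmr_iterate J b t"
    have v: "?v \<in> krylov t A g" "\<And>w. w \<in> krylov t A g \<Longrightarrow> norm (A *v ?v + g) \<le> norm (A *v w + g)"
      using lsmr_iterate_least[where A = J and b = b and t = t] unfolding A_def g_def by blast+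
    have k: "sol ?k \<in> krylov t A g"
      using iterates_in_krylov(1)[of ?k] krylov_mono[of ?k t] by auto
    have orth: "res ?k \<bullet> (A *v z) = 0" if "z \<in> krylov t A g" for z
    proof (cases "t \<le> M")
      case True
      then show ?thesis using res_H_krylov[of M ?k] M(2) that by simp
    next
      case False
      then show ?thesis using resM by (simp add: min_def)
    qed
    let ?e = "?v - sol ?k"
    have e: "?e \<in> krylov t A g" using v k subspace_krylov by (intro subspace_diff)
    have 1: "A *v ?v + g = A *v ?e - res ?k"
      by (simp add: res_eq matrix_vector_mult_diff_distrib)
    have "norm (A *v ?v + g) \<le> norm (res ?k)"
      using v(2)[OF k] by (simp add: res_eq norm_minus_commute[of "- g"] add.commute)
    \<comment> \<open>Minimality against Pythagoras: \<open>A *v ?e\<close> is orthogonal to the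
      residual, so it can only be zero.\<close>
    then have "(norm (A *v ?e - res ?k))\<^sup>2 \<le> (norm (res ?k))\<^sup>2"
      unfolding 1 by (intro power_mono) auto
    then have "(norm (A *v ?e))\<^sup>2 \<le> 0"
      using orth[OF e] by (simp add: power2_norm_eq_inner inner_diff_left inner_diff_right inner_commute)
    then have "A *v ?e = 0" by simp
    then show ?thesis using kerA[of ?e] e kr by (simp add: subset_iff)
  qed
  let ?P = "\<lambda>t. 1 \<le> t \<and> norm (J *v lsmr_iterate J b t + b) \<le> \<tau> * norm b"
  \<comment> \<open>The search starts at index 1, whereas \<open>M\<close> is zero if
    \<open>b\<close> is zero.\<close>
  have "?P (max 1 M)" using solM tau by (simp add: lsmr)
  then have P: "?P (Least ?P)" by (rule LeastI)
  then show "norm (J *v inexact_normal J b \<tau> + b) \<le> \<tau> * norm b"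
    unfolding inexact_normal_def by blast
  define k where "k = min (Least ?P) M"
  have k: "k \<le> M" "inexact_normal J b \<tau> = sol k"
    unfolding inexact_normal_def k_def by (simp, rule lsmr)
  \<comment> \<open>Pairing the solution with its preimage \<open>u\<close> under
    \<open>transpose J\<close> brings in the lower bound \<open>s\<close> just once and yields the
    constant \<open>1 / s\<close>.\<close>
  have "s * norm (sol M) \<le> norm b"
  proof -
    obtain u where u: "sol M = transpose J *v u" using iterates_in_krylov(1) kr by blast
    have "sol M \<bullet> sol M = u \<bullet> (J *v sol M)" by (subst (1) u) (rule inner_transpose_mult)
    also have "J *v sol M = - b" using solM by (simp add: eq_neg_iff_add_eq_0)
    finally have "(norm (sol M))\<^sup>2 = u \<bullet> (- b)" by (simp add: power2_norm_eq_inner)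
    also have "\<dots> \<le> norm u * norm b" using norm_cauchy_schwarz[of u "- b"] by simp
    finally have "s * (norm (sol M))\<^sup>2 \<le> (s * norm u) * norm b"
      using s by (simp add: mult.assoc)
    also have "\<dots> \<le> norm (sol M) * norm b"
      using lower[of u] u by (intro mult_right_mono) auto
    finally have "norm (sol M) * (s * norm (sol M)) \<le> norm (sol M) * norm b"
      by (simp add: power2_eq_square mult_ac)
    then show ?thesis by (cases "sol M = 0") auto
  qed
  moreover have "norm (sol k) \<le> norm (sol M)" using norm_sol_mono[of M k M] M(2) k by simp
  ultimately show "s * norm (inexact_normal J b \<tau>) \<le> norm b"
    unfolding k(2) using s by (meson less_imp_le mult_left_mono order_trans)
qed

section \<open>Projected conjugate residuals\<close>

lemma transpose_mult_component: "(transpose Z *v u) $ j = column j Z \<bullet> (u :: real^'n)"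
  by (simp add: matrix_vector_mult_def transpose_def column_def inner_vec_def)

lemma inner_mult_mult: "(Z *v x) \<bullet> (Z *v y) = x \<bullet> (transpose Z *v ((Z :: real^'m^'n) *v y))"
  using inner_transpose_mult[of "transpose Z" x "Z *v y"] by (simp only: transpose_transpose)

context
  fixes Z :: "real^'m^'n"
  assumes Z: "orthonormal_columns Z"
begin

text \<open>\<open>transpose Z ** Z\<close> is diagonal with entry 1 for actual columns and 0 for
  padding. So \<open>Z\<close> is isometric on vectors without padding components, and contracts in
  general.\<close>

lemma transpose_mult_mult_component:
  "(transpose Z *v (Z *v x)) $ j = (norm (column j Z))\<^sup>2 * x $ j"
proof -
  have "(transpose Z *v (Z *v x)) $ j = (\<Sum>i\<in>UNIV. x $ i * (column j Z \<bullet> column i Z))"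
    by (simp only: transpose_mult_component matrix_mult_sum[of Z x] inner_sum_right
        scalar_mult_eq_scaleR inner_scaleR_right)
  also have "\<dots> = (\<Sum>i\<in>UNIV. if i = j then x $ i * (norm (column j Z))\<^sup>2 else 0)"
    using Z by (intro sum.cong refl)
      (auto simp: orthonormal_columns_def orthogonal_def power2_norm_eq_inner)
  finally show ?thesis by simp
qed

lemma transpose_mult_mult_transpose: "transpose Z *v (Z *v (transpose Z *v u)) = transpose Z *v u"
proof (subst vec_eq_iff, intro allI)
  fix j
  show "(transpose Z *v (Z *v (transpose Z *v u))) $ j = (transpose Z *v u) $ j"
    using Z unfolding transpose_mult_mult_component
    by (cases "column j Z = 0")
      (auto simp: orthonormal_columns_def transpose_mult_component simp del: transpose_matrix_vector)
qed

lemma norm_mult_le: "norm (Z *v x) \<le> norm x"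
proof -
  have "(norm (Z *v x))\<^sup>2 = x \<bullet> (transpose Z *v (Z *v x))"
    by (simp only: power2_norm_eq_inner inner_mult_mult)
  also have "\<dots> = (\<Sum>j\<in>UNIV. x $ j * ((norm (column j Z))\<^sup>2 * x $ j))"
    by (simp only: inner_vec_def[of x] transpose_mult_mult_component inner_real_def)
  also have "\<dots> = (\<Sum>j\<in>UNIV. (norm (column j Z))\<^sup>2 * (x $ j)\<^sup>2)"
    by (simp add: power2_eq_square mult_ac)
  also have "\<dots> \<le> (\<Sum>j\<in>UNIV. (x $ j)\<^sup>2)"
  proof (rule sum_mono)
    fix j
    have "norm (column j Z) = 0 \<or> norm (column j Z) = 1"
      using Z unfolding orthonormal_columns_def norm_eq_zero by blast
    then have "(norm (column j Z))\<^sup>2 \<le> 1" by auto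
    then show "(norm (column j Z))\<^sup>2 * (x $ j)\<^sup>2 \<le> (x $ j)\<^sup>2"
      using mult_right_mono[of "(norm (column j Z))\<^sup>2" 1 "(x $ j)\<^sup>2"] by simp
  qed
  also have "\<dots> = (norm x)\<^sup>2"
    unfolding power2_norm_eq_inner inner_vec_def inner_real_def by (simp only: power2_eq_square)
  finally show ?thesis by (rule power2_le_imp_le) simp
qed

lemma norm_transpose_mult_le: "norm (transpose Z *v u) \<le> norm u"
proof -
  have "(norm (transpose Z *v u))\<^sup>2 = u \<bullet> (Z *v (transpose Z *v u))"
    by (simp only: power2_norm_eq_inner inner_transpose_mult)
  also have "\<dots> \<le> norm u * norm (transpose Z *v u)"
    by (intro order_trans[OF norm_cauchy_schwarz] mult_left_mono norm_mult_le norm_ge_zero)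
  finally show ?thesis
    by (cases "transpose Z *v u = 0") (simp_all add: power2_eq_square del: transpose_matrix_vector)
qed

end

text \<open>\<open>om\<close> stands for \<open>omega_tan\<close>; its bound by
  \<open>sg / k\<^sup>2\<close> is conditional on positive \<open>k\<close>, as in the case
  distinction of that definition. The proof treats the initial residual, iterates of index at least
  1, and the low-curvature residual separately.\<close>

lemma projected_cr_bounds:
  fixes H :: "real^'d^'d" and g :: "real^'d" and Z :: "real^'d^'d" and J :: "real^'d^'c"
  assumes symH: "transpose H = H" and Z: "orthonormal_columns Z"
    and sg: "0 < sg" and tt: "0 < tt"
    and k: "0 \<le> k" and Hk: "\<And>u. norm (H *v u) \<le> k * norm u"
    and feas: "norm (J *v (Z *v (transpose Z *v g))) \<le> tn / pn * (g \<bullet> (Z *v (transpose Z *v g)))"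
    and om: "0 \<le> om" "0 < k \<Longrightarrow> om \<le> sg / k\<^sup>2" "om \<le> tt / sqrt (tt\<^sup>2 + k\<^sup>2)"
    and w: "w = projected_cr H g Z J pn sg tt tn"
  shows "norm (J *v w) \<le> - (tn / pn) * (g \<bullet> w)"
    and "g \<bullet> w \<le> - min 1 sg * (norm w)\<^sup>2"
    and "om * norm (Z *v (transpose Z *v g)) \<le> norm w"
proof -
  define A where "A = transpose Z ** H ** Z"
  define b where "b = transpose Z *v g"
  have AZ: "A *v u = transpose Z *v (H *v (Z *v u))" for u
    by (simp only: A_def matrix_vector_mul_assoc matrix_mul_assoc)
  interpret conjugate_residual A b
    by unfold_locales (simp add: A_def matrix_transpose_mul symH matrix_mul_assoc)
  have Ak: "norm (A *v u) \<le> k * norm u" for u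
  proof -
    have "norm (A *v u) \<le> k * norm (Z *v u)"
      unfolding AZ by (rule order_trans[OF norm_transpose_mult_le[OF Z] Hk])
    also have "\<dots> \<le> k * norm u" using k by (intro mult_left_mono norm_mult_le[OF Z])
    finally show ?thesis .
  qed
  \<comment> \<open>\<open>S\<close> consists of the reduced vectors without padding components. All
    iterates lie in it, so lengths can be computed in reduced coordinates.\<close>
  define S where "S = {x. transpose Z *v (Z *v x) = x}"
  have ker: "subspace S" unfolding S_def
    by (auto simp: subspace_def matrix_vector_right_distrib matrix_vector_mult_scaleR
        simp del: transpose_matrix_vector)
  have kr: "krylov i A b \<subseteq> S" for i
    by (rule krylov_subset_invariant[OF ker])
      (simp_all only: S_def mem_Collect_eq AZ b_def transpose_mult_mult_transpose[OF Z])
  have S_norm: "norm (Z *v x) = norm x" if "x \<in> S" for x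
    using that inner_mult_mult[of Z x x] by (simp only: S_def mem_Collect_eq norm_eq_sqrt_inner)
  have solS: "sol i \<in> S" and resS: "res i \<in> S" for i
    using kr iterates_in_krylov by blast+
  have bS: "b \<in> S" using resS[of 0] subspace_neg[OF ker, of "res 0"] by (simp add: iter_0)
  have g_Z: "g \<bullet> (Z *v x) = b \<bullet> x" for x
    unfolding b_def by (rule inner_transpose_mult[symmetric])
  let ?inf = "\<lambda>u. norm (J *v u) > - (tn / pn) * (g \<bullet> u)"
  let ?conv = "\<lambda>t. norm (A *v res t) \<le> tt * norm (A *v sol t)"
  let ?low = "\<lambda>t. curv t \<le> (real CARD('d) + 1) * sg * (norm (res t))\<^sup>2"
  let ?P = "\<lambda>t. 1 \<le> t \<and> (?inf (Z *v sol t) \<or> ?conv t \<or> ?low t)"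
  define T where "T = Least ?P"
  have w_eq: "w = (if ?low 0 then Z *v res 0
         else if ?inf (Z *v sol T) then Z *v sol (T - 1)
         else if ?conv T then Z *v sol T
         else if ?inf (Z *v res T) then Z *v sol T
         else Z *v res T)"
    unfolding w projected_cr_def Let_def T_def A_def[symmetric] b_def[symmetric]
      sol_def[symmetric] res_def[symmetric] curv_def[symmetric] ..
  \<comment> \<open>\<open>feas\<close> is the feasibility test for the projected gradient, and both
    sides of the test scale with \<open>a\<close>. This covers the initial residual and the first
    iterate.\<close>
  have feas0: "\<not> ?inf (a *\<^sub>R (Z *v res 0))" if a: "0 \<le> a" for a
  proof -
    have r0: "Z *v res 0 = - (Z *v (transpose Z *v g))"
      unfolding b_def[symmetric] iter_0 by (rule linear_neg[OF matrix_vector_mul_linear])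
    have neg: "J *v (- u) = - (J *v u)" for u by (rule linear_neg[OF matrix_vector_mul_linear])
    have "norm (J *v (a *\<^sub>R (Z *v res 0))) = a * norm (J *v (Z *v (transpose Z *v g)))"
      using a unfolding r0 by (simp add: matrix_vector_mult_scaleR neg del: transpose_matrix_vector)
    also have "\<dots> \<le> a * (tn / pn * (g \<bullet> (Z *v (transpose Z *v g))))"
      using a feas by (intro mult_left_mono)
    also have "\<dots> = - (tn / pn) * (g \<bullet> (a *\<^sub>R (Z *v res 0)))"
      unfolding r0 by (simp del: transpose_matrix_vector)
    finally show ?thesis by simp
  qed
  have Pg: "norm (Z *v (transpose Z *v g)) = norm b"
    using S_norm[OF bS] by (simp only: b_def)
  have om1: "om \<le> 1"
  proof -
    have "tt \<le> sqrt (tt\<^sup>2 + k\<^sup>2)" using tt by (intro real_le_rsqrt) simp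
    moreover from this have "0 < sqrt (tt\<^sup>2 + k\<^sup>2)" using tt by linarith
    ultimately have "tt / sqrt (tt\<^sup>2 + k\<^sup>2) \<le> 1" by (simp only: divide_le_eq_1_pos)
    then show ?thesis using om(3) by linarith
  qed
  have "\<not> ?inf w \<and> g \<bullet> w \<le> - min 1 sg * (norm w)\<^sup>2 \<and> om * norm b \<le> norm w"
  proof (cases "?low 0")
    case True
    then have w0: "w = Z *v res 0" by (simp add: w_eq)
    have nw: "norm w = norm b" using S_norm[OF resS[of 0]] by (simp add: w0 iter_0)
    have "g \<bullet> w = - (norm w)\<^sup>2"
      unfolding w0 g_Z nw[unfolded w0] by (simp add: iter_0 power2_norm_eq_inner)
    moreover have "min 1 sg * (norm w)\<^sup>2 \<le> 1 * (norm w)\<^sup>2" by (intro mult_right_mono) auto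
    moreover have "om * norm b \<le> norm w" using om1 mult_right_mono[of om 1 "norm b"] nw by simp
    ultimately show ?thesis using feas0[of 1] w0 by simp
  next
    case False
    have nonlow: "0 < curv i" if "\<not> ?low i" for i
    proof -
      have "0 \<le> (real CARD('d) + 1) * sg * (norm (res i))\<^sup>2" using sg by simp
      then show ?thesis using that by linarith
    qed
    have "\<exists>t. ?P t"
    proof (rule ccontr)
      assume n: "\<not> (\<exists>t. ?P t)"
      have "0 < curv i" for i
        using n False nonlow[of i] by (cases "i = 0") auto
      then show False using steps_le_dim[of "Suc CARD('d)"] by simp
    qed
    then have PT: "?P T" unfolding T_def by (rule LeastI_ex)
    have notP: "\<not> ?P i" if "i < T" for i using that unfolding T_def by (rule not_less_Least)
    have high: "\<not> ?low i" if "i < T" for i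
      using notP[OF that] False by (cases "i = 0") auto
    \<comment> \<open>\<open>T\<close> now takes the role of the bound \<open>t\<close> in the
      orthogonality results; the curvature at \<open>T\<close> itself may fail to be
      positive.\<close>
    have pos: "0 < curv i" if "i < T" for i using nonlow[OF high[OF that]] .
    have r0: "res 0 \<noteq> 0" using pos[of 0] PT by (auto simp: curv_def)
    have kpos: "0 < k"
    proof (rule ccontr)
      assume "\<not> 0 < k"
      then have "A *v res 0 = 0" using Ak[of "res 0"] k by simp
      then show False using pos[of 0] PT by (simp add: curv_def)
    qed
    have dir0: "dir 0 = res 0" by (simp add: iter_0)
    have sol1: "sol 1 = zeta 0 *\<^sub>R res 0" by (simp add: sol_Suc iter_0)
    \<comment> \<open>Treats every exit that returns an iterate. Its length is inherited from the
      first iterate because \<open>norm (A *v sol i)\<close> grows with \<open>i\<close>. The bound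
      \<open>k\<close> is used once for \<open>A *v res 0\<close> and once for
      \<open>A *v sol i\<close>, hence \<open>k\<^sup>2\<close>.\<close>
    have SOL: "\<not> ?inf (Z *v sol i) \<Longrightarrow> ?thesis" if i: "1 \<le> i" "i \<le> T" and wi: "w = Z *v sol i" for i
    proof -
      assume fe: "\<not> ?inf (Z *v sol i)"
      have nw: "norm w = norm (sol i)" using S_norm[OF solS[of i]] wi by simp
      have "sg * (norm (sol i))\<^sup>2 \<le> sol i \<bullet> (A *v sol i)"
      proof (rule sol_curvature[OF pos i(2)])
        fix l assume "l < i"
        then have "(real CARD('d) + 1) * sg * (norm (res l))\<^sup>2 \<le> curv l" using high[of l] i by simp
        moreover have "real CARD('d) * sg * (norm (res l))\<^sup>2 \<le> (real CARD('d) + 1) * sg * (norm (res l))\<^sup>2"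
          using sg by (intro mult_right_mono) auto
        ultimately show "real CARD('d) * sg * (norm (res l))\<^sup>2 \<le> curv l" by linarith
      qed (use sg in auto)
      then have 1: "g \<bullet> w \<le> - sg * (norm w)\<^sup>2"
        using inner_g_sol_le[OF pos i(2)] unfolding nw unfolding wi g_Z by simp
      have "min 1 sg * (norm w)\<^sup>2 \<le> sg * (norm w)\<^sup>2" by (intro mult_right_mono) auto
      then have 2: "g \<bullet> w \<le> - min 1 sg * (norm w)\<^sup>2" using 1 by linarith
      have Ar0: "0 < norm (A *v res 0)"
        using pos[of 0] PT by (auto simp: curv_def)
      have "norm (A *v sol 1) = \<bar>zeta 0\<bar> * norm (A *v res 0)"
        unfolding sol1 matrix_vector_mult_scaleR by simp
      also have "\<dots> = curv 0 / norm (A *v res 0)"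
        using Ar0 pos[of 0] PT by (simp add: zeta_def dir0 power2_eq_square)
      also have "\<dots> \<ge> (sg * (norm (res 0))\<^sup>2) / (k * norm (res 0))"
      proof (rule frac_le)
        have "sg * (norm (res 0))\<^sup>2 \<le> (real CARD('d) + 1) * sg * (norm (res 0))\<^sup>2"
          using sg by (intro mult_right_mono) auto
        then show "sg * (norm (res 0))\<^sup>2 \<le> curv 0" using False by linarith
      qed (use Ar0 Ak pos[of 0] PT in auto)
      finally have "sg * norm (res 0) / k \<le> norm (A *v sol 1)"
        using r0 by (simp add: power2_eq_square)
      also have "\<dots> \<le> norm (A *v sol i)" by (rule norm_H_sol_mono[OF pos i])
      also have "\<dots> \<le> k * norm (sol i)" by (rule Ak)
      finally have "sg / k\<^sup>2 * norm b \<le> norm (sol i)"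
        using kpos by (simp add: iter_0 field_simps power2_eq_square)
      moreover have "om * norm b \<le> sg / k\<^sup>2 * norm b" using om(2)[OF kpos] by (intro mult_right_mono) auto
      ultimately show ?thesis using 2 fe nw wi by simp
    qed
    \<comment> \<open>The first iterate is a nonnegative multiple of the initial residual. An
      infeasible exit thus has \<open>T\<close> at least 2 and never returns the zero
      iterate.\<close>
    have feas1: "\<not> ?inf (Z *v sol 1)"
    proof -
      have "Z *v sol 1 = zeta 0 *\<^sub>R (Z *v res 0)"
        unfolding sol1 by (rule matrix_vector_mult_scaleR)
      moreover have "0 \<le> zeta 0" using pos[of 0] PT by (simp add: zeta_def)
      ultimately show ?thesis using feas0 by metis
    qed
    show ?thesis
    proof (cases "?inf (Z *v sol T)")
      case True
      then have "T \<noteq> 1" using feas1 by auto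
      then have T: "1 \<le> T - 1" "T - 1 < T" using PT by auto
      then have "\<not> ?inf (Z *v sol (T - 1))" using notP[of "T - 1"] by blast
      moreover have "w = Z *v sol (T - 1)" using w_eq False True by simp
      ultimately show ?thesis using SOL[OF T(1) less_imp_le[OF T(2)]] by blast
    next
      case feT: False
      show ?thesis
      proof (cases "?conv T \<or> ?inf (Z *v res T)")
        case True
        then have "w = Z *v sol T" using w_eq False feT by auto
        then show ?thesis using SOL[of T] feT PT by blast
      next
        case nc: False
        then have wT: "w = Z *v res T" using w_eq False feT by simp
        have nw: "norm w = norm (res T)" using S_norm[OF resS[of T]] wT by simp
        have 1: "g \<bullet> w = - (norm w)\<^sup>2"
          using inner_g_res[OF pos order_refl] unfolding nw unfolding wT g_Z by simp
        have 2: "min 1 sg * (norm w)\<^sup>2 \<le> 1 * (norm w)\<^sup>2" by (intro mult_right_mono) auto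
        \<comment> \<open>The failed convergence test bounds \<open>A *v sol T\<close> by the
          residual. Inserting this into the Pythagorean identity leaves a bound on
          \<open>norm b\<close> by the residual alone.\<close>
        have "tt * norm (A *v sol T) \<le> k * norm (res T)"
          using nc Ak[of "res T"] by linarith
        then have "(tt * norm (A *v sol T))\<^sup>2 \<le> (k * norm (res T))\<^sup>2"
          using tt by (intro power_mono) auto
        then have "tt\<^sup>2 * ((norm b)\<^sup>2 - (norm (res T))\<^sup>2) \<le> k\<^sup>2 * (norm (res T))\<^sup>2"
          by (simp add: power_mult_distrib norm_H_sol[OF pos order_refl])
        then have "(tt * norm b)\<^sup>2 \<le> (tt\<^sup>2 + k\<^sup>2) * (norm (res T))\<^sup>2"
          by (simp add: power_mult_distrib algebra_simps)
        then have "tt * norm b \<le> sqrt ((tt\<^sup>2 + k\<^sup>2) * (norm (res T))\<^sup>2)"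
          by (rule real_le_rsqrt)
        also have "\<dots> = sqrt (tt\<^sup>2 + k\<^sup>2) * norm (res T)" by (simp add: real_sqrt_mult)
        finally have "tt * norm b \<le> sqrt (tt\<^sup>2 + k\<^sup>2) * norm (res T)" .
        moreover have "0 < sqrt (tt\<^sup>2 + k\<^sup>2)" using tt by (simp add: add_pos_nonneg)
        ultimately have "tt / sqrt (tt\<^sup>2 + k\<^sup>2) * norm b \<le> norm (res T)"
          by (simp add: divide_le_eq mult.commute)
        moreover have "om * norm b \<le> tt / sqrt (tt\<^sup>2 + k\<^sup>2) * norm b"
          by (intro mult_right_mono om) auto
        ultimately show ?thesis using 1 2 nc wT nw by simp
      qed
    qed
  qed
  then show "norm (J *v w) \<le> - (tn / pn) * (g \<bullet> w)"
    and "g \<bullet> w \<le> - min 1 sg * (norm w)\<^sup>2"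
    and "om * norm (Z *v (transpose Z *v g)) \<le> norm w"
    unfolding Pg by simp_all
qed

section \<open>Gradients and Hessians\<close>

text \<open>The sum is the Riesz representative of the derivative; it provides the witness for the
  definite description in \<open>grad\<close>.\<close>

lemma inner_sum_frechet_derivative:
  fixes f :: "'a::euclidean_space \<Rightarrow> real"
  assumes "f differentiable at x"
  shows "h \<bullet> (\<Sum>b\<in>Basis. frechet_derivative f (at x) b *\<^sub>R b) = frechet_derivative f (at x) h"
proof -
  have lin: "linear (frechet_derivative f (at x))" using assms by (rule linear_frechet_derivative)
  have "frechet_derivative f (at x) h = frechet_derivative f (at x) (\<Sum>b\<in>Basis. (h \<bullet> b) *\<^sub>R b)"
    by (simp only: euclidean_representation)
  also have "\<dots> = (\<Sum>b\<in>Basis. (h \<bullet> b) * frechet_derivative f (at x) b)"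
    by (simp add: linear_sum[OF lin] linear_scale[OF lin])
  finally show ?thesis by (simp add: inner_sum_right mult.commute)
qed

lemma GDERIV_grad:
  fixes f :: "'a::euclidean_space \<Rightarrow> real"
  assumes "f differentiable at x"
  shows "GDERIV f x :> grad f x"
    and "grad f x = (\<Sum>b\<in>Basis. frechet_derivative f (at x) b *\<^sub>R b)"
proof -
  let ?G = "\<Sum>b\<in>Basis. frechet_derivative f (at x) b *\<^sub>R b"
  have G: "GDERIV f x :> ?G"
    unfolding gderiv_def inner_sum_frechet_derivative[OF assms] using assms
    by (simp add: frechet_derivative_works[symmetric])
  have u: "D = ?G" if "GDERIV f x :> D" for D
  proof -
    have "(\<lambda>h. h \<bullet> D) = (\<lambda>h. h \<bullet> ?G)"
      using that G unfolding gderiv_def by (rule has_derivative_unique)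
    then show ?thesis by (metis vector_eq_ldot)
  qed
  show "grad f x = ?G" unfolding grad_def by (rule the_equality[where P = "\<lambda>D. GDERIV f x :> D", OF G u])
  then show "GDERIV f x :> grad f x" using G by simp
qed

lemma has_derivative_grad:
  fixes f :: "'a::euclidean_space \<Rightarrow> real"
  assumes "f differentiable at x"
  shows "(f has_derivative (\<lambda>h. grad f x \<bullet> h)) (at x)"
  using GDERIV_grad(1)[OF assms] by (simp add: gderiv_def inner_commute)

lemma frechet_derivative_grad:
  fixes f :: "'a::euclidean_space \<Rightarrow> real"
  assumes "f differentiable at x"
  shows "frechet_derivative f (at x) h = grad f x \<bullet> h"
  using frechet_derivative_at[OF has_derivative_grad[OF assms]] by metis

lemma C2_imp_differentiable: "C2 f \<Longrightarrow> f differentiable at x"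
  by (simp add: C2_def C1_def)

lemma C2_imp_grad_differentiable:
  fixes f :: "'a::euclidean_space \<Rightarrow> real"
  assumes "C2 f"
  shows "grad f differentiable at x"
proof -
  have "grad f = (\<lambda>y. \<Sum>b\<in>Basis. frechet_derivative f (at y) b *\<^sub>R b)"
    using GDERIV_grad(2) C2_imp_differentiable[OF assms] by blast
  moreover have "(\<lambda>y. frechet_derivative f (at y) b) differentiable at x" for b
    using assms by (simp add: C2_def C1_def)
  ultimately show ?thesis by (simp add: differentiable_sum)
qed

section \<open>Symmetry of second derivatives\<close>

lemma mvt_along_line:
  fixes F :: "'a::euclidean_space \<Rightarrow> real"
  assumes "0 < h" "\<And>y. F differentiable at y"
  obtains s where "0 < s" "s < h"
    "F (x + h *\<^sub>R u) - F x = h * frechet_derivative F (at (x + s *\<^sub>R u)) u"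
proof -
  have "((\<lambda>t. F (x + t *\<^sub>R u)) has_real_derivative frechet_derivative F (at (x + t *\<^sub>R u)) u) (at t)" for t
  proof -
    have "(F has_derivative frechet_derivative F (at (x + t *\<^sub>R u))) (at (x + t *\<^sub>R u))"
      using assms(2) by (simp add: frechet_derivative_works[symmetric])
    then have "((\<lambda>t. F (x + t *\<^sub>R u)) has_derivative
        (\<lambda>r. frechet_derivative F (at (x + t *\<^sub>R u)) (r *\<^sub>R u))) (at t)"
      by (rule has_derivative_compose[rotated]) (auto intro!: derivative_eq_intros)
    moreover have "linear (frechet_derivative F (at (x + t *\<^sub>R u)))"
      using assms(2) by (rule linear_frechet_derivative)
    ultimately show ?thesis
      by (simp add: has_field_derivative_def linear_scale mult_commute_abs)
  qed
  from MVT2[OF assms(1) this] obtain s where "0 < s" "s < h"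
    "F (x + h *\<^sub>R u) - F (x + 0 *\<^sub>R u) = (h - 0) * frechet_derivative F (at (x + s *\<^sub>R u)) u"
    by blast
  then show ?thesis using that by simp
qed

lemma second_difference:
  fixes F :: "'a::euclidean_space \<Rightarrow> real"
  assumes "0 < h" "C2 F"
  obtains s r where "0 < s" "s < h" "0 < r" "r < h"
    "F (x + h *\<^sub>R u + h *\<^sub>R v) - F (x + h *\<^sub>R u) - (F (x + h *\<^sub>R v) - F x)
      = h * (h * frechet_derivative (\<lambda>y. frechet_derivative F (at y) u) (at (x + s *\<^sub>R u + r *\<^sub>R v)) v)"
proof -
  have dF: "F differentiable at y" for y using assms(2) by (rule C2_imp_differentiable)
  have dDF: "(\<lambda>y. frechet_derivative F (at y) u) differentiable at y" for y
    using assms(2) by (simp add: C2_def C1_def)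
  define \<phi> where "\<phi> y = F (y + h *\<^sub>R v) - F y" for y
  have d: "(\<phi> has_derivative (\<lambda>w. frechet_derivative F (at (y + h *\<^sub>R v)) w - frechet_derivative F (at y) w)) (at y)" for y
  proof -
    have "(F has_derivative frechet_derivative F (at (y + h *\<^sub>R v))) (at (y + h *\<^sub>R v))"
      and 2: "(F has_derivative frechet_derivative F (at y)) (at y)"
      using dF by (simp_all add: frechet_derivative_works[symmetric])
    then have "((\<lambda>y. F (y + h *\<^sub>R v)) has_derivative frechet_derivative F (at (y + h *\<^sub>R v))) (at y)"
      by (rule_tac has_derivative_compose[rotated]) (auto intro!: derivative_eq_intros)
    then show ?thesis unfolding \<phi>_def using 2 by (rule has_derivative_diff)
  qed
  then have "\<phi> differentiable at y" for y by (auto simp: differentiable_def)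
  from mvt_along_line[OF assms(1) this, of x u] obtain s where s: "0 < s" "s < h"
    "\<phi> (x + h *\<^sub>R u) - \<phi> x = h * frechet_derivative \<phi> (at (x + s *\<^sub>R u)) u" by blast
  have 1: "frechet_derivative \<phi> (at (x + s *\<^sub>R u)) u
      = frechet_derivative F (at (x + s *\<^sub>R u + h *\<^sub>R v)) u - frechet_derivative F (at (x + s *\<^sub>R u)) u"
    using frechet_derivative_at[OF d] by metis
  from mvt_along_line[OF assms(1) dDF, of "x + s *\<^sub>R u" v] obtain r where r: "0 < r" "r < h"
    "frechet_derivative F (at (x + s *\<^sub>R u + h *\<^sub>R v)) u - frechet_derivative F (at (x + s *\<^sub>R u)) u
      = h * frechet_derivative (\<lambda>y. frechet_derivative F (at y) u) (at (x + s *\<^sub>R u + r *\<^sub>R v)) v"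
    by blast
  show ?thesis using that[OF s(1,2) r(1,2)] s(3) unfolding 1 r(3) \<phi>_def by simp
qed

text \<open>The mixed second difference over a parallelogram does not depend on the order of
  \<open>u\<close> and \<open>v\<close>. Both orders of differentiation express it by values near
  \<open>x\<close>, and continuity identifies the limits. Symmetry admits the Hessian of the
  Lagrangian to \<open>conjugate_residual\<close>.\<close>

lemma second_derivative_symmetric:
  fixes F :: "'a::euclidean_space \<Rightarrow> real"
  assumes "C2 F"
  shows "frechet_derivative (\<lambda>y. frechet_derivative F (at y) u) (at x) v
    = frechet_derivative (\<lambda>y. frechet_derivative F (at y) v) (at x) u"
proof -
  let ?A = "\<lambda>u v y. frechet_derivative (\<lambda>y. frechet_derivative F (at y) u) (at y) v"
  have "\<exists>s r s' r'. 0 < s \<and> s < h \<and> 0 < r \<and> r < h \<and> 0 < s' \<and> s' < h \<and> 0 < r' \<and> r' < h \<and>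
      ?A u v (x + s *\<^sub>R u + r *\<^sub>R v) = ?A v u (x + s' *\<^sub>R v + r' *\<^sub>R u)" if h: "0 < h" for h
  proof -
    obtain s r where 1: "0 < s" "s < h" "0 < r" "r < h"
      "F (x + h *\<^sub>R u + h *\<^sub>R v) - F (x + h *\<^sub>R u) - (F (x + h *\<^sub>R v) - F x)
        = h * (h * ?A u v (x + s *\<^sub>R u + r *\<^sub>R v))"
      by (rule second_difference[OF h assms])
    obtain s' r' where 2: "0 < s'" "s' < h" "0 < r'" "r' < h"
      "F (x + h *\<^sub>R v + h *\<^sub>R u) - F (x + h *\<^sub>R v) - (F (x + h *\<^sub>R u) - F x)
        = h * (h * ?A v u (x + s' *\<^sub>R v + r' *\<^sub>R u))"
      by (rule second_difference[OF h assms])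
    have "F (x + h *\<^sub>R v + h *\<^sub>R u) = F (x + h *\<^sub>R u + h *\<^sub>R v)" by (simp add: ac_simps)
    then have "h * (h * ?A u v (x + s *\<^sub>R u + r *\<^sub>R v)) = h * (h * ?A v u (x + s' *\<^sub>R v + r' *\<^sub>R u))"
      using 1(5) 2(5) by linarith
    then have "?A u v (x + s *\<^sub>R u + r *\<^sub>R v) = ?A v u (x + s' *\<^sub>R v + r' *\<^sub>R u)"
      using h by simp
    then show ?thesis using 1(1-4) 2(1-4) by blast
  qed
  then have "\<forall>n. \<exists>s r s' r'. 0 < s \<and> s < inverse (real (Suc n)) \<and> 0 < r \<and> r < inverse (real (Suc n))
      \<and> 0 < s' \<and> s' < inverse (real (Suc n)) \<and> 0 < r' \<and> r' < inverse (real (Suc n)) \<and>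
      ?A u v (x + s *\<^sub>R u + r *\<^sub>R v) = ?A v u (x + s' *\<^sub>R v + r' *\<^sub>R u)"
    by simp
  then obtain s r s' r' :: "nat \<Rightarrow> real" where
    b: "\<And>n. 0 < s n \<and> s n < inverse (real (Suc n))" "\<And>n. 0 < r n \<and> r n < inverse (real (Suc n))"
      "\<And>n. 0 < s' n \<and> s' n < inverse (real (Suc n))" "\<And>n. 0 < r' n \<and> r' n < inverse (real (Suc n))"
    and eq: "\<And>n. ?A u v (x + s n *\<^sub>R u + r n *\<^sub>R v) = ?A v u (x + s' n *\<^sub>R v + r' n *\<^sub>R u)"
    by metis
  have lim: "q \<longlonglongrightarrow> 0" if "\<And>n. 0 < q n \<and> q n < inverse (real (Suc n))" for q :: "nat \<Rightarrow> real"
    by (rule tendsto_sandwich[OF _ _ tendsto_const LIMSEQ_inverse_real_of_nat])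
      (use that less_imp_le in \<open>auto intro!: always_eventually\<close>)
  have cont: "isCont (?A u v) y" for u v y
  proof -
    have "continuous_on UNIV (?A u v)" using assms unfolding C2_def C1_def by blast
    then show ?thesis by (simp add: continuous_on_eq_continuous_at)
  qed
  have "(\<lambda>n. x + s n *\<^sub>R u + r n *\<^sub>R v) \<longlonglongrightarrow> x + 0 *\<^sub>R u + 0 *\<^sub>R v"
    by (intro tendsto_intros lim b)
  then have 1: "(\<lambda>n. ?A u v (x + s n *\<^sub>R u + r n *\<^sub>R v)) \<longlonglongrightarrow> ?A u v x"
    using isCont_tendsto_compose[OF cont] by simp
  have "(\<lambda>n. x + s' n *\<^sub>R v + r' n *\<^sub>R u) \<longlonglongrightarrow> x + 0 *\<^sub>R v + 0 *\<^sub>R u"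
    by (intro tendsto_intros lim b)
  then have "(\<lambda>n. ?A v u (x + s' n *\<^sub>R v + r' n *\<^sub>R u)) \<longlonglongrightarrow> ?A v u x"
    using isCont_tendsto_compose[OF cont] by simp
  then show ?thesis using 1 unfolding eq by (rule LIMSEQ_unique[rotated])
qed

lemma transpose_hessian:
  fixes F :: "real^'n \<Rightarrow> real"
  assumes "C2 F"
  shows "transpose (hessian F x) = hessian F x"
proof -
  have H: "(grad F has_derivative (\<lambda>h. hessian F x *v h)) (at x)"
    using C2_imp_grad_differentiable[OF assms] unfolding hessian_def by (simp add: jacobian_works[symmetric])
  have "u \<bullet> (hessian F x *v v) = frechet_derivative (\<lambda>y. frechet_derivative F (at y) u) (at x) v" for u v
  proof -
    have "(\<lambda>y. frechet_derivative F (at y) u) = (\<lambda>y. u \<bullet> grad F y)"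
      using frechet_derivative_grad C2_imp_differentiable[OF assms] by (metis inner_commute)
    moreover have "((\<lambda>y. u \<bullet> grad F y) has_derivative (\<lambda>h. u \<bullet> (hessian F x *v h))) (at x)"
      using H by (rule has_derivative_inner_right)
    ultimately show ?thesis using frechet_derivative_at by metis
  qed
  then have s: "u \<bullet> (hessian F x *v v) = v \<bullet> (hessian F x *v u)" for u v
    using second_derivative_symmetric[OF assms] by metis
  have "hessian F x $ i $ j = axis i 1 \<bullet> (hessian F x *v axis j 1)" for i j
    by (simp add: inner_axis' matrix_vector_mult_basis column_def)
  then have "hessian F x $ i $ j = hessian F x $ j $ i" for i j
    using s[of "axis i 1" "axis j 1"] by simp
  then show ?thesis by (simp add: vec_eq_iff transpose_def)
qed

section \<open>Smoothness and gradient of the Lagrangian\<close>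

lemma C1_add_inner:
  fixes a :: "'a::euclidean_space \<Rightarrow> real" and b :: "'a \<Rightarrow> 'b::euclidean_space"
  assumes "C1 a" "C1 b"
  shows "C1 (\<lambda>z. a z + l \<bullet> b z)"
    and "frechet_derivative (\<lambda>z. a z + l \<bullet> b z) (at x) u
      = frechet_derivative a (at x) u + l \<bullet> frechet_derivative b (at x) u"
proof -
  have d: "((\<lambda>z. a z + l \<bullet> b z) has_derivative
      (\<lambda>u. frechet_derivative a (at y) u + l \<bullet> frechet_derivative b (at y) u)) (at y)" for y
    using assms unfolding C1_def
    by (intro has_derivative_add has_derivative_inner_right) (auto simp: frechet_derivative_works[symmetric])
  then have e: "frechet_derivative (\<lambda>z. a z + l \<bullet> b z) (at y) u
      = frechet_derivative a (at y) u + l \<bullet> frechet_derivative b (at y) u" for y u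
    using frechet_derivative_at[OF d] by metis
  show "C1 (\<lambda>z. a z + l \<bullet> b z)"
    unfolding C1_def e using d assms by (auto simp: C1_def differentiable_def intro!: continuous_intros)
  show "frechet_derivative (\<lambda>z. a z + l \<bullet> b z) (at x) u
      = frechet_derivative a (at x) u + l \<bullet> frechet_derivative b (at x) u" by (rule e)
qed

lemma C2_lagrangian:
  assumes "C2 f" "C2 c"
  shows "C2 (\<lambda>z. lagrangian f c z l)"
  using assms unfolding C2_def lagrangian_def by (simp add: C1_add_inner)

lemma grad_lagrangian:
  fixes f :: "real^'d \<Rightarrow> real" and c :: "real^'d \<Rightarrow> real^'c"
  assumes "C2 f" "C2 c"
  shows "grad (\<lambda>z. lagrangian f c z l) x = grad f x + transpose (Jac c x) *v l"
proof -
  have "h \<bullet> grad (\<lambda>z. lagrangian f c z l) x = h \<bullet> (grad f x + transpose (Jac c x) *v l)" for h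
  proof -
    have J: "frechet_derivative c (at x) = (\<lambda>h. Jac c x *v h)"
      using frechet_derivative_at[of c "\<lambda>h. Jac c x *v h"] C2_imp_differentiable[OF assms(2)]
      by (simp add: jacobian_works)
    have "grad (\<lambda>z. lagrangian f c z l) x \<bullet> h = frechet_derivative (\<lambda>z. lagrangian f c z l) (at x) h"
      by (rule frechet_derivative_grad[symmetric, OF C2_imp_differentiable[OF C2_lagrangian[OF assms]]])
    also have "\<dots> = frechet_derivative f (at x) h + l \<bullet> frechet_derivative c (at x) h"
      unfolding lagrangian_def using assms by (intro C1_add_inner) (simp_all add: C2_def)
    also have "\<dots> = grad f x \<bullet> h + (transpose (Jac c x) *v l) \<bullet> h"
      using frechet_derivative_grad[OF C2_imp_differentiable[OF assms(1)]]
      by (simp add: J dot_lmul_matrix)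
    finally show ?thesis by (simp only: inner_add_left[symmetric] inner_commute[of h])
  qed
  then show ?thesis by (metis vector_eq_ldot)
qed

text \<open>Difference quotients inherit the Lipschitz constant; openness supplies points of
  \<open>X\<close> in every direction from \<open>x\<close>.\<close>

lemma lipschitz_imp_derivative_bound:
  assumes "open X" "x \<in> X" and h: "(h has_derivative h') (at x)"
    and lip: "\<And>y. y \<in> X \<Longrightarrow> norm (h y - h x) \<le> K * norm (y - x)"
  shows "norm (h' v) \<le> K * norm v"
proof (cases "v = 0")
  case True
  then show ?thesis using linear_0[OF has_derivative_linear[OF h]] by simp
next
  case v: False
  have "norm (h' v) \<le> K * norm v + e" if e: "0 < e" for e
  proof -
    define e' where "e' = e / norm v"
    have "0 < e'" using v e by (simp add: e'_def)
    then obtain d where d: "0 < d" "\<And>y. norm (y - x) < d \<Longrightarrow> norm (h y - h x - h' (y - x)) \<le> e' * norm (y - x)"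
      using h unfolding has_derivative_at_alt by blast
    obtain d2 where d2: "0 < d2" "ball x d2 \<subseteq> X" using assms(1,2) openE by blast
    define t where "t = min d d2 / 2 / norm v"
    define y where "y = x + t *\<^sub>R v"
    have t: "0 < t" using d d2 v by (simp add: t_def)
    have n: "norm (y - x) = t * norm v" using t by (simp add: y_def)
    also have "\<dots> = min d d2 / 2" using v by (simp add: t_def)
    also have "\<dots> < min d d2" using d(1) d2(1) by (simp add: min_def)
    finally have nd: "norm (y - x) < d" "norm (y - x) < d2" by auto
    then have "y \<in> X" using d2 by (auto simp: dist_norm norm_minus_commute)
    have "h' (y - x) = t *\<^sub>R h' v"
      by (simp add: y_def linear_scale[OF has_derivative_linear[OF h]])
    then have "t * norm (h' v) = norm (h' (y - x))" using t by simp
    also have "\<dots> \<le> norm (h y - h x) + norm (h y - h x - h' (y - x))"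
      using norm_triangle_ineq4[of "h y - h x" "h y - h x - h' (y - x)"] by simp
    also have "\<dots> \<le> K * norm (y - x) + e' * norm (y - x)"
      using lip[OF \<open>y \<in> X\<close>] d(2)[OF nd(1)] by (rule add_mono)
    also have "\<dots> = t * (K * norm v + e)" using v by (simp add: n e'_def algebra_simps)
    finally show ?thesis using t by simp
  qed
  then show ?thesis by (rule field_le_epsilon)
qed

text \<open>The comparison function \<open>L / 2 * s\<^sup>2 * (norm p)\<^sup>2\<close> has the
  Lipschitz bound as its derivative. The values are vectors to include the constraints, hence a mean
  value inequality.\<close>

lemma derivative_lipschitz_quadratic_bound:
  fixes h :: "'a::real_normed_vector \<Rightarrow> 'b::real_normed_vector"
  assumes h: "\<And>y. (h has_derivative h' y) (at y)" and a: "0 \<le> a" "a \<le> 1"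
    and lip: "\<And>s. 0 \<le> s \<Longrightarrow> s \<le> 1 \<Longrightarrow> norm (h' (x + s *\<^sub>R p) p - h' x p) \<le> L * s * (norm p)\<^sup>2"
  shows "norm (h (x + a *\<^sub>R p) - h x - a *\<^sub>R h' x p) \<le> L / 2 * a\<^sup>2 * (norm p)\<^sup>2"
proof (cases "a = 0")
  case False
  then have apos: "0 < a" using a by simp
  have d: "((\<lambda>s. h (x + s *\<^sub>R p) - s *\<^sub>R h' x p) has_vector_derivative (h' (x + s *\<^sub>R p) p - h' x p)) (at s)" for s
  proof -
    have "((\<lambda>s. h (x + s *\<^sub>R p)) has_derivative (\<lambda>r. h' (x + s *\<^sub>R p) (r *\<^sub>R p))) (at s)"
      by (rule has_derivative_compose[OF _ h]) (auto intro!: derivative_eq_intros)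
    then have "((\<lambda>s. h (x + s *\<^sub>R p)) has_vector_derivative h' (x + s *\<^sub>R p) p) (at s)"
      unfolding has_vector_derivative_def
      by (simp add: linear_scale[OF has_derivative_linear[OF h]])
    moreover have "((\<lambda>s. s *\<^sub>R h' x p) has_vector_derivative h' x p) (at s)"
      by (auto intro!: derivative_eq_intros)
    ultimately show ?thesis by (rule has_vector_derivative_diff)
  qed
  have dphi: "((\<lambda>s. L / 2 * s\<^sup>2 * (norm p)\<^sup>2) has_vector_derivative (L * s * (norm p)\<^sup>2)) (at s)" for s
    by (auto intro!: derivative_eq_intros simp: has_real_derivative_iff_has_vector_derivative[symmetric])
  have "norm ((h (x + a *\<^sub>R p) - a *\<^sub>R h' x p) - (h (x + 0 *\<^sub>R p) - 0 *\<^sub>R h' x p))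
      \<le> L / 2 * a\<^sup>2 * (norm p)\<^sup>2 - L / 2 * 0\<^sup>2 * (norm p)\<^sup>2"
  proof (rule differentiable_bound_general[OF apos])
    show "continuous_on {0..a} (\<lambda>s. h (x + s *\<^sub>R p) - s *\<^sub>R h' x p)"
      using d by (meson continuous_at_imp_continuous_on has_vector_derivative_continuous)
    show "continuous_on {0..a} (\<lambda>s. L / 2 * s\<^sup>2 * (norm p)\<^sup>2)" by (intro continuous_intros)
    show "norm (h' (x + s *\<^sub>R p) p - h' x p) \<le> L * s * (norm p)\<^sup>2" if "0 < s" "s < a" for s
      using that a by (intro lip) auto
  qed (use d dphi in auto)
  then show ?thesis by (simp add: algebra_simps)
qed simp

section \<open>Step lengths\<close>

lemma orth_proj_eq:
  assumes S: "subspace S" "y \<in> S" "\<And>z. z \<in> S \<Longrightarrow> orthogonal (x - y) z"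
  shows "orth_proj S x = y"
  unfolding orth_proj_def
proof (rule the_equality)
  show "y \<in> S \<and> (\<forall>z\<in>S. orthogonal (x - y) z)" using S by blast
next
  fix y' assume y': "y' \<in> S \<and> (\<forall>z\<in>S. orthogonal (x - y') z)"
  have "y' - y \<in> S" using y' S by (intro subspace_diff) auto
  then have "(x - y) \<bullet> (y' - y) = 0" "(x - y') \<bullet> (y' - y) = 0"
    using S(3) y' unfolding orthogonal_def by blast+
  then have "(y' - y) \<bullet> (y' - y) = 0" by (simp add: inner_diff_left)
  then show "y' = y" by simp
qed

text \<open>The null space is orthogonal to the range of \<open>transpose J\<close>, hence to that
  of \<open>W\<close>. Subtracting \<open>W ** transpose W\<close> does not change inner products
  with the projection, so Cauchy-Schwarz applies.\<close>

lemma norm_orth_proj_null_space_le: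
  fixes W :: "real^'k^'n" and J :: "real^'n^'m"
  assumes "range (\<lambda>u. W *v u) \<subseteq> range (\<lambda>u. transpose J *v u)"
  shows "norm (orth_proj (null_space J) g) \<le> norm ((mat 1 - W ** transpose W) *v g)"
proof -
  have N: "subspace (null_space J)"
    by (auto simp: null_space_def subspace_def matrix_vector_right_distrib matrix_vector_mult_scaleR)
  obtain y z where yz: "y \<in> span (null_space J)" "\<And>w. w \<in> span (null_space J) \<Longrightarrow> orthogonal z w" "g = y + z"
    using orthogonal_subspace_decomp_exists by metis
  have y: "y \<in> null_space J" "\<And>w. w \<in> null_space J \<Longrightarrow> orthogonal (g - y) w"
    using yz unfolding span_eq_iff[THEN iffD2, OF N] by auto
  have p: "orth_proj (null_space J) g = y" by (rule orth_proj_eq[OF N y])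
  have W0: "y \<bullet> (W *v u) = 0" for u
  proof -
    obtain w where w: "W *v u = transpose J *v w" using assms by blast
    have "(transpose J *v w) \<bullet> y = w \<bullet> (J *v y)" by (rule inner_transpose_mult)
    then show ?thesis using y(1) by (simp only: w null_space_def mem_Collect_eq inner_zero_right inner_zero_left inner_commute)
  qed
  have "(norm y)\<^sup>2 = y \<bullet> g"
    using y(2)[OF y(1)] by (simp add: orthogonal_def inner_diff_left power2_norm_eq_inner inner_commute[of y g])
  also have "\<dots> = y \<bullet> ((mat 1 - W ** transpose W) *v g)"
    using W0[of "transpose W *v g"]
    by (simp add: matrix_vector_mult_diff_rdistrib inner_diff_right matrix_vector_mul_assoc
        del: transpose_matrix_vector)
  also have "\<dots> \<le> norm y * norm ((mat 1 - W ** transpose W) *v g)" by (rule norm_cauchy_schwarz)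
  finally show ?thesis unfolding p by (cases "y = 0") (simp_all add: power2_eq_square)
qed

text \<open>Either the power 1 is accepted, or the preceding power was rejected and exceeds
  \<open>B\<close>. The one factor lost in between is the \<open>theta P\<close> in
  \<open>alpha_tilde\<close>.\<close>

lemma least_power_ge:
  fixes \<theta> B :: real
  assumes t: "0 < \<theta>" "\<theta> < 1" and B: "0 < B"
    and Q: "\<And>a. 0 < a \<Longrightarrow> a \<le> 1 \<Longrightarrow> a \<le> B \<Longrightarrow> Q a"
  defines "j \<equiv> LEAST j. Q (\<theta> ^ j)"
  shows "Q (\<theta> ^ j)" "min 1 (\<theta> * B) \<le> \<theta> ^ j"
proof -
  have le1: "\<theta> ^ i \<le> 1" for i using t by (simp add: power_le_one)
  obtain n where "\<theta> ^ n < B" using real_arch_pow_inv[OF B t(2)] by blast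
  then have "Q (\<theta> ^ n)" using t le1[of n] by (intro Q) auto
  then show "Q (\<theta> ^ j)" unfolding j_def by (rule LeastI)
  show "min 1 (\<theta> * B) \<le> \<theta> ^ j"
  proof (cases j)
    case (Suc i)
    have "\<not> Q (\<theta> ^ i)" using not_less_Least[of i "\<lambda>j. Q (\<theta> ^ j)"] Suc unfolding j_def by simp
    then have "B \<le> \<theta> ^ i" using Q[of "\<theta> ^ i"] t le1[of i] by fastforce
    then have "\<theta> * B \<le> \<theta> * \<theta> ^ i" using t by (intro mult_left_mono) auto
    then show ?thesis using Suc by simp
  qed simp
qed

text \<open>The linearized constraints at a fraction \<open>a\<close> of the step are a convex
  combination of those at its ends. Convexity of the norm turns this into the first-order term
  \<open>a * Dbar\<close>.\<close>

lemma merit_upper_bound: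
  fixes f :: "real^'d \<Rightarrow> real" and c :: "real^'d \<Rightarrow> real^'c"
  assumes df: "\<And>y. f differentiable at y" and dc: "\<And>y. c differentiable at y"
    and lf: "\<And>s. 0 \<le> s \<Longrightarrow> s \<le> 1 \<Longrightarrow> norm (grad f (x + s *\<^sub>R p) - grad f x) \<le> Lf * (s * norm p)"
    and lc: "\<And>s u. 0 \<le> s \<Longrightarrow> s \<le> 1 \<Longrightarrow>
      norm (Jac c (x + s *\<^sub>R p) *v u - Jac c x *v u) \<le> Lc * (s * norm p) * norm u"
    and a: "0 \<le> a" "a \<le> 1" and pn: "0 \<le> pn"
  shows "merit f c pn (x + a *\<^sub>R p) \<le> merit f c pn x + a * Dbar f c pn x p
    + (pn * Lc + Lf) / 2 * a\<^sup>2 * (norm p)\<^sup>2"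
proof -
  have "norm (f (x + a *\<^sub>R p) - f x - a *\<^sub>R (grad f x \<bullet> p)) \<le> Lf / 2 * a\<^sup>2 * (norm p)\<^sup>2"
  proof (rule derivative_lipschitz_quadratic_bound[where h' = "\<lambda>y h. grad f y \<bullet> h", OF has_derivative_grad[OF df] a])
    fix s :: real assume s: "0 \<le> s" "s \<le> 1"
    have "norm (grad f (x + s *\<^sub>R p) \<bullet> p - grad f x \<bullet> p) = \<bar>(grad f (x + s *\<^sub>R p) - grad f x) \<bullet> p\<bar>"
      by (simp add: inner_diff_left)
    also have "\<dots> \<le> norm (grad f (x + s *\<^sub>R p) - grad f x) * norm p" by (rule Cauchy_Schwarz_ineq2)
    also have "\<dots> \<le> Lf * (s * norm p) * norm p" using lf[OF s] by (intro mult_right_mono) auto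
    finally show "norm (grad f (x + s *\<^sub>R p) \<bullet> p - grad f x \<bullet> p) \<le> Lf * s * (norm p)\<^sup>2"
      by (simp add: power2_eq_square mult.assoc)
  qed
  then have 1: "f (x + a *\<^sub>R p) \<le> f x + a * (grad f x \<bullet> p) + Lf / 2 * a\<^sup>2 * (norm p)\<^sup>2"
    unfolding real_norm_def real_scaleR_def abs_le_iff by linarith
  let ?J = "Jac c x"
  have dJ: "(c has_derivative (\<lambda>h. Jac c y *v h)) (at y)" for y
    using dc by (simp add: jacobian_works[symmetric])
  have 2: "norm (c (x + a *\<^sub>R p) - c x - a *\<^sub>R (?J *v p)) \<le> Lc / 2 * a\<^sup>2 * (norm p)\<^sup>2"
  proof (rule derivative_lipschitz_quadratic_bound[where h' = "\<lambda>y h. Jac c y *v h", OF dJ a])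
    fix s :: real assume s: "0 \<le> s" "s \<le> 1"
    show "norm (Jac c (x + s *\<^sub>R p) *v p - Jac c x *v p) \<le> Lc * s * (norm p)\<^sup>2"
      using lc[OF s, of p] by (simp add: power2_eq_square mult.assoc)
  qed
  have "c (x + a *\<^sub>R p) = (c (x + a *\<^sub>R p) - c x - a *\<^sub>R (?J *v p)) + ((1 - a) *\<^sub>R c x + a *\<^sub>R (c x + ?J *v p))"
    by (simp add: algebra_simps)
  then have "norm (c (x + a *\<^sub>R p)) \<le> norm (c (x + a *\<^sub>R p) - c x - a *\<^sub>R (?J *v p))
      + norm ((1 - a) *\<^sub>R c x + a *\<^sub>R (c x + ?J *v p))"
    by (metis norm_triangle_ineq)
  also have "norm ((1 - a) *\<^sub>R c x + a *\<^sub>R (c x + ?J *v p)) \<le> (1 - a) * norm (c x) + a * norm (c x + ?J *v p)"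
    using norm_triangle_ineq[of "(1 - a) *\<^sub>R c x" "a *\<^sub>R (c x + ?J *v p)"] a by simp
  finally have "norm (c (x + a *\<^sub>R p)) \<le> norm (c x) + a * (norm (c x + ?J *v p) - norm (c x)) + Lc / 2 * a\<^sup>2 * (norm p)\<^sup>2"
    using 2 by (simp add: algebra_simps)
  then have "pn * norm (c (x + a *\<^sub>R p)) \<le> pn * (norm (c x) + a * (norm (c x + ?J *v p) - norm (c x)) + Lc / 2 * a\<^sup>2 * (norm p)\<^sup>2)"
    using pn by (rule mult_left_mono)
  also have "\<dots> = pn * norm (c x) + a * (pn * (norm (c x + ?J *v p) - norm (c x)))
      + pn * Lc / 2 * a\<^sup>2 * (norm p)\<^sup>2"
    by (simp add: distrib_left mult_ac)
  finally have 3: "pn * norm (c (x + a *\<^sub>R p)) \<le> \<dots>" .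
  have "(pn * Lc + Lf) / 2 * a\<^sup>2 * (norm p)\<^sup>2
      = pn * Lc / 2 * a\<^sup>2 * (norm p)\<^sup>2 + Lf / 2 * a\<^sup>2 * (norm p)\<^sup>2"
    by (simp add: add_divide_distrib distrib_right)
  then show ?thesis using 1 3 unfolding merit_def Dbar_def distrib_left[of a] by linarith
qed

lemma norm_add_squared_le: "(norm (v + w))\<^sup>2 \<le> 2 * ((norm v)\<^sup>2 + (norm (w :: 'a::real_inner))\<^sup>2)"
proof -
  have "0 \<le> (norm (v - w))\<^sup>2" by simp
  then show ?thesis
    by (simp add: power2_norm_eq_inner inner_add_left inner_add_right inner_diff_left inner_diff_right)
qed

text \<open>\<open>E\<close> bounds \<open>- Dbar\<close> from below: its first term is what
  \<open>G\<close> leaves of the normal decrease, its second what \<open>W1\<close> leaves of the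
  tangential one.\<close>

lemma backtracking_decrease:
  fixes f :: "real^'d \<Rightarrow> real" and c :: "real^'d \<Rightarrow> real^'c"
  assumes P: "valid_params P"
    and df: "\<And>y. f differentiable at y" and dc: "\<And>y. c differentiable at y"
    and lf: "\<And>s. 0 \<le> s \<Longrightarrow> s \<le> 1 \<Longrightarrow> norm (grad f (x + s *\<^sub>R (v + w)) - grad f x) \<le> Lf * (s * norm (v + w))"
    and lc: "\<And>s u. 0 \<le> s \<Longrightarrow> s \<le> 1 \<Longrightarrow>
      norm (Jac c (x + s *\<^sub>R (v + w)) *v u - Jac c x *v u) \<le> Lc * (s * norm (v + w)) * norm u"
    and L: "0 \<le> Lf" "0 \<le> Lc" and pn: "pen_init P \<le> pn" "pn \<le> pt"
    and nu: "norm v \<le> nu * norm (c x)" and kc: "norm (c x) \<le> kc"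
    and N: "norm (c x + Jac c x *v v) \<le> tau_norm P * norm (c x)"
    and G: "grad f x \<bullet> v \<le> pn * ((1 - rho P) * (1 - tau_norm P) * norm (c x))"
    and W1: "norm (Jac c x *v w) \<le> - (tau_null P / pn) * (grad f x \<bullet> w)"
    and W2: "grad f x \<bullet> w \<le> - gt * (norm w)\<^sup>2" and gt: "0 < gt"
  defines "E \<equiv> rho P * (1 - tau_norm P) * pn * norm (c x) + (1 - tau_null P) * gt * (norm w)\<^sup>2"
    and "al \<equiv> backtrack f c (theta P) (eta P) pn x (v + w)"
  shows "merit f c pn (x + al *\<^sub>R (v + w))
    \<le> merit f c pn x - alpha_tilde P (1 - tau_norm P) gt nu pt Lf Lc kc * eta P * E"
proof -
  have par: "0 < tau_norm P" "tau_norm P < 1" "0 < tau_null P" "tau_null P < 1" "0 < pen_init P"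
    "0 < rho P" "rho P < 1" "0 < eta P" "eta P < 1" "0 < theta P" "theta P < 1"
    using P by (auto simp: valid_params_def)
  have pn0: "0 < pn" using par pn by linarith
  let ?p = "v + w" and ?J = "Jac c x" and ?g = "grad f x"
  let ?D = "Dbar f c pn x ?p"
  have E0: "0 \<le> E" unfolding E_def using par pn0 gt by (intro add_nonneg_nonneg mult_nonneg_nonneg) auto
  have DE: "?D \<le> - E"
  proof -
    have "norm (c x + ?J *v ?p) \<le> norm (c x + ?J *v v) + norm (?J *v w)"
      by (metis norm_triangle_ineq add.assoc matrix_vector_right_distrib)
    then have "pn * norm (c x + ?J *v ?p) \<le> pn * (tau_norm P * norm (c x) + - (tau_null P / pn) * (?g \<bullet> w))"
      using N W1 pn0 by (intro mult_left_mono) auto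
    also have "\<dots> = pn * (tau_norm P * norm (c x)) - tau_null P * (?g \<bullet> w)"
      using pn0 by (simp add: field_simps)
    finally have "?D \<le> ?g \<bullet> v + (1 - tau_null P) * (?g \<bullet> w) - pn * ((1 - tau_norm P) * norm (c x))"
      unfolding Dbar_def by (simp add: inner_add_right algebra_simps)
    moreover have "(1 - tau_null P) * (?g \<bullet> w) \<le> (1 - tau_null P) * (- gt * (norm w)\<^sup>2)"
      using W2 par by (intro mult_left_mono) auto
    ultimately show ?thesis using G unfolding E_def by (simp add: algebra_simps)
  qed
  let ?Q = "\<lambda>a. merit f c pn (x + a *\<^sub>R ?p) \<le> merit f c pn x + a * eta P * ?D"
  \<comment> \<open>With \<open>pt\<close> in place of the current penalty, the lower bound on step
    lengths is uniform over all iterations.\<close>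
  define q where "q = pt * Lc + Lf"
  have q0: "0 \<le> q" unfolding q_def using L pn pn0 by simp
  have ub: "merit f c pn (x + a *\<^sub>R ?p) \<le> merit f c pn x + a * ?D + q / 2 * a\<^sup>2 * (norm ?p)\<^sup>2"
    if a: "0 \<le> a" "a \<le> 1" for a
  proof -
    have "(pn * Lc + Lf) / 2 * a\<^sup>2 * (norm ?p)\<^sup>2 \<le> q / 2 * a\<^sup>2 * (norm ?p)\<^sup>2"
      unfolding q_def using L pn by (intro mult_right_mono divide_right_mono add_right_mono) auto
    then show ?thesis using merit_upper_bound[where p = ?p and Lf = Lf and Lc = Lc and pn = pn, OF df dc lf lc a] pn0
      by linarith
  qed
  have al: "?Q al \<and> alpha_tilde P (1 - tau_norm P) gt nu pt Lf Lc kc \<le> al"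
  proof (cases "q = 0")
    case True
    have Q: "?Q a" if a: "0 < a" "a \<le> 1" for a
    proof -
      have "?D * 1 \<le> ?D * eta P" using DE E0 par by (intro mult_left_mono_neg) auto
      then have "a * ?D \<le> a * (?D * eta P)" using a by (intro mult_left_mono) auto
      moreover have "merit f c pn (x + a *\<^sub>R ?p) \<le> merit f c pn x + a * ?D"
        using ub[of a] a True by simp
      ultimately show ?thesis by (simp add: mult_ac)
    qed
    \<comment> \<open>For this choice of \<open>B\<close> the bound
      \<open>min 1 (theta P * B)\<close> is 1, the value of \<open>alpha_tilde\<close> in this
      case.\<close>
    have "0 < 1 / theta P" using par by simp
    from least_power_ge[OF par(10,11) this, of ?Q] Q
    have "?Q (theta P ^ (LEAST j. ?Q (theta P ^ j)))" "1 \<le> theta P ^ (LEAST j. ?Q (theta P ^ j))"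
      using par by auto
    then show ?thesis unfolding al_def backtrack_def using True by (simp add: alpha_tilde_def q_def)
  next
    case False
    then have qpos: "0 < q" using q0 by simp
    define m where "m = min ((1 - tau_null P) * gt) (pen_init P * (1 - tau_norm P) * rho P)"
    define M where "M = max 1 (kc * nu\<^sup>2)"
    \<comment> \<open>Up to \<open>B\<close> the second-order term stays below the fraction
      \<open>1 - eta P\<close> of the predicted decrease. \<open>m\<close> bounds the decrease from
      below and \<open>M\<close> the squared step from above, both against the quantity
      \<open>y\<close>, which is linear in the constraint norm but quadratic in
      \<open>w\<close>.\<close>
    define B where "B = (1 - eta P) * m / (q * M)"
    have m0: "0 < m" unfolding m_def using par gt by simp
    have M0: "1 \<le> M" by (simp add: M_def)
    have B0: "0 < B" unfolding B_def using m0 M0 qpos par by (intro divide_pos_pos mult_pos_pos) auto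
    define y where "y = norm (c x) + (norm w)\<^sup>2"
    have mE: "m * y \<le> E"
    proof -
      have "m * norm (c x) \<le> rho P * (1 - tau_norm P) * pn * norm (c x)"
      proof (rule mult_right_mono)
        have "m \<le> pen_init P * ((1 - tau_norm P) * rho P)" by (simp add: m_def mult.assoc)
        also have "\<dots> \<le> pn * ((1 - tau_norm P) * rho P)" using pn par by (intro mult_right_mono) auto
        finally show "m \<le> rho P * (1 - tau_norm P) * pn" by (simp add: mult_ac)
      qed simp
      moreover have "m * (norm w)\<^sup>2 \<le> (1 - tau_null P) * gt * (norm w)\<^sup>2"
        by (intro mult_right_mono) (auto simp: m_def)
      ultimately show ?thesis unfolding E_def y_def by (simp add: distrib_left)
    qed
    \<comment> \<open>The square of the constraint norm is made linear by the bound
      \<open>kc\<close>, which produces \<open>max 1 (kc * nu\<^sup>2)\<close>. The factor 2 cancels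
      against \<open>q / 2\<close>.\<close>
    have pM: "(norm ?p)\<^sup>2 \<le> 2 * (M * y)"
    proof -
      have "(norm v)\<^sup>2 \<le> (nu * norm (c x))\<^sup>2" using nu by (intro power_mono) auto
      also have "\<dots> = nu\<^sup>2 * norm (c x) * norm (c x)" by (simp add: power2_eq_square)
      also have "\<dots> \<le> nu\<^sup>2 * kc * norm (c x)" using kc by (intro mult_right_mono mult_left_mono) auto
      also have "\<dots> \<le> M * norm (c x)" by (intro mult_right_mono) (auto simp: M_def mult.commute)
      finally have "(norm v)\<^sup>2 + (norm w)\<^sup>2 \<le> M * y"
        using mult_right_mono[OF M0, of "(norm w)\<^sup>2"] by (simp add: y_def distrib_left)
      then show ?thesis by (intro order_trans[OF norm_add_squared_le]) simp
    qed
    have Q: "?Q a" if a: "0 < a" "a \<le> 1" "a \<le> B" for a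
    proof -
      have y0: "0 \<le> y" by (simp add: y_def)
      have "q / 2 * a\<^sup>2 * (norm ?p)\<^sup>2 \<le> q / 2 * a\<^sup>2 * (2 * (M * y))"
        using pM qpos by (intro mult_left_mono) auto
      also have "\<dots> = a * (a * (q * (M * y)))" by (simp add: power2_eq_square)
      also have "\<dots> \<le> a * (B * (q * (M * y)))"
        using a qpos M0 y0 by (intro mult_left_mono mult_right_mono mult_nonneg_nonneg) auto
      also have "\<dots> = a * ((1 - eta P) * (m * y))"
        using qpos M0 by (simp add: B_def)
      also have "\<dots> \<le> a * ((1 - eta P) * E)" using mE a par by (intro mult_left_mono) auto
      also have "\<dots> \<le> a * ((1 - eta P) * (- ?D))" using DE a par by (intro mult_left_mono) auto
      finally have "q / 2 * a\<^sup>2 * (norm ?p)\<^sup>2 \<le> a * ((1 - eta P) * (- ?D))" .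
      moreover have "a * ?D + a * ((1 - eta P) * (- ?D)) = a * eta P * ?D"
        by (simp add: algebra_simps)
      ultimately show ?thesis using ub[of a] a by linarith
    qed
    have at: "alpha_tilde P (1 - tau_norm P) gt nu pt Lf Lc kc = min 1 (theta P * B)"
      using False by (simp add: alpha_tilde_def q_def B_def m_def M_def mult.assoc)
    show ?thesis
      unfolding al_def backtrack_def at
      using least_power_ge[OF par(10,11) B0, of ?Q, OF Q] by blast
  qed
  have "merit f c pn (x + al *\<^sub>R ?p) \<le> merit f c pn x + (al * eta P) * ?D"
    using al by simp
  also have "(al * eta P) * ?D \<le> (alpha_tilde P (1 - tau_norm P) gt nu pt Lf Lc kc * eta P) * (- E)"
  proof -
    have at0: "0 \<le> alpha_tilde P (1 - tau_norm P) gt nu pt Lf Lc kc"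
      using par gt q0 unfolding alpha_tilde_def q_def by (auto intro!: divide_nonneg_nonneg mult_nonneg_nonneg)
    then have "(al * eta P) * ?D \<le> (al * eta P) * (- E)"
      using DE al par by (intro mult_left_mono) auto
    also have "\<dots> \<le> (alpha_tilde P (1 - tau_norm P) gt nu pt Lf Lc kc * eta P) * (- E)"
      using al par E0 by (intro mult_right_mono_neg mult_right_mono) auto
    finally show ?thesis .
  qed
  finally show ?thesis by simp
qed

section \<open>Complexity of the algorithm\<close>

lemma norm_mult_le_opnorm: "norm (A *v u) \<le> opnorm A * norm (u :: real^'n)"
  by (rule onorm[OF matrix_vector_mul_bounded_linear])

lemma norm_transpose_mult_le_opnorm:
  fixes A :: "real^'n^'m"
  shows "norm (transpose A *v u) \<le> opnorm A * norm u"
proof (cases "transpose A *v u = 0")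
  case True
  then show ?thesis
    using onorm_pos_le[OF matrix_vector_mul_bounded_linear, of A] by (simp only: norm_zero) simp
next
  case False
  have "(norm (transpose A *v u))\<^sup>2 = u \<bullet> (A *v (transpose A *v u))"
    by (simp only: power2_norm_eq_inner inner_transpose_mult)
  also have "\<dots> \<le> norm u * (opnorm A * norm (transpose A *v u))"
    by (intro order_trans[OF norm_cauchy_schwarz] mult_left_mono norm_mult_le_opnorm norm_ge_zero)
  finally show ?thesis using False by (simp add: power2_eq_square mult_ac del: transpose_matrix_vector)
qed

text \<open>The Hessian bound stays outside the assumptions, because its existence for open
  \<open>X\<close> is derived in this locale.\<close>

locale pdnmr =
  fixes f :: "real^'d \<Rightarrow> real" and c :: "real^'d \<Rightarrow> real^'c" and P :: pdnmr_params
    and x0 :: "real^'d" and l0 :: "real^'c" and T :: "('d, 'c) pdnmr_trace" and X :: "(real^'d) set"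
    and \<sigma>J \<kappa>J Lf Lc flow \<kappa>g \<kappa>c :: real
  assumes C2f: "C2 f" and C2c: "C2 c" and params: "valid_params P"
    and run: "pdnmr_run f c P x0 l0 T" and visited: "visited f c P T \<subseteq> X"
    and sJ: "0 < \<sigma>J" and sJ_le: "\<sigma>J \<le> \<kappa>J"
    and sv: "\<forall>x\<in>X. \<sigma>J \<le> singular_value CARD('c) (Jac c x) \<and>
               singular_value CARD('c) (Jac c x) \<le> singular_value 1 (Jac c x) \<and>
               singular_value 1 (Jac c x) \<le> \<kappa>J"
    and lip_grad: "Lf-lipschitz_on X (grad f)" and Lc: "0 \<le> Lc"
    and lip_Jac: "\<forall>x\<in>X. \<forall>y\<in>X. opnorm (Jac c x - Jac c y) \<le> Lc * dist x y"
    and flow: "\<forall>x\<in>X. flow \<le> f x" and kg: "\<forall>x\<in>X. norm (grad f x) \<le> \<kappa>g"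
    and kc: "\<forall>x\<in>X. norm (c x) \<le> \<kappa>c"
begin

lemma par: "0 < eps_c P" "0 < eps_p P" "0 < tau_norm P" "tau_norm P < 1" "0 < tau_null P" "tau_null P < 1"
    "0 < pen_init P" "0 < rho P" "rho P < 1" "0 < eta P" "eta P < 1" "0 < theta P" "theta P < 1"
    "0 < sigma P" "0 < tau_tan P"
  using params by (auto simp: valid_params_def)

abbreviation "x k \<equiv> iter T k"
abbreviation "J k \<equiv> Jac c (x k)"
abbreviation "g k \<equiv> grad f (x k)"
abbreviation "v k \<equiv> normal_step T k"
abbreviation "w k \<equiv> tan_step T k"
abbreviation "reach k \<equiv> reached f c P T k"
abbreviation "stop k \<equiv> stops f c P T k"

lemma reached_mono: "reach k \<Longrightarrow> j \<le> k \<Longrightarrow> reach j"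
  by (auto simp: reached_def)

lemma normal: "reach k \<Longrightarrow> normal_phase f c P T k"
  and tangential: "reach k \<Longrightarrow> \<not> stop k \<Longrightarrow> tangential_phase f c P T k"
  and update: "reach k \<Longrightarrow> \<not> stop k \<Longrightarrow> update_phase f c P T k"
  using run by (auto simp: pdnmr_run_def)

lemma iter_in_X: "reach k \<Longrightarrow> x k \<in> X"
  using visited unfolding visited_def by blast

lemma segment_in_X: "reach k \<Longrightarrow> \<not> stop k \<Longrightarrow> 0 \<le> a \<Longrightarrow> a \<le> 1 \<Longrightarrow> x k + a *\<^sub>R step T k \<in> X"
  using visited unfolding visited_def by blast

lemma x0_in_X: "x0 \<in> X"
  using iter_in_X[of 0] run by (simp add: reached_def pdnmr_run_def)

lemma kg_nonneg: "0 \<le> \<kappa>g"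
  using kg x0_in_X norm_ge_zero order_trans by blast

lemma Lf_nonneg: "0 \<le> Lf"
  using lip_grad by (rule lipschitz_on_nonneg)

lemma Jac_lower: "y \<in> X \<Longrightarrow> \<sigma>J * norm u \<le> norm (transpose (Jac c y) *v u)"
  using sv sJ by (intro norm_transpose_mult_ge_singular_value) auto

lemma Jac_upper: "y \<in> X \<Longrightarrow> norm (transpose (Jac c y) *v u) \<le> \<kappa>J * norm u"
  using sv sJ sJ_le by (intro norm_transpose_mult_le_singular_value) auto

section \<open>Uniform bounds on steps and penalties\<close>

lemma normal_step_bounds:
  assumes "reach k"
  shows "norm (c (x k) + J k *v v k) \<le> tau_norm P * norm (c (x k))"
    and "norm (v k) \<le> 1 / \<sigma>J * norm (c (x k))"
proof -
  have v: "v k = inexact_normal (J k) (c (x k)) (tau_norm P)"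
    using normal[OF assms] by (simp add: normal_phase_def Let_def)
  note b = inexact_normal_bounds[OF sJ Jac_lower[OF iter_in_X[OF assms]] less_imp_le[OF par(3)], of "c (x k)"]
  show "norm (c (x k) + J k *v v k) \<le> tau_norm P * norm (c (x k))"
    using b(1) by (simp add: v add.commute)
  show "norm (v k) \<le> 1 / \<sigma>J * norm (c (x k))"
    using b(2) sJ by (simp add: v field_simps)
qed

lemma pen_eq: "reach k \<Longrightarrow> pen T k = max (pen_trial f c P (x k) (v k)) (pen_prev P T k)"
  using normal[of k] by (simp add: normal_phase_def Let_def)

text \<open>This is \<open>\<pi>tilde\<close>. The first entry bounds the trial penalties:
  \<open>v k\<close> is at most \<open>1 / \<sigma>J\<close> times the constraint norm, which
  cancels in the quotient.\<close>

definition \<pi>max :: real where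
  "\<pi>max = max (\<kappa>g * (1 / \<sigma>J) / ((1 - rho P) * (1 - tau_norm P))) (pen_init P)"

lemma pen_trial_le: "reach k \<Longrightarrow> pen_trial f c P (x k) (v k) \<le> \<pi>max"
proof (cases "c (x k) = 0")
  case True
  then show ?thesis using par by (simp add: pen_trial_def \<pi>max_def less_imp_le le_max_iff_disj)
next
  case False
  assume r: "reach k"
  let ?q = "(1 - rho P) * (1 - tau_norm P)"
  have q: "0 < ?q" using par by simp
  have "g k \<bullet> v k \<le> norm (g k) * norm (v k)" by (rule norm_cauchy_schwarz)
  also have "\<dots> \<le> \<kappa>g * (1 / \<sigma>J * norm (c (x k)))"
    using kg iter_in_X[OF r] normal_step_bounds(2)[OF r] kg_nonneg by (intro mult_mono) auto
  finally have "(g k \<bullet> v k) / (?q * norm (c (x k))) \<le> (\<kappa>g * (1 / \<sigma>J * norm (c (x k)))) / (?q * norm (c (x k)))"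
    using q by (intro divide_right_mono) auto
  also have "\<dots> = \<kappa>g * (1 / \<sigma>J) / ?q"
  proof -
    have "a * (b * n) / (m * n) = a * b / m" if "n \<noteq> 0" for a b m n :: real
      using that by simp
    then show ?thesis using False by simp
  qed
  also have "\<dots> \<le> \<pi>max" by (simp add: \<pi>max_def)
  finally show ?thesis using False by (simp add: pen_trial_def)
qed

lemma pen_prev_bounds: "reach k \<Longrightarrow> pen_init P \<le> pen_prev P T k \<and> pen_prev P T k \<le> \<pi>max"
proof (induction k)
  case (Suc k)
  then have "reach k" using reached_mono by force
  then show ?case using Suc pen_eq[of k] pen_trial_le[of k] by (auto simp: pen_prev_def)
qed (simp add: pen_prev_def \<pi>max_def)

lemma pen_bounds:
  assumes "reach k"
  shows "pen_init P \<le> pen T k" "pen T k \<le> \<pi>max" "pen_prev P T k \<le> pen T k"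
  using pen_prev_bounds[OF assms] pen_eq[OF assms] pen_trial_le[OF assms] by auto

text \<open>For nonzero constraints this rearranges the trial penalty; otherwise the step bound
  forces \<open>v k = 0\<close>.\<close>

lemma normal_step_descent:
  assumes r: "reach k"
  shows "g k \<bullet> v k \<le> pen T k * ((1 - rho P) * (1 - tau_norm P) * norm (c (x k)))"
proof (cases "c (x k) = 0")
  case True
  then have "v k = 0" using normal_step_bounds(2)[OF r] by simp
  then show ?thesis using True by simp
next
  case False
  have "pen_trial f c P (x k) (v k) \<le> pen T k" using pen_eq[OF r] by simp
  moreover have "0 < (1 - rho P) * (1 - tau_norm P) * norm (c (x k))" using par False by simp
  ultimately show ?thesis using False by (simp add: pen_trial_def pos_divide_le_eq)
qed

text \<open>With a small projected gradient the step is zero. This satisfies the first two bounds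
  but need not satisfy the third, which is therefore conditional.\<close>

lemma tangential_step_bounds:
  assumes r: "reach k" and s: "\<not> stop k" and hb: "lagrangian_hessian_bound f c P T \<kappa>L"
  shows "norm (J k *v w k) \<le> - (tau_null P / pen T k) * (g k \<bullet> w k)"
    and "g k \<bullet> w k \<le> - min 1 (sigma P) * (norm (w k))\<^sup>2"
    and "\<not> small_proj_grad f P T k \<Longrightarrow> omega_tan P \<kappa>L * norm (Phat T k *v g k) \<le> norm (w k)"
proof -
  have "norm (J k *v w k) \<le> - (tau_null P / pen T k) * (g k \<bullet> w k)
    \<and> g k \<bullet> w k \<le> - min 1 (sigma P) * (norm (w k))\<^sup>2
    \<and> (\<not> small_proj_grad f P T k \<longrightarrow> omega_tan P \<kappa>L * norm (Phat T k *v g k) \<le> norm (w k))"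
  proof (cases "small_proj_grad f P T k")
    case True
    then have "w k = 0" using tangential[OF r s] by (simp add: tangential_phase_def Let_def)
    then show ?thesis using True by simp
  next
    case False
    define l where "l = mult T (Suc k)"
    define Z where "Z = Zmat T k"
    let ?H = "hessian (\<lambda>z. lagrangian f c z l) (x k)"
    have Z: "orthonormal_columns Z" "Phat T k = Z ** transpose Z"
      and w: "w k = projected_cr ?H (g k) Z (J k) (pen T k) (sigma P) (tau_tan P) (tau_null P)"
      using tangential[OF r s] False by (simp_all add: tangential_phase_def Let_def l_def Z_def)
    have PZ: "Phat T k *v u = Z *v (transpose Z *v u)" for u
      by (simp only: Z(2) matrix_vector_mul_assoc)
    have feas: "norm (J k *v (Z *v (transpose Z *v g k))) \<le> tau_null P / pen T k * (g k \<bullet> (Z *v (transpose Z *v g k)))"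
      using normal[OF r] False unfolding normal_phase_def small_proj_grad_def Let_def PZ by blast
    have k0: "0 \<le> \<kappa>L" and op: "opnorm ?H \<le> \<kappa>L"
      using hb r s False by (auto simp: lagrangian_hessian_bound_def l_def)
    have Hk: "norm (?H *v u) \<le> \<kappa>L * norm u" for u
      using norm_mult_le_opnorm[of ?H u] mult_right_mono[OF op norm_ge_zero[of u]] by linarith
    have om: "0 \<le> omega_tan P \<kappa>L" "0 < \<kappa>L \<Longrightarrow> omega_tan P \<kappa>L \<le> sigma P / \<kappa>L\<^sup>2"
      "omega_tan P \<kappa>L \<le> tau_tan P / sqrt ((tau_tan P)\<^sup>2 + \<kappa>L\<^sup>2)"
      using par(14,15) by (auto simp: omega_tan_def)
    note b = projected_cr_bounds[OF transpose_hessian[OF C2_lagrangian[OF C2f C2c]] Z(1) par(14,15) k0 Hk feas om w]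
    show ?thesis using b unfolding PZ by blast
  qed
  then show "norm (J k *v w k) \<le> - (tau_null P / pen T k) * (g k \<bullet> w k)"
    and "g k \<bullet> w k \<le> - min 1 (sigma P) * (norm (w k))\<^sup>2"
    and "\<not> small_proj_grad f P T k \<Longrightarrow> omega_tan P \<kappa>L * norm (Phat T k *v g k) \<le> norm (w k)"
    by blast+
qed

definition \<alpha> :: real where
  "\<alpha> = alpha_tilde P (1 - tau_norm P) (min 1 (sigma P)) (1 / \<sigma>J) \<pi>max Lf Lc \<kappa>c"

lemma merit_decrease:
  assumes r: "reach k" and s: "\<not> stop k" and hb: "lagrangian_hessian_bound f c P T \<kappa>L"
  shows "merit f c (pen T k) (x (Suc k)) \<le> merit f c (pen T k) (x k)
    - \<alpha> * eta P * (rho P * (1 - tau_norm P) * pen T k * norm (c (x k))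
        + (1 - tau_null P) * min 1 (sigma P) * (norm (w k))\<^sup>2)"
proof -
  have st: "step T k = v k + w k" and sz: "step_size T k = backtrack f c (theta P) (eta P) (pen T k) (x k) (v k + w k)"
    and it: "x (Suc k) = x k + step_size T k *\<^sub>R (v k + w k)"
    using update[OF r s] by (simp_all add: update_phase_def)
  have seg: "x k + a *\<^sub>R (v k + w k) \<in> X" if "0 \<le> a" "a \<le> 1" for a
    using segment_in_X[OF r s that] by (simp add: st)
  have "norm (grad f (x k + a *\<^sub>R (v k + w k)) - g k) \<le> Lf * (a * norm (v k + w k))"
    if a: "0 \<le> a" "a \<le> 1" for a
    using lipschitz_onD[OF lip_grad seg[OF a] iter_in_X[OF r]] a by (simp add: dist_norm)
  moreover have "norm (Jac c (x k + a *\<^sub>R (v k + w k)) *v u - J k *v u) \<le> Lc * (a * norm (v k + w k)) * norm u"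
    if a: "0 \<le> a" "a \<le> 1" for a u
  proof -
    let ?A = "Jac c (x k + a *\<^sub>R (v k + w k)) - J k"
    have "opnorm ?A \<le> Lc * dist (x k + a *\<^sub>R (v k + w k)) (x k)"
      using lip_Jac seg[OF a] iter_in_X[OF r] by blast
    then have op: "opnorm ?A \<le> Lc * (a * norm (v k + w k))" using a by (simp add: dist_norm)
    have "norm (?A *v u) \<le> opnorm ?A * norm u" by (rule norm_mult_le_opnorm)
    also have "\<dots> \<le> Lc * (a * norm (v k + w k)) * norm u" using op by (intro mult_right_mono) auto
    finally show ?thesis by (simp add: matrix_vector_mult_diff_rdistrib)
  qed
  moreover have "0 < min 1 (sigma P)" using par by simp
  ultimately show ?thesis
    unfolding it sz \<alpha>_def
    using kc iter_in_X[OF r]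
    by (intro backtracking_decrease[OF params C2_imp_differentiable[OF C2f] C2_imp_differentiable[OF C2c]
          _ _ Lf_nonneg Lc pen_bounds(1,2)[OF r] normal_step_bounds(2)[OF r] _ normal_step_bounds(1)[OF r]
          normal_step_descent[OF r] tangential_step_bounds(1,2)[OF r s hb]]) auto
qed

text \<open>The divisor is the penalty of the preceding iteration, so the initial value contains
  \<open>pen_init P\<close> and equals the numerator of the complexity bound.\<close>

definition potential :: "nat \<Rightarrow> real" where
  "potential k = (f (x k) - flow) / pen_prev P T k + norm (c (x k))"

lemma potential_nonneg: "reach k \<Longrightarrow> 0 \<le> potential k"
  using flow iter_in_X[of k] pen_prev_bounds[of k] par(7) unfolding potential_def
  by (intro add_nonneg_nonneg divide_nonneg_nonneg) auto

lemma \<pi>max_pos: "0 < \<pi>max"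
  using par(7) by (simp add: \<pi>max_def less_max_iff_disj)

lemma \<alpha>_pos: "0 < \<alpha>"
proof -
  have q: "0 \<le> \<pi>max * Lc + Lf" using \<pi>max_pos Lc Lf_nonneg
    by (intro add_nonneg_nonneg mult_nonneg_nonneg) auto
  have m: "0 < min ((1 - tau_null P) * min 1 (sigma P)) (pen_init P * (1 - tau_norm P) * rho P)"
    using par by simp
  show ?thesis
  proof (cases "\<pi>max * Lc + Lf = 0")
    case True
    then show ?thesis by (simp add: \<alpha>_def alpha_tilde_def)
  next
    case False
    then have "0 < \<pi>max * Lc + Lf" using q by linarith
    moreover have "0 < max 1 (\<kappa>c * (1 / \<sigma>J)\<^sup>2)" by (simp add: less_max_iff_disj)
    ultimately have "0 < theta P * (1 - eta P) * min ((1 - tau_null P) * min 1 (sigma P))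
        (pen_init P * (1 - tau_norm P) * rho P) / ((\<pi>max * Lc + Lf) * max 1 (\<kappa>c * (1 / \<sigma>J)\<^sup>2))"
      using m par by (intro divide_pos_pos mult_pos_pos) (auto simp del: min_less_iff_conj)
    then show ?thesis using False unfolding \<alpha>_def alpha_tilde_def by simp
  qed
qed

lemma omega_tan_pos: "0 \<le> \<kappa>L \<Longrightarrow> 0 < omega_tan P \<kappa>L"
proof -
  have "0 < sqrt ((tau_tan P)\<^sup>2 + \<kappa>L\<^sup>2)" using par(15) by (simp add: add_pos_nonneg)
  then show ?thesis using par(14,15) unfolding omega_tan_def by auto
qed

definition \<Gamma>1 :: real where
  "\<Gamma>1 = \<alpha> * eta P * rho P * (1 - tau_norm P)"
definition \<Gamma>2 :: "real \<Rightarrow> real" where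
  "\<Gamma>2 \<kappa>L = \<alpha> * eta P * (1 - tau_null P) * min 1 (sigma P) * (omega_tan P \<kappa>L)\<^sup>2 / \<pi>max"

lemma \<Gamma>_pos: "0 < \<Gamma>1" "0 \<le> \<kappa>L \<Longrightarrow> 0 < \<Gamma>2 \<kappa>L"
  using \<alpha>_pos \<pi>max_pos omega_tan_pos[of \<kappa>L] par unfolding \<Gamma>1_def \<Gamma>2_def
  by (auto intro!: divide_pos_pos mult_pos_pos zero_less_power)

lemma potential_decrease:
  assumes r: "reach k" and s: "\<not> stop k" and hb: "lagrangian_hessian_bound f c P T \<kappa>L"
  shows "potential (Suc k) \<le> potential k - min \<Gamma>1 (\<Gamma>2 \<kappa>L) * min (eps_c P) ((eps_p P)\<^sup>2)"
proof -
  let ?pn = "pen T k" and ?\<delta> = "min \<Gamma>1 (\<Gamma>2 \<kappa>L) * min (eps_c P) ((eps_p P)\<^sup>2)"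
  have k0: "0 \<le> \<kappa>L" using hb by (simp add: lagrangian_hessian_bound_def)
  have pn: "0 < ?pn" using pen_bounds(1)[OF r] par(7) by linarith
  let ?a = "\<Gamma>1 * norm (c (x k))"
  define b where "b = \<alpha> * eta P * (1 - tau_null P) * min 1 (sigma P) * (norm (w k))\<^sup>2 / ?pn"
  have a0: "0 \<le> ?a" using \<Gamma>_pos(1) by simp
  have b0: "0 \<le> b" unfolding b_def using \<alpha>_pos par pn by (intro divide_nonneg_nonneg mult_nonneg_nonneg) auto
  \<comment> \<open>Only one summand is known to be large and the other is merely nonnegative; this
    is the reason for the two minima.\<close>
  have "?\<delta> \<le> ?a + b"
  proof (cases "norm (c (x k)) \<le> eps_c P")
    case False
    have "?\<delta> \<le> \<Gamma>1 * norm (c (x k))"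
      using \<Gamma>_pos(1) \<Gamma>_pos(2)[OF k0] par(1,2) False by (intro mult_mono) auto
    then show ?thesis using b0 by linarith
  next
    case True
    then have ns: "\<not> small_proj_grad f P T k" using s by (simp add: stops_def)
    have om: "0 < omega_tan P \<kappa>L" using omega_tan_pos[OF k0] .
    have "omega_tan P \<kappa>L * eps_p P \<le> omega_tan P \<kappa>L * norm (Phat T k *v g k)"
      using ns om by (intro mult_left_mono) (auto simp: small_proj_grad_def)
    also have "\<dots> \<le> norm (w k)" by (rule tangential_step_bounds(3)[OF r s hb ns])
    finally have "(omega_tan P \<kappa>L * eps_p P)\<^sup>2 \<le> (norm (w k))\<^sup>2"
      using om par by (intro power_mono) auto
    then have "\<alpha> * eta P * (1 - tau_null P) * min 1 (sigma P) * (omega_tan P \<kappa>L * eps_p P)\<^sup>2 / \<pi>max \<le> b"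
      unfolding b_def using \<alpha>_pos par pn pen_bounds(2)[OF r]
      by (intro frac_le mult_left_mono mult_nonneg_nonneg) auto
    then have "\<Gamma>2 \<kappa>L * (eps_p P)\<^sup>2 \<le> b" by (simp add: \<Gamma>2_def power_mult_distrib mult_ac)
    moreover have "?\<delta> \<le> \<Gamma>2 \<kappa>L * (eps_p P)\<^sup>2"
      using \<Gamma>_pos(1) \<Gamma>_pos(2)[OF k0] par(1,2) by (intro mult_mono) auto
    ultimately show ?thesis using a0 by linarith
  qed
  moreover have "potential (Suc k) \<le> potential k - (?a + b)"
  proof -
    have "f (x (Suc k)) + ?pn * norm (c (x (Suc k))) \<le> f (x k) + ?pn * norm (c (x k)) - ?pn * (?a + b)"
    proof -
      have "?pn * b = \<alpha> * eta P * (1 - tau_null P) * min 1 (sigma P) * (norm (w k))\<^sup>2"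
        using pn by (simp add: b_def)
      then have "?pn * (?a + b) = \<alpha> * eta P * (rho P * (1 - tau_norm P) * ?pn * norm (c (x k))
          + (1 - tau_null P) * min 1 (sigma P) * (norm (w k))\<^sup>2)"
        unfolding \<Gamma>1_def distrib_left by (simp only: mult_ac)
      then show ?thesis using merit_decrease[OF r s hb] unfolding merit_def by linarith
    qed
    then have "(f (x (Suc k)) - flow + ?pn * norm (c (x (Suc k)))) / ?pn
        \<le> (f (x k) - flow + ?pn * norm (c (x k)) - ?pn * (?a + b)) / ?pn"
      using pn by (intro divide_right_mono) auto
    then have "(f (x (Suc k)) - flow) / ?pn + norm (c (x (Suc k)))
        \<le> (f (x k) - flow) / ?pn + norm (c (x k)) - (?a + b)"
      using pn by (simp add: add_divide_distrib diff_divide_distrib)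
    moreover have "(f (x k) - flow) / ?pn \<le> (f (x k) - flow) / pen_prev P T k"
      using flow iter_in_X[OF r] pen_bounds(3)[OF r] pen_prev_bounds[OF r] par(7)
      by (intro divide_left_mono mult_pos_pos) auto
    ultimately show ?thesis unfolding potential_def by (simp add: pen_prev_def)
  qed
  ultimately show ?thesis by linarith
qed

lemma stops_within:
  assumes hb: "lagrangian_hessian_bound f c P T \<kappa>L"
  shows "\<exists>k. int k < \<lceil>((f x0 - flow) / pen_init P + norm (c x0)) /
      (min \<Gamma>1 (\<Gamma>2 \<kappa>L) * min (eps_c P) ((eps_p P)\<^sup>2))\<rceil> + 1 \<and> reach k \<and> stop k"
proof -
  define \<delta> where "\<delta> = min \<Gamma>1 (\<Gamma>2 \<kappa>L) * min (eps_c P) ((eps_p P)\<^sup>2)"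
  have k0: "0 \<le> \<kappa>L" using hb by (simp add: lagrangian_hessian_bound_def)
  have d: "0 < \<delta>" unfolding \<delta>_def using \<Gamma>_pos(1) \<Gamma>_pos(2)[OF k0] par(1,2) by simp
  have p0: "potential 0 = (f x0 - flow) / pen_init P + norm (c x0)"
    using run by (simp add: potential_def pen_prev_def pdnmr_run_def)
  have dec: "reach n \<Longrightarrow> potential n \<le> potential 0 - real n * \<delta>" for n
  proof (induction n)
    case (Suc n)
    then have "reach n" "\<not> stop n" using reached_mono[of "Suc n" n] by (auto simp: reached_def)
    then show ?case using Suc potential_decrease[OF _ _ hb, of n, folded \<delta>_def] by (simp add: algebra_simps)
  qed simp
  let ?N = "\<lceil>potential 0 / \<delta>\<rceil>"
  have pos0: "0 \<le> potential 0" by (rule potential_nonneg) (simp add: reached_def)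
  then have "0 \<le> potential 0 / \<delta>" using d by simp
  then have "- 1 < potential 0 / \<delta>" by linarith
  then have N0: "0 \<le> ?N" by (simp only: zero_le_ceiling)
  have "\<exists>k. k \<le> nat ?N \<and> stop k"
  proof (rule ccontr)
    assume "\<not> (\<exists>k. k \<le> nat ?N \<and> stop k)"
    \<comment> \<open>The first \<open>?N\<close> decreases already exhaust the initial potential;
      one more would make it negative.\<close>
    then have r: "reach (Suc (nat ?N))" by (auto simp: reached_def less_Suc_eq_le)
    have "0 \<le> potential 0 - real (Suc (nat ?N)) * \<delta>"
      using dec[OF r] potential_nonneg[OF r] by linarith
    moreover have "potential 0 / \<delta> \<le> real (nat ?N)" using N0 by (simp add: le_of_int_ceiling)
    then have "potential 0 \<le> real (nat ?N) * \<delta>" using d by (simp only: pos_divide_le_eq)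
    ultimately show False using d by (simp add: algebra_simps)
  qed
  then obtain i where i: "i \<le> nat ?N" "stop i" by blast
  \<comment> \<open>\<open>reach\<close> requires that no earlier index stops, so the least stopping
    index is taken.\<close>
  define k where "k = (LEAST k. stop k)"
  have "k \<le> i" unfolding k_def using i(2) by (rule Least_le)
  then have kN: "k \<le> nat ?N" using i(1) by (rule order_trans)
  have sk: "stop k" unfolding k_def using i(2) by (rule LeastI)
  have "\<not> stop j" if "j < k" for j using that unfolding k_def by (rule not_less_Least)
  then have "reach k" by (simp add: reached_def)
  moreover have "int k < ?N + 1" using kN N0 by linarith
  ultimately show ?thesis using sk unfolding p0 \<delta>_def by blast
qed

lemma stop_imp_projected_gradient_small:
  assumes "reach k" "stop k"
  shows "norm (orth_proj (null_space (J k)) (g k)) \<le> eps_p P"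
proof -
  have "norm (orth_proj (null_space (J k)) (g k)) \<le> norm (Phat T k *v g k)"
    unfolding Phat_def using normal[OF assms(1)]
    by (intro norm_orth_proj_null_space_le) (simp add: normal_phase_def Let_def del: transpose_matrix_vector)
  then show ?thesis using assms(2) by (simp add: stops_def small_proj_grad_def)
qed

text \<open>On \<open>X\<close> the gradient of the Lagrangian has Lipschitz constant at most
  \<open>Lf + Lc * norm l\<close>, and the multipliers are uniformly bounded. Openness turns this
  constant into a bound on the Hessian.\<close>

lemma lagrangian_hessian_bound_exists:
  assumes "open X"
  shows "\<exists>\<kappa>. lagrangian_hessian_bound f c P T \<kappa>"
proof -
  \<comment> \<open>The LSMR bound for the matrix \<open>transpose (J k)\<close> and the vector
    \<open>g k\<close>.\<close>
  let ?m = "2 * \<kappa>J * \<kappa>g / \<sigma>J\<^sup>2"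
  have m0: "0 \<le> ?m" using kg_nonneg sJ sJ_le by simp
  let ?K = "Lf + Lc * ?m"
  have K0: "0 \<le> ?K" using m0 Lc Lf_nonneg by (intro add_nonneg_nonneg mult_nonneg_nonneg) auto
  have "opnorm (hessian (\<lambda>z. lagrangian f c z (mult T (Suc k))) (x k)) \<le> ?K"
    if r: "reach k" and s: "\<not> stop k" and ns: "\<not> small_proj_grad f P T k" for k
  proof -
    define l where "l = mult T (Suc k)"
    have xX: "x k \<in> X" by (rule iter_in_X[OF r])
    have "l = 0 \<or> (\<exists>t\<ge>1. l = lsmr_iterate (transpose (J k)) (g k) t)"
      using tangential[OF r s] ns unfolding tangential_phase_def Let_def l_def by simp
    then have l: "norm l \<le> ?m"
    proof
      assume "l = 0"
      then show ?thesis using m0 by simp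
    next
      assume "\<exists>t\<ge>1. l = lsmr_iterate (transpose (J k)) (g k) t"
      then obtain t where t: "l = lsmr_iterate (transpose (J k)) (g k) t" by blast
      have "norm l \<le> 2 * \<kappa>J * norm (g k) / \<sigma>J\<^sup>2"
        unfolding t using sJ sJ_le by (intro norm_lsmr_iterate_le Jac_lower[OF xX] Jac_upper[OF xX]) auto
      also have "\<dots> \<le> ?m" using kg xX sJ sJ_le by (intro divide_right_mono mult_left_mono) auto
      finally show ?thesis .
    qed
    let ?G = "grad (\<lambda>z. lagrangian f c z l)"
    let ?H = "hessian (\<lambda>z. lagrangian f c z l) (x k)"
    have dG: "(?G has_derivative (\<lambda>h. ?H *v h)) (at (x k))"
      using C2_imp_grad_differentiable[OF C2_lagrangian[OF C2f C2c]]
      unfolding hessian_def by (simp add: jacobian_works[symmetric])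
    have lip: "norm (?G y - ?G (x k)) \<le> ?K * norm (y - x k)" if y: "y \<in> X" for y
    proof -
      let ?A = "Jac c y - J k"
      have tr: "transpose ?A = transpose (Jac c y) - transpose (J k)"
        by (simp add: vec_eq_iff transpose_def)
      have "?G y - ?G (x k) = (grad f y - g k) + transpose ?A *v l"
        unfolding grad_lagrangian[OF C2f C2c] tr matrix_vector_mult_diff_rdistrib by simp
      then have "norm (?G y - ?G (x k)) \<le> norm (grad f y - g k) + norm (transpose ?A *v l)"
        by (simp only: norm_triangle_ineq)
      also have "norm (grad f y - g k) \<le> Lf * norm (y - x k)"
        using lipschitz_onD[OF lip_grad y xX] by (simp add: dist_norm)
      also have "norm (transpose ?A *v l) \<le> opnorm ?A * norm l" by (rule norm_transpose_mult_le_opnorm)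
      also have "\<dots> \<le> (Lc * norm (y - x k)) * ?m"
        using lip_Jac y xX l Lc by (intro mult_mono) (auto simp: dist_norm)
      finally show ?thesis by (simp add: algebra_simps)
    qed
    have "opnorm ?H \<le> ?K"
      using lipschitz_imp_derivative_bound[OF assms xX dG lip] K0 by (intro onorm_bound) auto
    then show ?thesis by (simp only: l_def)
  qed
  then show ?thesis using K0 unfolding lagrangian_hessian_bound_def by blast
qed

end

theorem theorem2:
  fixes f :: "real^'d \<Rightarrow> real"
    and c :: "real^'d \<Rightarrow> real^'c"
    and P :: pdnmr_params
    and x0 :: "real^'d"
    and l0 :: "real^'c"
    and T :: "('d, 'c) pdnmr_trace"
    and X :: "(real^'d) set"
    and \<sigma>J \<kappa>J Lf Lc flow \<kappa>g \<kappa>c \<kappa>L :: real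
    and \<gamma>norm \<nu>u \<gamma>tan \<omega>tan \<pi>tilde \<alpha>tilde \<Gamma>c \<Gamma>p :: real
    and K :: int
  assumes "C2 f" and "C2 c"
    and "valid_params P"
    and "pdnmr_run f c P x0 l0 T"
    and "visited f c P T \<subseteq> X"
    and "0 < \<sigma>J" and "\<sigma>J \<le> \<kappa>J"
    and "\<forall>x\<in>X. \<sigma>J \<le> singular_value CARD('c) (Jac c x) \<and>
               singular_value CARD('c) (Jac c x) \<le> singular_value 1 (Jac c x) \<and>
               singular_value 1 (Jac c x) \<le> \<kappa>J"
    and "Lf-lipschitz_on X (grad f)"
    and "0 \<le> Lc" and "\<forall>x\<in>X. \<forall>y\<in>X. opnorm (Jac c x - Jac c y) \<le> Lc * dist x y"
    and "\<forall>x\<in>X. flow \<le> f x"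
    and "\<forall>x\<in>X. norm (grad f x) \<le> \<kappa>g"
    and "\<forall>x\<in>X. norm (c x) \<le> \<kappa>c"
    and "\<gamma>norm = 1 - tau_norm P"
    and "\<nu>u = 1 / \<sigma>J"
    and "\<gamma>tan = min 1 (sigma P)"
    and "\<omega>tan = omega_tan P \<kappa>L"
    and "\<pi>tilde = max (\<kappa>g * \<nu>u / ((1 - rho P) * \<gamma>norm)) (pen_init P)"
    and "\<alpha>tilde = alpha_tilde P \<gamma>norm \<gamma>tan \<nu>u \<pi>tilde Lf Lc \<kappa>c"
    and "\<Gamma>c = \<alpha>tilde * eta P * rho P * \<gamma>norm"
    and "\<Gamma>p = \<alpha>tilde * eta P * (1 - tau_null P) * \<gamma>tan * \<omega>tan\<^sup>2 / \<pi>tilde"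
    and "K = \<lceil>((f x0 - flow) / pen_init P + norm (c x0)) /
              (min \<Gamma>c \<Gamma>p * min (eps_c P) ((eps_p P)\<^sup>2))\<rceil> + 1"
  shows "(open X \<longrightarrow> (\<exists>\<kappa>. lagrangian_hessian_bound f c P T \<kappa>)) \<and>
         (lagrangian_hessian_bound f c P T \<kappa>L \<longrightarrow>
            0 < \<Gamma>c \<and> 0 < \<Gamma>p \<and>
            (\<exists>k. int k < K \<and> reached f c P T k \<and>
                 norm (c (iter T k)) \<le> eps_c P \<and>
                 norm (orth_proj (null_space (Jac c (iter T k))) (grad f (iter T k))) \<le> eps_p P))"
proof -
  interpret pdnmr f c P x0 l0 T X \<sigma>J \<kappa>J Lf Lc flow \<kappa>g \<kappa>c
    by unfold_locales (rule assms)+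
  have "0 < \<Gamma>c \<and> 0 < \<Gamma>p \<and>
      (\<exists>k. int k < K \<and> reached f c P T k \<and> norm (c (iter T k)) \<le> eps_c P \<and>
        norm (orth_proj (null_space (Jac c (iter T k))) (grad f (iter T k))) \<le> eps_p P)"
    if hb: "lagrangian_hessian_bound f c P T \<kappa>L"
  proof -
    have G: "\<Gamma>c = \<Gamma>1" "\<Gamma>p = \<Gamma>2 \<kappa>L" by (simp_all only: assms(15-22) \<Gamma>1_def \<Gamma>2_def \<alpha>_def \<pi>max_def)
    have "0 \<le> \<kappa>L" using hb by (simp add: lagrangian_hessian_bound_def)
    moreover obtain k where k: "int k < K" "reached f c P T k" "stops f c P T k"
      using stops_within[OF hb] unfolding G[symmetric] assms(23)[symmetric] by blast
    moreover have "norm (c (iter T k)) \<le> eps_c P" using k(3) by (simp add: stops_def)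
    ultimately show ?thesis
      using \<Gamma>_pos(1) \<Gamma>_pos(2)[of \<kappa>L] stop_imp_projected_gradient_small[of k] unfolding G by blast
  qed
  then show ?thesis using lagrangian_hessian_bound_exists by blast
qed

end
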